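(* Let $L$ be a filtered shifted $L_\infty$-algebra over a field $\Bbbk$ of characteristic zero and let $$\big\{\rho^{(n)}=\rho^{(n)}_0(t_0)+dt_0\,\rho^{(n)}_1(t_0)\big\}_{n\ge1}$$ be a sequence of $1$-cells in $\mathfrak{MC}_\bullet(L)$ such that, for all $n\ge1$, $$\rho^{(n)}_1(t_0)\in\mathcal F_nL\,\hat\otimes\,\Bbbk[t_0]\qquad\text{and}\qquad\rho^{(n)}_0(1)=\rho^{(n+1)}_0(0).$$ Then there exists a sequence of $1$-cells $$\big\{\gamma^{(n)}=\gamma^{(n)}_0(t_0)+dt_0\,\gamma^{(n)}_1(t_0)\big\}_{n\ge1}$$ in $\mathfrak{MC}_\bullet(L)$ such that, for all $n\ge1$, $$\gamma^{(n)}_0(0)=\rho^{(1)}_0(0),\qquad\gamma^{(n)}_0(1)=\rho^{(n)}_0(1),\qquad \gamma^{(n+1)}-\gamma^{(n)}\in\mathcal F_{n+1}L\,\hat\otimes\,\Omega_1 .$$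
   Context: A shifted $L_\infty$-algebra is a cochain complex $(L,\partial)$ (unbounded, over $\Bbbk$) with a degree $1$ coderivation $\mathcal Q$, $\mathcal Q^2=0$, of the cocommutative coalgebra $\underline S(L)=L\oplus S^2(L)\oplus\cdots$ with $\mathcal Q(v)=\partial v$ for $v\in L$; equivalently, degree $1$ graded symmetric brackets $\{v_1,\dots,v_m\}_m=\mathcal Q'(v_1\cdots v_m)$, $m\ge2$, where $\mathcal Q'$ is $\mathcal Q$ followed by projection to $L$, satisfying the corresponding relations. It is filtered if $L$ has a descending filtration by subcomplexes $L=\mathcal F_1L\supset\mathcal F_2L\supset\cdots$, complete in the sense that $L=\varprojlim_kL/\mathcal F_kL$, with $\{\mathcal F_{i_1}L,\dots,\mathcal F_{i_m}L\}_m\subseteq\mathcal F_{i_1+\cdots+i_m}L$ for $m>1$. MC elements are $\alpha\in L^0$ with $\mathrm{curv}(\alpha):=\partial\alpha+\sum_{m\ge2}\frac1{m!}\{\alpha,\dots,\alpha\}_m=0$. Twisted differential: $\partial^\alpha(v)=\partial v+\sum_{k\ge1}\frac1{k!}\{\alpha,\dots,\alpha,v\}_{k+1}$. $\Omega_n$ is Sullivan's dg algebra of polynomial differential forms on $\Delta^n$; in particular $\Omega_1=\Bbbk[t_0]\oplus\Bbbk[t_0]\,dt_0$. $L\hat\otimes\Omega_n=\varprojlim_k((L/\mathcal F_kL)\otimes\Omega_n)$ is a filtered shifted $L_\infty$-algebra with filtration $\mathcal F_mL\hat\otimes\Omega_n$, differential $\partial+d$ and brackets extended $\Omega_n$-multilinearly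 with Koszul signs; $\mathcal F_mL\hat\otimes\Bbbk[t_0]$ denotes the analogous completed tensor product. $\mathfrak{MC}_\bullet(L)$ is the simplicial set with $\mathfrak{MC}_n(L)=\mathrm{MC}(L\hat\otimes\Omega_n)$. A $1$-cell is an element $\beta=\beta_0(t_0)+dt_0\,\beta_1(t_0)$ with $\beta_0\in L^0\hat\otimes\Bbbk[t_0]$, $\beta_1\in L^{-1}\hat\otimes\Bbbk[t_0]$, satisfying $\mathrm{curv}(\beta_0(t_0))=0$ and $\frac{d}{dt_0}\beta_0(t_0)=\partial^{\beta_0(t_0)}\beta_1(t_0)$. *)

theory Defs
  imports Complex_Main "HOL-Library.FuncSet" "HOL-Library.Function_Algebras" "HOL-Library.Product_Plus"
begin

text \<open>
  A graded vector space is a family of subspaces \<open>Gr L d\<close>, \<open>d\<close> an integer, of one ambient vector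
  space; only homogeneous elements are ever used.  No independence of the \<open>Gr L d\<close> in the ambient
  space is needed, since the degree of an argument is always passed along explicitly:
  \<open>Diff L d\<close> is the differential on \<open>Gr L d\<close>, and \<open>Brk L\<close> takes a list of pairs
  (degree, element).  Only lists of length at least 2 and filtration indices at least 1 are relevant.
\<close>

record ('k, 'v) Linf =
  Scal :: "'k \<Rightarrow> 'v \<Rightarrow> 'v"
  Gr :: "int \<Rightarrow> 'v set"
  Filt :: "nat \<Rightarrow> int \<Rightarrow> 'v set"
  Diff :: "int \<Rightarrow> 'v \<Rightarrow> 'v"
  Brk :: "(int \<times> 'v) list \<Rightarrow> 'v"

definition signed :: "int \<Rightarrow> 'v::ab_group_add \<Rightarrow> 'v" where
  "signed e v = (if even e then v else - v)"

definition homog :: "('k, 'v) Linf \<Rightarrow> (int \<times> 'v) list \<Rightarrow> bool" where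
  "homog L xs \<longleftrightarrow> (\<forall>(d, v) \<in> set xs. v \<in> Gr L d)"

definition total_deg :: "(int \<times> 'v) list \<Rightarrow> int" where
  "total_deg xs = sum_list (map fst xs)"

text \<open>All operations together: the unary one is the differential.\<close>

definition Op :: "('k, 'v) Linf \<Rightarrow> (int \<times> 'v) list \<Rightarrow> 'v" where
  "Op L xs = (if length xs = 1 then Diff L (fst (hd xs)) (snd (hd xs)) else Brk L xs)"

text \<open>
  Exponent of the Koszul sign of the unshuffle that moves the entries with index in \<open>A\<close>
  in front of the others, keeping the order within both groups.
\<close>

definition koszul :: "int list \<Rightarrow> nat set \<Rightarrow> int" where
  "koszul ds A = (\<Sum>(i, j) | i < j \<and> j < length ds \<and> i \<notin> A \<and> j \<in> A. ds ! i * ds ! j)"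

text \<open>
  The axiom \<open>relations\<close> says that the coderivation with corestriction \<open>Op L\<close>,
  which sends a product of homogeneous elements to the sum over all unshuffles of
  (operation applied to the first group) times (second group), squares to zero.
\<close>

locale shifted_Linf = vector_space "Scal L"
  for L :: "('k::field, 'v::ab_group_add) Linf" +
  assumes Gr_subspace: "subspace (Gr L d)"
    and Diff_in: "v \<in> Gr L d \<Longrightarrow> Diff L d v \<in> Gr L (d + 1)"
    and Diff_add: "\<lbrakk>v \<in> Gr L d; w \<in> Gr L d\<rbrakk> \<Longrightarrow> Diff L d (v + w) = Diff L d v + Diff L d w"
    and Diff_scale: "v \<in> Gr L d \<Longrightarrow> Diff L d (Scal L c v) = Scal L c (Diff L d v)"
    and Brk_in: "\<lbrakk>length xs \<ge> 2; homog L xs\<rbrakk> \<Longrightarrow> Brk L xs \<in> Gr L (total_deg xs + 1)"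
    and Brk_add: "\<lbrakk>length xs + length ys \<ge> 1; homog L (xs @ ys); v \<in> Gr L d; w \<in> Gr L d\<rbrakk> \<Longrightarrow>
      Brk L (xs @ (d, v + w) # ys) = Brk L (xs @ (d, v) # ys) + Brk L (xs @ (d, w) # ys)"
    and Brk_scale: "\<lbrakk>length xs + length ys \<ge> 1; homog L (xs @ ys); v \<in> Gr L d\<rbrakk> \<Longrightarrow>
      Brk L (xs @ (d, Scal L c v) # ys) = Scal L c (Brk L (xs @ (d, v) # ys))"
    and Brk_symmetric: "\<lbrakk>homog L (xs @ ys); v \<in> Gr L d; w \<in> Gr L e\<rbrakk> \<Longrightarrow>
      Brk L (xs @ (d, v) # (e, w) # ys) = signed (d * e) (Brk L (xs @ (e, w) # (d, v) # ys))"
    and relations: "\<lbrakk>xs \<noteq> []; homog L xs\<rbrakk> \<Longrightarrow>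
      (\<Sum>A | A \<subseteq> {..<length xs} \<and> A \<noteq> {}.
        signed (koszul (map fst xs) A)
          (Op L ((total_deg (nths xs A) + 1, Op L (nths xs A)) # nths xs (- A)))) = 0"

text \<open>Quotients as sets of cosets, and the limit of the quotients over the indices \<open>k \<ge> 1\<close>.\<close>

definition quot :: "'v::ab_group_add set \<Rightarrow> 'v set \<Rightarrow> 'v set set" where
  "quot V W = (\<lambda>v. (+) v ` W) ` V"

definition lim_quot :: "'v::ab_group_add set \<Rightarrow> (nat \<Rightarrow> 'v set) \<Rightarrow> (nat \<Rightarrow> 'v set) set" where
  "lim_quot V F = {c \<in> (\<Pi>\<^sub>E k\<in>{1..}. quot V (F k)). \<forall>k\<ge>1. c (Suc k) \<subseteq> c k}"

locale filtered_shifted_Linf = shifted_Linf L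
  for L :: "('k::field, 'v::ab_group_add) Linf" +
  assumes Filt_subspace: "n \<ge> 1 \<Longrightarrow> subspace (Filt L n d)"
    and Filt_1: "Filt L 1 d = Gr L d"
    and Filt_desc: "n \<ge> 1 \<Longrightarrow> Filt L (Suc n) d \<subseteq> Filt L n d"
    and Filt_Diff: "\<lbrakk>n \<ge> 1; v \<in> Filt L n d\<rbrakk> \<Longrightarrow> Diff L d v \<in> Filt L n (d + 1)"
    and Filt_complete: "bij_betw (\<lambda>v. \<lambda>k\<in>{1..}. (+) v ` Filt L k d)
      (Gr L d) (lim_quot (Gr L d) (\<lambda>k. Filt L k d))"
    and Filt_Brk: "\<lbrakk>length xs \<ge> 2; length ns = length xs;
        \<And>i. i < length xs \<Longrightarrow> ns ! i \<ge> 1 \<and> snd (xs ! i) \<in> Filt L (ns ! i) (fst (xs ! i))\<rbrakk> \<Longrightarrow>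
      Brk L xs \<in> Filt L (sum_list ns) (total_deg xs + 1)"

text \<open>The sum, in degree \<open>d\<close>, of a series converging with respect to the filtration.\<close>

definition fsum :: "('k, 'v::ab_group_add) Linf \<Rightarrow> int \<Rightarrow> (nat \<Rightarrow> 'v) \<Rightarrow> 'v" where
  "fsum L d f = (THE v. v \<in> Gr L d \<and> (\<forall>k\<ge>1. \<exists>N. \<forall>n\<ge>N. (\<Sum>i<n. f i) - v \<in> Filt L k d))"

definition curv :: "('k::field_char_0, 'v::ab_group_add) Linf \<Rightarrow> 'v \<Rightarrow> 'v" where
  "curv L \<alpha> = Diff L 0 \<alpha> +
     fsum L 1 (\<lambda>j. Scal L (1 / fact (j + 2)) (Brk L (replicate (j + 2) (0, \<alpha>))))"

definition MC :: "('k::field_char_0, 'v::ab_group_add) Linf \<Rightarrow> 'v set" where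
  "MC L = {\<alpha> \<in> Gr L 0. curv L \<alpha> = 0}"

text \<open>
  \<open>ctens L m d\<close> is the degree \<open>d\<close> part of the completed tensor product of \<open>Filt L m\<close> with the
  polynomial ring in \<open>t\<close>.  Its elements are represented by their coefficients, as series
  \<open>x 0 + x 1 * t + x 2 * t ^ 2 + \<dots>\<close> that become polynomials modulo each step of the filtration.
  The lemma \<open>ctens_eq_lim\<close> below identifies this with the inverse limit.
\<close>

definition ctens :: "('k, 'v) Linf \<Rightarrow> nat \<Rightarrow> int \<Rightarrow> (nat \<Rightarrow> 'v) set" where
  "ctens L m d = {x. (\<forall>i. x i \<in> Filt L m d) \<and> (\<forall>k\<ge>1. finite {i. x i \<notin> Filt L k d})}"

definition quot_poly :: "'v::ab_group_add set \<Rightarrow> 'v set \<Rightarrow> (nat \<Rightarrow> 'v set) set" where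
  "quot_poly V W = {p. (\<forall>i. p i \<in> quot V W) \<and> finite {i. p i \<noteq> W}}"

definition lim_quot_poly ::
    "'v::ab_group_add set \<Rightarrow> (nat \<Rightarrow> 'v set) \<Rightarrow> (nat \<Rightarrow> nat \<Rightarrow> 'v set) set" where
  "lim_quot_poly V F =
     {p \<in> (\<Pi>\<^sub>E k\<in>{1..}. quot_poly V (F k)). \<forall>k\<ge>1. \<forall>i. p (Suc k) i \<subseteq> p k i}"

lemma (in filtered_shifted_Linf) ctens_eq_lim:
  assumes m: "m \<ge> 1"
  shows "bij_betw (\<lambda>x. \<lambda>k\<in>{1..}. \<lambda>i. (+) (x i) ` (Filt L m d \<inter> Filt L k d))
    (ctens L m d) (lim_quot_poly (Filt L m d) (\<lambda>k. Filt L m d \<inter> Filt L k d))"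
    (is "bij_betw ?h _ _")
proof -
  define V where "V = Filt L m d"
  define W where "W = (\<lambda>k. V \<inter> Filt L k d)"
  have subV: "subspace V" unfolding V_def using Filt_subspace m by blast
  have subF: "subspace (Filt L k d)" if "k \<ge> 1" for k using Filt_subspace that by blast
  have subW: "subspace (W k)" if "k \<ge> 1" for k
    unfolding W_def using subspace_inter[OF subV subF[OF that]] .
  have V_Gr: "V \<subseteq> Gr L d"
  proof -
    have "Filt L n d \<subseteq> Filt L 1 d" if "n \<ge> 1" for n
      using that by (induction n rule: dec_induct) (use Filt_desc in auto)
    then show ?thesis unfolding V_def using m Filt_1 by blast
  qed
  have cosI: "v \<in> (+) v ` U" if "subspace U" for v U
    using subspace_0[OF that] by (metis add.right_neutral image_eqI)
  have coseq: "(+) v ` U = (+) w ` U \<longleftrightarrow> v - w \<in> U" if U: "subspace U" for v w U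
  proof
    assume "(+) v ` U = (+) w ` U"
    then obtain u where "v = w + u" "u \<in> U" using cosI[OF U, of v] by auto
    then show "v - w \<in> U" by simp
  next
    have sub: "(+) v' ` U \<subseteq> (+) w' ` U" if h: "v' - w' \<in> U" for v' w'
    proof
      fix x assume "x \<in> (+) v' ` U"
      then obtain u where u: "x = v' + u" "u \<in> U" by auto
      have "x = w' + ((v' - w') + u)" using u by simp
      then show "x \<in> (+) w' ` U" using subspace_add[OF U h u(2)] by blast
    qed
    assume h: "v - w \<in> U"
    then have "w - v \<in> U" using subspace_neg[OF U h] by simp
    then show "(+) v ` U = (+) w ` U" using sub h by blast
  qed
  have cos0: "(+) v ` U = U \<longleftrightarrow> v \<in> U" if U: "subspace U" for v U
    using coseq[OF U, of v 0] by simp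
  let ?c = "\<lambda>v. \<lambda>k\<in>{1..}. (+) v ` Filt L k d"
  have inj: "inj_on ?c (Gr L d)" and onto: "?c ` Gr L d = lim_quot (Gr L d) (\<lambda>k. Filt L k d)"
    using Filt_complete[of d] by (auto simp: bij_betw_def)
  have sep: "v = w" if "v \<in> Gr L d" "w \<in> Gr L d" "\<And>k. k \<ge> 1 \<Longrightarrow> v - w \<in> Filt L k d" for v w
  proof -
    have "?c v = ?c w" by (rule restrict_ext) (use coseq subF that(3) in auto)
    then show ?thesis using inj that(1,2) by (auto dest: inj_onD)
  qed
  have compl: "\<exists>v\<in>Gr L d. \<forall>k\<ge>1. v - y k \<in> Filt L k d"
    if y: "\<And>k. k \<ge> 1 \<Longrightarrow> y k \<in> Gr L d" "\<And>k. k \<ge> 1 \<Longrightarrow> y (Suc k) - y k \<in> Filt L k d" for y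
  proof -
    have "(+) (y (Suc k)) ` Filt L (Suc k) d \<subseteq> (+) (y k) ` Filt L k d" if k: "k \<ge> 1" for k
    proof -
      have "(+) (y (Suc k)) ` Filt L k d = (+) (y k) ` Filt L k d"
        using coseq[OF subF[OF k]] y(2)[OF k] by blast
      then show ?thesis using Filt_desc[OF k, of d] by blast
    qed
    then have "(\<lambda>k\<in>{1..}. (+) (y k) ` Filt L k d) \<in> lim_quot (Gr L d) (\<lambda>k. Filt L k d)"
      unfolding lim_quot_def quot_def using y(1) by auto
    then obtain v where v: "v \<in> Gr L d" "(\<lambda>k\<in>{1..}. (+) (y k) ` Filt L k d) = ?c v"
      using onto by blast
    have "v - y k \<in> Filt L k d" if k: "k \<ge> 1" for k
      using fun_cong[OF v(2), of k] k coseq[OF subF[OF k], of v "y k"] by simp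
    then show ?thesis using v(1) by blast
  qed
  have fin: "finite {i. (+) (x i) ` W k \<noteq> W k} \<longleftrightarrow> finite {i. x i \<notin> Filt L k d}"
    if "k \<ge> 1" "\<And>i. x i \<in> V" for x k
    using that cos0[OF subW[OF that(1)]] by (simp add: W_def)
  have "inj_on ?h (ctens L m d)"
  proof (rule inj_onI)
    fix x y assume x: "x \<in> ctens L m d" and y: "y \<in> ctens L m d" and e: "?h x = ?h y"
    have xy: "x i \<in> Gr L d" "y i \<in> Gr L d" for i
      using x y V_Gr by (auto simp: ctens_def V_def)
    have "x i - y i \<in> Filt L k d" if k: "k \<ge> 1" for i k
    proof -
      have "(+) (x i) ` W k = (+) (y i) ` W k"
        using fun_cong[OF fun_cong[OF e, of k], of i] k by (simp add: W_def V_def)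
      then show ?thesis using coseq[OF subW[OF k]] by (auto simp: W_def)
    qed
    then show "x = y" using sep xy by blast
  qed
  moreover have "?h ` ctens L m d \<subseteq> lim_quot_poly V W"
  proof (rule image_subsetI)
    fix x assume x: "x \<in> ctens L m d"
    then have xV: "x i \<in> V" for i by (simp add: ctens_def V_def)
    have hx: "?h x = (\<lambda>k\<in>{1..}. \<lambda>i. (+) (x i) ` W k)" by (simp add: W_def V_def)
    have "(\<lambda>i. (+) (x i) ` W k) \<in> quot_poly V (W k)" if k: "k \<ge> 1" for k
      using fin[OF k, of x] xV x k by (auto simp: quot_poly_def quot_def ctens_def)
    moreover have "W (Suc k) \<subseteq> W k" if "k \<ge> 1" for k
      using Filt_desc[OF that, of d] by (auto simp: W_def)
    ultimately show "?h x \<in> lim_quot_poly V W" unfolding hx lim_quot_poly_def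
      by (auto simp: image_subset_iff)
  qed
  moreover have "lim_quot_poly V W \<subseteq> ?h ` ctens L m d"
  proof
    fix p assume p: "p \<in> lim_quot_poly V W"
    have pq: "p k \<in> quot_poly V (W k)" if "k \<ge> 1" for k
      using p that by (auto simp: lim_quot_poly_def)
    have pext: "p \<in> extensional {1..}" using p by (auto simp: lim_quot_poly_def PiE_def)
    have "\<exists>v\<in>V. p k i = (+) v ` W k" if "k \<ge> 1" for k i
    proof -
      have "p k i \<in> quot V (W k)" using pq[OF that] by (simp add: quot_poly_def)
      then show ?thesis unfolding quot_def by blast
    qed
    then obtain y where y: "\<And>k i. k \<ge> 1 \<Longrightarrow> y k i \<in> V \<and> p k i = (+) (y k i) ` W k" by metis
    have step: "y (Suc k) i - y k i \<in> W k" if k: "k \<ge> 1" for k i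
    proof -
      have "p (Suc k) i \<subseteq> p k i" using p k by (auto simp: lim_quot_poly_def)
      moreover have "y (Suc k) i \<in> p (Suc k) i"
        using y[of "Suc k" i] cosI[OF subW[of "Suc k"]] by auto
      ultimately have "y (Suc k) i \<in> (+) (y k i) ` W k" using y[OF k] by auto
      then show ?thesis by auto
    qed
    have "\<exists>v\<in>Gr L d. \<forall>k\<ge>1. v - y k i \<in> Filt L k d" for i
      by (rule compl) (use y V_Gr step in \<open>auto simp: W_def\<close>)
    then obtain x where x: "\<And>i k. k \<ge> 1 \<Longrightarrow> x i - y k i \<in> Filt L k d" by metis
    have xV: "x i \<in> V" for i
      using subspace_add[OF subV, of "x i - y m i" "y m i"] x[OF m] y[OF m] by (simp add: V_def)
    have pk: "p k i = (+) (x i) ` W k" if k: "k \<ge> 1" for k i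
    proof -
      have "x i - y k i \<in> W k"
        using x[OF k] subspace_diff[OF subV xV] y[OF k] by (simp add: W_def)
      then show ?thesis using coseq[OF subW[OF k]] y[OF k] by blast
    qed
    have "finite {i. x i \<notin> Filt L k d}" if k: "k \<ge> 1" for k
      using pq[OF k] fin[OF k, of x] xV pk[OF k] by (simp add: quot_poly_def)
    then have "x \<in> ctens L m d" using xV by (simp add: ctens_def V_def)
    moreover have "p = ?h x"
    proof
      fix k show "p k = ?h x k"
        using pk[of k] pext by (cases "k \<ge> 1") (auto simp: W_def V_def extensional_def)
    qed
    ultimately show "p \<in> ?h ` ctens L m d" by blast
  qed
  ultimately show ?thesis by (simp add: bij_betw_def V_def[symmetric] W_def set_eq_subset)
qed

text \<open>Value at \<open>t = c\<close> of an element of \<open>ctens L 1 d\<close>.\<close>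

definition ev :: "('k::field, 'v::ab_group_add) Linf \<Rightarrow> int \<Rightarrow> 'k \<Rightarrow> (nat \<Rightarrow> 'v) \<Rightarrow> 'v" where
  "ev L d c x = fsum L d (\<lambda>i. Scal L (c ^ i) (x i))"

text \<open>Extension of the brackets that is multilinear over the polynomial ring in \<open>t\<close>.\<close>

definition Brk_t :: "('k, 'v::ab_group_add) Linf \<Rightarrow> (int \<times> (nat \<Rightarrow> 'v)) list \<Rightarrow> nat \<Rightarrow> 'v" where
  "Brk_t L xs n = (\<Sum>is | length is = length xs \<and> sum_list is = n.
     Brk L (map2 (\<lambda>(d, x) i. (d, x i)) xs is))"

text \<open>
  The completed tensor product of \<open>L\<close> with the polynomial forms on the 1-simplex: the pair
  \<open>(a, b)\<close> stands for \<open>a(t) + dt b(t)\<close>, so that in degree \<open>d\<close> the entry \<open>b\<close> has degree \<open>d - 1\<close>.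
  Moving \<open>dt\<close> to the front past the differential or the bracket, both of degree 1, and past the
  preceding arguments produces the signs.  Terms with two factors \<open>dt\<close> vanish.
\<close>

definition tensor_Omega1 ::
    "('k::field, 'v::ab_group_add) Linf \<Rightarrow> ('k, (nat \<Rightarrow> 'v) \<times> (nat \<Rightarrow> 'v)) Linf" where
  "tensor_Omega1 L = \<lparr>
     Scal = (\<lambda>c (a, b). (\<lambda>i. Scal L c (a i), \<lambda>i. Scal L c (b i))),
     Gr = (\<lambda>d. ctens L 1 d \<times> ctens L 1 (d - 1)),
     Filt = (\<lambda>m d. ctens L m d \<times> ctens L m (d - 1)),
     Diff = (\<lambda>d (a, b). (\<lambda>i. Diff L d (a i),
       \<lambda>i. Scal L (of_nat (Suc i)) (a (Suc i)) - Diff L (d - 1) (b i))),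
     Brk = (\<lambda>xs. (Brk_t L (map (\<lambda>(d, a, b). (d, a)) xs),
       \<Sum>j<length xs. signed (1 + total_deg (take j xs))
         (Brk_t L (map (\<lambda>(d, a, b). (d, a)) (take j xs)
           @ (\<lambda>(d, a, b). (d - 1, b)) (xs ! j)
           # map (\<lambda>(d, a, b). (d, a)) (drop (Suc j) xs)))))\<rparr>"

text \<open>
  The set of 1-cells of the simplicial set of Maurer-Cartan elements.  For \<open>a + dt b\<close> of degree 0
  the Maurer-Cartan equation splits into \<open>curv a = 0\<close> and \<open>da/dt = \<close> (differential of \<open>L\<close>
  twisted by \<open>a\<close>) applied to \<open>b\<close>.
\<close>

definition MC_cells1 :: "('k::field_char_0, 'v::ab_group_add) Linf \<Rightarrow> ((nat \<Rightarrow> 'v) \<times> (nat \<Rightarrow> 'v)) set" where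
  "MC_cells1 L = MC (tensor_Omega1 L)"

end

theory Submission imports Defs begin

text \<open>
  Let \<open>\<gamma> = a + dt b\<close> be a cell ending where \<open>\<rho> = r + dt c\<close> starts, with \<open>c\<close> deep in the filtration.
  Deform \<open>\<gamma>\<close>, as a Maurer-Cartan element over the polynomial forms in \<open>t\<close>, by the gauge flow in a
  new variable \<open>s\<close> generated by \<open>\<eta> = t c(s)\<close>.  At \<open>t = 0\<close> the generator vanishes, so the starting
  point stays fixed; at \<open>t = 1\<close> it is \<open>c\<close>, so by uniqueness of the flow the end point runs along \<open>r\<close>
  and arrives at the end of \<open>\<rho>\<close> when \<open>s = 1\<close>.  The deformation is as deep in the filtration as \<open>c\<close>.
  The flow equations are solved by contraction, and the relations of the extended algebra
  \<open>L[t]\<close> hold because they hold after evaluation at every scalar, of which there are infinitely many.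
\<close>

section \<open>Filtration, convergent series and contractions\<close>

text \<open>Running \<gamma> and \<rho> one after the other is not an option: two polynomial paths
  concatenate only to a piecewise polynomial one, and the result would not be close to \<gamma>. So
  \<gamma> keeps its parameter and only its end point is moved; the factor t in \<eta> is 0 at the
  fixed end and 1 at the moving one.

  The deformation involves two polynomial variables. Both come from one construction,
  \<open>polyL\<close>, applied twice, which forces the proof that \<open>polyL L\<close> is again a
  filtered shifted algebra. Checking its relations directly would drag Koszul signs through sums
  over compositions.

  No small time interval is available to make the integral equations contract. The filtration
  replaces it: a bracket with two or more entries raises the filtration, while the differential only
  preserves it, and the unknown enters the flow equations only inside brackets that also contain
  \<eta>. The cell equations are not imposed along the flow. Their failures satisfy linear equations
  with initial value 0 that become homogeneous once the curvature vanishes, and uniqueness makes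
  them 0.\<close>

context vector_space
begin

lemma coset_eq_iff:
  assumes W: "subspace W"
  shows "(+) v ` W = (+) w ` W \<longleftrightarrow> v - w \<in> W"
proof
  assume "(+) v ` W = (+) w ` W"
  moreover have "v \<in> (+) v ` W"
    using subspace_0[OF W] by (metis add.right_neutral image_eqI)
  ultimately obtain u where "v = w + u" "u \<in> W" by auto
  then show "v - w \<in> W" by simp
next
  have sub: "(+) v' ` W \<subseteq> (+) w' ` W" if h: "v' - w' \<in> W" for v' w'
  proof
    fix x assume "x \<in> (+) v' ` W"
    then obtain u where u: "x = w' + ((v' - w') + u)" "u \<in> W" by auto
    then show "x \<in> (+) w' ` W" using subspace_add[OF W h u(2)] by blast
  qed
  assume h: "v - w \<in> W"
  then have "w - v \<in> W" using subspace_neg[OF W h] by simp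
  then show "(+) v ` W = (+) w ` W" using sub h by blast
qed

text \<open>Injectivity is separatedness, and surjectivity is convergence of sequences with small
  steps. Both directions serve: one extracts limits in \<open>L\<close>, the other proves that the
  polynomials over \<open>L\<close> are complete.\<close>

lemma bij_lim_quot_iff:
  assumes V: "subspace V" and F: "\<And>k. k \<ge> 1 \<Longrightarrow> subspace (F k)"
    and desc: "\<And>k. k \<ge> 1 \<Longrightarrow> F (Suc k) \<subseteq> F k"
  shows "bij_betw (\<lambda>v. \<lambda>k\<in>{1..}. (+) v ` F k) V (lim_quot V F) \<longleftrightarrow>
    (\<forall>v\<in>V. (\<forall>k\<ge>1. v \<in> F k) \<longrightarrow> v = 0) \<and>
    (\<forall>y. (\<forall>k\<ge>1. y k \<in> V \<and> y (Suc k) - y k \<in> F k) \<longrightarrow> (\<exists>v\<in>V. \<forall>k\<ge>1. v - y k \<in> F k))"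
    (is "bij_betw ?c _ _ \<longleftrightarrow> ?sep \<and> ?compl")
proof -
  have ceq: "(\<lambda>k\<in>{1..}. (+) (x k) ` F k) = (\<lambda>k\<in>{1..}. (+) (y k) ` F k) \<longleftrightarrow>
      (\<forall>k\<ge>1. x k - y k \<in> F k)" for x y
  proof -
    have "(\<lambda>k\<in>{1..}. (+) (x k) ` F k) = (\<lambda>k\<in>{1..}. (+) (y k) ` F k) \<longleftrightarrow>
      (\<forall>k\<ge>1. (+) (x k) ` F k = (+) (y k) ` F k)"
      by (auto simp: restrict_def fun_eq_iff)
    then show ?thesis using coset_eq_iff[OF F] by auto
  qed
  \<comment> \<open>A compatible family of cosets amounts to a sequence of representatives: nesting
    of the cosets at \<open>Suc k\<close> and \<open>k\<close> says that the step of the sequence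
    lies in \<open>F k\<close>.\<close>
  have lim: "lim_quot V F = {(\<lambda>k\<in>{1..}. (+) (y k) ` F k) |y. \<forall>k\<ge>1. y k \<in> V \<and> y (Suc k) - y k \<in> F k}"
    (is "_ = ?R")
  proof (intro equalityI subsetI)
    fix p assume p: "p \<in> lim_quot V F"
    have "\<forall>k\<ge>1. \<exists>v\<in>V. p k = (+) v ` F k"
      using p by (simp add: lim_quot_def quot_def PiE_def Pi_def image_iff)
    then obtain y where y: "\<And>k. k \<ge> 1 \<Longrightarrow> y k \<in> V \<and> p k = (+) (y k) ` F k" by metis
    have "y (Suc k) - y k \<in> F k" if k: "k \<ge> 1" for k
    proof -
      have "y (Suc k) \<in> (+) (y (Suc k)) ` F (Suc k)"
        using subspace_0[OF F[of "Suc k"]] by (auto intro: image_eqI[of _ _ 0])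
      moreover have "p (Suc k) \<subseteq> p k" using p k by (auto simp: lim_quot_def)
      ultimately have "y (Suc k) \<in> (+) (y k) ` F k" using k y[of k] y[of "Suc k"] by auto
      then show ?thesis by auto
    qed
    moreover have "p = (\<lambda>k\<in>{1..}. (+) (y k) ` F k)"
      using p y by (auto simp: lim_quot_def PiE_def extensional_def fun_eq_iff)
    ultimately show "p \<in> ?R" using y by blast
  next
    fix p assume "p \<in> ?R"
    then obtain y where p: "p = (\<lambda>k\<in>{1..}. (+) (y k) ` F k)"
      and y: "\<And>k. k \<ge> 1 \<Longrightarrow> y k \<in> V \<and> y (Suc k) - y k \<in> F k" by blast
    have "(+) (y (Suc k)) ` F (Suc k) \<subseteq> (+) (y k) ` F k" if k: "k \<ge> 1" for k
    proof -
      have "(+) (y (Suc k)) ` F k = (+) (y k) ` F k" using coset_eq_iff[OF F[OF k]] y[OF k] by blast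
      then show ?thesis using desc[OF k] by blast
    qed
    then show "p \<in> lim_quot V F" using y by (auto simp: p lim_quot_def quot_def)
  qed
  have "inj_on ?c V \<longleftrightarrow> ?sep"
  proof
    assume i: "inj_on ?c V"
    have "v = 0" if "v \<in> V" "\<forall>k\<ge>1. v \<in> F k" for v
      using inj_onD[OF i, of v 0] that ceq[of "\<lambda>_. v" "\<lambda>_. 0"] subspace_0[OF V] by auto
    then show ?sep by blast
  next
    assume s: ?sep
    show "inj_on ?c V"
    proof (rule inj_onI)
      fix v w assume "v \<in> V" "w \<in> V" "?c v = ?c w"
      then show "v = w" using ceq[of "\<lambda>_. v" "\<lambda>_. w"] s subspace_diff[OF V, of v w] by auto
    qed
  qed
  moreover have "?c ` V = lim_quot V F \<longleftrightarrow> ?compl"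
  proof -
    have "?c ` V \<subseteq> lim_quot V F" unfolding lim using subspace_0[OF F] by auto
    then have "?c ` V = lim_quot V F \<longleftrightarrow> lim_quot V F \<subseteq> ?c ` V" by auto
    also have "\<dots> \<longleftrightarrow> (\<forall>y. (\<forall>k\<ge>1. y k \<in> V \<and> y (Suc k) - y k \<in> F k) \<longrightarrow>
        (\<exists>v\<in>V. (\<lambda>k\<in>{1..}. (+) (y k) ` F k) = ?c v))"
      unfolding lim by (auto simp: image_iff)
    also have "\<dots> \<longleftrightarrow> ?compl"
    proof -
      have "y k - v \<in> F k \<longleftrightarrow> v - y k \<in> F k" if "k \<ge> 1" for y v and k :: nat
        using subspace_neg[OF F[OF that], of "y k - v"] subspace_neg[OF F[OF that], of "v - y k"] by auto
      then show ?thesis unfolding ceq by auto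
    qed
    finally show ?thesis .
  qed
  ultimately show ?thesis by (auto simp: bij_betw_def)
qed

end

section \<open>Closure properties of the filtration, separatedness and limits\<close>

context filtered_shifted_Linf
begin

lemma Filt_Suc_0 [simp]: "Filt L (Suc 0) d = Gr L d"
  using Filt_1 by simp

lemma Filt_mono: assumes "1 \<le> k" "k \<le> n" shows "Filt L n d \<subseteq> Filt L k d"
  using assms(2)
proof (induction n rule: dec_induct)
  case (step n) then show ?case using Filt_desc[of n d] assms(1) by auto
qed auto

lemma Filt_le: "v \<in> Filt L n d \<Longrightarrow> 1 \<le> k \<Longrightarrow> k \<le> n \<Longrightarrow> v \<in> Filt L k d"
  using Filt_mono by blast

lemma Filt_Gr: "v \<in> Filt L n d \<Longrightarrow> 1 \<le> n \<Longrightarrow> v \<in> Gr L d"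
  using Filt_le[of v n d 1] Filt_1[of d] by auto

lemma Filt_0: "1 \<le> n \<Longrightarrow> 0 \<in> Filt L n d"
  using Filt_subspace subspace_0 by blast

lemma Filt_add: "1 \<le> n \<Longrightarrow> v \<in> Filt L n d \<Longrightarrow> w \<in> Filt L n d \<Longrightarrow> v + w \<in> Filt L n d"
  using Filt_subspace subspace_add by blast

lemma Filt_diff: "1 \<le> n \<Longrightarrow> v \<in> Filt L n d \<Longrightarrow> w \<in> Filt L n d \<Longrightarrow> v - w \<in> Filt L n d"
  using Filt_subspace subspace_diff by blast

lemma Filt_neg: "1 \<le> n \<Longrightarrow> v \<in> Filt L n d \<Longrightarrow> - v \<in> Filt L n d"
  using Filt_subspace subspace_neg by blast

lemma Filt_scale: "1 \<le> n \<Longrightarrow> v \<in> Filt L n d \<Longrightarrow> Scal L c v \<in> Filt L n d"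
  using Filt_subspace subspace_scale by blast

lemma Filt_sum: "1 \<le> n \<Longrightarrow> (\<And>i. i \<in> I \<Longrightarrow> f i \<in> Filt L n d) \<Longrightarrow> sum f I \<in> Filt L n d"
  using Filt_subspace subspace_sum by blast

lemma Filt_swap: "1 \<le> n \<Longrightarrow> v - w \<in> Filt L n d \<Longrightarrow> w - v \<in> Filt L n d"
  using Filt_neg[of n "v - w" d] by simp

lemma Filt_trans:
  "1 \<le> n \<Longrightarrow> u - v \<in> Filt L n d \<Longrightarrow> v - w \<in> Filt L n d \<Longrightarrow> u - w \<in> Filt L n d"
  using Filt_add[of n "u - v" d "v - w"] by simp

lemmas Gr_0 = Filt_0[of 1, unfolded Filt_1, simplified]
  and Gr_add = Filt_add[of 1, unfolded Filt_1, simplified]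
  and Gr_diff = Filt_diff[of 1, unfolded Filt_1, simplified]
  and Gr_neg = Filt_neg[of 1, unfolded Filt_1, simplified]
  and Gr_scale = Filt_scale[of 1, unfolded Filt_1, simplified]
  and Gr_sum = Filt_sum[of 1, unfolded Filt_1, simplified]

lemma Filt_sep_compl:
  "(\<forall>v\<in>Gr L d. (\<forall>k\<ge>1. v \<in> Filt L k d) \<longrightarrow> v = 0) \<and>
    (\<forall>y. (\<forall>k\<ge>1. y k \<in> Gr L d \<and> y (Suc k) - y k \<in> Filt L k d) \<longrightarrow>
      (\<exists>v\<in>Gr L d. \<forall>k\<ge>1. v - y k \<in> Filt L k d))"
  by (rule bij_lim_quot_iff[THEN iffD1, OF _ _ _ Filt_complete])
    (use Gr_subspace Filt_subspace Filt_desc in auto)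

lemma Filt_separated:
  assumes "v \<in> Gr L d" "\<And>k. k \<ge> 1 \<Longrightarrow> v \<in> Filt L k d"
  shows "v = 0"
  using conjunct1[OF Filt_sep_compl[of d]] assms by simp

lemma Filt_eqI:
  assumes "v \<in> Gr L d" "w \<in> Gr L d" "\<And>k. k \<ge> 1 \<Longrightarrow> v - w \<in> Filt L k d"
  shows "v = w"
  using Filt_separated[OF Gr_diff[OF assms(1,2)] assms(3)] by simp

lemma Filt_limit:
  assumes "\<And>k. k \<ge> 1 \<Longrightarrow> y k \<in> Gr L d" "\<And>k. k \<ge> 1 \<Longrightarrow> y (Suc k) - y k \<in> Filt L k d"
  obtains v where "v \<in> Gr L d" "\<And>k. k \<ge> 1 \<Longrightarrow> v - y k \<in> Filt L k d"
proof -
  have "\<forall>k\<ge>1. y k \<in> Gr L d \<and> y (Suc k) - y k \<in> Filt L k d" using assms by simp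
  then have "\<exists>v\<in>Gr L d. \<forall>k\<ge>1. v - y k \<in> Filt L k d"
    using conjunct2[OF Filt_sep_compl[of d], rule_format, of y] by blast
  then show ?thesis using that by blast
qed

section \<open>Completed polynomials and sums of convergent series\<close>

lemma ctens_iff:
  "x \<in> ctens L m d \<longleftrightarrow> (\<forall>i. x i \<in> Filt L m d) \<and> (\<forall>k\<ge>1. \<exists>N. \<forall>i\<ge>N. x i \<in> Filt L k d)"
proof -
  have "finite {i. x i \<notin> W} \<longleftrightarrow> (\<exists>N. \<forall>i\<ge>N. x i \<in> W)" for W
    unfolding finite_nat_set_iff_bounded by (auto simp: not_less[symmetric])
  then show ?thesis by (simp add: ctens_def)
qed

lemma ctens_Filt: "x \<in> ctens L m d \<Longrightarrow> x i \<in> Filt L m d"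
  by (simp add: ctens_iff)

lemma ctens_Gr: "x \<in> ctens L 1 d \<Longrightarrow> x i \<in> Gr L d"
  using ctens_Filt[of x 1 d i] by simp

lemma ctens_tail:
  assumes "x \<in> ctens L m d" "k \<ge> 1"
  obtains N where "\<And>i. i \<ge> N \<Longrightarrow> x i \<in> Filt L k d"
  using assms unfolding ctens_iff by blast

lemma ctens_mono: "x \<in> ctens L m d \<Longrightarrow> 1 \<le> k \<Longrightarrow> k \<le> m \<Longrightarrow> x \<in> ctens L k d"
  using Filt_le unfolding ctens_iff by blast

lemma ctensI:
  assumes "\<And>i. x i \<in> Filt L m d" "\<And>k. k \<ge> 1 \<Longrightarrow> \<exists>N. \<forall>i\<ge>N. x i \<in> Filt L k d"
  shows "x \<in> ctens L m d"
  using assms by (auto simp: ctens_iff)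

lemma ctens_add:
  assumes "1 \<le> m" "x \<in> ctens L m d" "y \<in> ctens L m d"
  shows "(\<lambda>i. x i + y i) \<in> ctens L m d"
proof (rule ctensI)
  fix k :: nat assume k: "k \<ge> 1"
  obtain M N where "\<And>i. i \<ge> M \<Longrightarrow> x i \<in> Filt L k d" "\<And>i. i \<ge> N \<Longrightarrow> y i \<in> Filt L k d"
    using ctens_tail[OF assms(2) k] ctens_tail[OF assms(3) k] by metis
  then have "\<forall>i\<ge>max M N. x i + y i \<in> Filt L k d" using Filt_add[OF k] by simp
  then show "\<exists>N. \<forall>i\<ge>N. x i + y i \<in> Filt L k d" by blast
qed (use Filt_add assms ctens_Filt in blast)

lemma ctens_scale_coeff:
  assumes "1 \<le> m" "x \<in> ctens L m d"
  shows "(\<lambda>i. Scal L (c i) (x i)) \<in> ctens L m d"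
  using assms Filt_scale unfolding ctens_iff by meson

lemma ctens_0: "1 \<le> m \<Longrightarrow> (\<lambda>i. 0) \<in> ctens L m d"
  using Filt_0 by (auto simp: ctens_iff)

text \<open>Terms tending to zero are summable because the steps of the filtration are subspaces:
  all partial sums beyond \<open>N k\<close> agree modulo step \<open>k\<close>. Separatedness makes
  the limit unique.\<close>

lemma fsum_ex:
  assumes f: "f \<in> ctens L 1 d"
  shows "\<exists>!v. v \<in> Gr L d \<and> (\<forall>k\<ge>1. \<exists>N. \<forall>n\<ge>N. (\<Sum>i<n. f i) - v \<in> Filt L k d)"
proof -
  have "\<forall>k. \<exists>N. k \<ge> 1 \<longrightarrow> (\<forall>i\<ge>N. f i \<in> Filt L k d)"
    using f by (auto simp: ctens_iff)
  then obtain N where N: "\<And>k i. k \<ge> 1 \<Longrightarrow> i \<ge> N k \<Longrightarrow> f i \<in> Filt L k d" by metis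
  have tail: "(\<Sum>i<n. f i) - (\<Sum>i<n'. f i) \<in> Filt L k d" if k: "k \<ge> 1" and n: "N k \<le> n" "N k \<le> n'" for k n n'
  proof -
    have *: "(\<Sum>i<b. f i) - (\<Sum>i<a. f i) \<in> Filt L k d" if "N k \<le> a" "a \<le> b" for a b
    proof -
      have "(\<Sum>i<b. f i) - (\<Sum>i<a. f i) = (\<Sum>i\<in>{a..<b}. f i)"
        using sum_diff_nat_ivl[of 0 a b f] that by (simp add: lessThan_atLeast0)
      also have "\<dots> \<in> Filt L k d" by (intro Filt_sum[OF k] N[OF k]) (use that in auto)
      finally show ?thesis .
    qed
    then show ?thesis using *[of n n'] *[of n' n] n Filt_swap[OF k] by (cases "n \<le> n'") auto
  qed
  \<comment> \<open>\<open>N\<close> need not be monotone. The cumulative sums bound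
    \<open>N k\<close> both at \<open>k\<close> and at \<open>Suc k\<close>, so consecutive chosen
    partial sums agree modulo step \<open>k\<close>.\<close>
  define M where "M k = (\<Sum>j\<le>k. N j)" for k
  have M: "N k \<le> M k" "N k \<le> M (Suc k)" for k
    unfolding M_def by (auto intro: member_le_sum[of k "{..k}" N] trans_le_add1)
  obtain v where v: "v \<in> Gr L d" "\<And>k. k \<ge> 1 \<Longrightarrow> v - (\<Sum>i<M k. f i) \<in> Filt L k d"
    by (rule Filt_limit[of "\<lambda>k. \<Sum>i<M k. f i" d])
      (use f ctens_Gr tail M in \<open>auto intro!: Gr_sum\<close>)
  have "(\<Sum>i<n. f i) - v \<in> Filt L k d" if k: "k \<ge> 1" and n: "n \<ge> N k" for k n
    using Filt_trans[OF k tail[OF k n M(1)] Filt_swap[OF k v(2)[OF k]]] .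
  then have ex: "\<forall>k\<ge>1. \<exists>N. \<forall>n\<ge>N. (\<Sum>i<n. f i) - v \<in> Filt L k d" by blast
  show ?thesis
  proof (rule ex1I[of _ v])
    fix w assume w: "w \<in> Gr L d \<and> (\<forall>k\<ge>1. \<exists>N. \<forall>n\<ge>N. (\<Sum>i<n. f i) - w \<in> Filt L k d)"
    show "w = v"
    proof (rule Filt_eqI)
      fix k :: nat assume k: "k \<ge> 1"
      obtain A B where "\<forall>n\<ge>A. (\<Sum>i<n. f i) - w \<in> Filt L k d" "\<forall>n\<ge>B. (\<Sum>i<n. f i) - v \<in> Filt L k d"
        using w ex k by meson
      then show "w - v \<in> Filt L k d"
        using Filt_trans[OF k Filt_swap[OF k], of "\<Sum>i<max A B. f i" w d v] by auto
    qed (use w v in auto)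
  qed (use ex v in auto)
qed

lemma fsum_Gr: "f \<in> ctens L 1 d \<Longrightarrow> fsum L d f \<in> Gr L d"
  and fsum_lim: "f \<in> ctens L 1 d \<Longrightarrow> k \<ge> 1 \<Longrightarrow> \<exists>N. \<forall>n\<ge>N. (\<Sum>i<n. f i) - fsum L d f \<in> Filt L k d"
  unfolding fsum_def using theI'[OF fsum_ex, of f d] by auto

lemma fsum_eqI:
  assumes "f \<in> ctens L 1 d" "v \<in> Gr L d"
    "\<And>k. k \<ge> 1 \<Longrightarrow> \<exists>N. \<forall>n\<ge>N. (\<Sum>i<n. f i) - v \<in> Filt L k d"
  shows "fsum L d f = v"
  unfolding fsum_def by (rule the1_equality[OF fsum_ex[OF assms(1)]]) (use assms in simp)

lemma fsum_mod:
  assumes f: "f \<in> ctens L 1 d" and k: "k \<ge> 1" and n: "\<And>i. i \<ge> n \<Longrightarrow> f i \<in> Filt L k d"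
  shows "fsum L d f - (\<Sum>i<n. f i) \<in> Filt L k d"
proof -
  obtain N where "\<forall>n\<ge>N. (\<Sum>i<n. f i) - fsum L d f \<in> Filt L k d" using fsum_lim[OF f k] by blast
  then have "(\<Sum>i<max n N. f i) - fsum L d f \<in> Filt L k d" by simp
  moreover have "(\<Sum>i<max n N. f i) - (\<Sum>i<n. f i) \<in> Filt L k d"
  proof -
    have "(\<Sum>i<max n N. f i) - (\<Sum>i<n. f i) = (\<Sum>i\<in>{n..<max n N}. f i)"
      using sum_diff_nat_ivl[of 0 n "max n N" f] by (simp add: lessThan_atLeast0)
    also have "\<dots> \<in> Filt L k d" by (intro Filt_sum[OF k] n) auto
    finally show ?thesis .
  qed
  ultimately show ?thesis using Filt_trans[OF k Filt_swap[OF k]] by blast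
qed

lemma fsum_Filt:
  assumes f: "f \<in> ctens L m d" and m: "m \<ge> 1"
  shows "fsum L d f \<in> Filt L m d"
  using fsum_mod[of f d m 0] ctens_mono[OF f, of 1] ctens_Filt[OF f] m by auto

lemma fsum_add:
  assumes "f \<in> ctens L 1 d" "g \<in> ctens L 1 d"
  shows "fsum L d (\<lambda>i. f i + g i) = fsum L d f + fsum L d g"
proof (rule fsum_eqI)
  fix k :: nat assume k: "k \<ge> 1"
  obtain M N where "\<forall>n\<ge>M. (\<Sum>i<n. f i) - fsum L d f \<in> Filt L k d"
      "\<forall>n\<ge>N. (\<Sum>i<n. g i) - fsum L d g \<in> Filt L k d"
    using fsum_lim[OF assms(1) k] fsum_lim[OF assms(2) k] by meson
  then have "(\<Sum>i<n. f i + g i) - (fsum L d f + fsum L d g) \<in> Filt L k d" if "n \<ge> max M N" for n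
    using Filt_add[OF k, of "(\<Sum>i<n. f i) - fsum L d f" d "(\<Sum>i<n. g i) - fsum L d g"] that
    by (simp add: sum.distrib algebra_simps)
  then show "\<exists>N. \<forall>n\<ge>N. (\<Sum>i<n. f i + g i) - (fsum L d f + fsum L d g) \<in> Filt L k d" by blast
qed (use assms ctens_add[of 1] fsum_Gr Gr_add in auto)

lemma fsum_finite:
  assumes "\<And>i. f i \<in> Gr L d" "\<And>i. i \<ge> n \<Longrightarrow> f i = 0"
  shows "fsum L d f = (\<Sum>i<n. f i)"
proof (rule fsum_eqI)
  have "(\<Sum>i<m. f i) - (\<Sum>i<n. f i) = 0" if "m \<ge> n" for m
    using that assms(2) by (simp, intro sum.mono_neutral_right) auto
  then show "\<exists>N. \<forall>m\<ge>N. (\<Sum>i<m. f i) - (\<Sum>i<n. f i) \<in> Filt L k d" if "k \<ge> 1" for k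
    using Filt_0[OF that] by metis
next
  have "\<forall>i\<ge>n. f i \<in> Filt L k d" if "k \<ge> 1" for k using assms(2) Filt_0[OF that] by simp
  then show "f \<in> ctens L 1 d" unfolding ctens_iff using assms(1) by auto
qed (use assms in \<open>auto intro!: Gr_sum\<close>)

lemma fsum_zero [simp]: "fsum L d (\<lambda>i. 0) = 0"
  using fsum_finite[of "\<lambda>i. 0" d 0] Gr_0 by simp

end

text \<open>The degree is an argument of a map, as the graded pieces need not be independent.\<close>

definition filt_hom :: "('k, 'v::ab_group_add) Linf \<Rightarrow> ('k, 'w::ab_group_add) Linf \<Rightarrow> (int \<Rightarrow> 'v \<Rightarrow> 'w) \<Rightarrow> bool" where
  "filt_hom L M f \<longleftrightarrow> (\<forall>d. (\<forall>k\<ge>1. \<forall>v\<in>Filt L k d. f d v \<in> Filt M k d) \<and>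
    (\<forall>v\<in>Gr L d. \<forall>w\<in>Gr L d. f d (v + w) = f d v + f d w) \<and>
    (\<forall>v\<in>Gr L d. \<forall>c. f d (Scal L c v) = Scal M c (f d v)))"

lemma filt_homI:
  assumes "\<And>d k v. k \<ge> 1 \<Longrightarrow> v \<in> Filt L k d \<Longrightarrow> f d v \<in> Filt M k d"
    and "\<And>d v w. v \<in> Gr L d \<Longrightarrow> w \<in> Gr L d \<Longrightarrow> f d (v + w) = f d v + f d w"
    and "\<And>d v c. v \<in> Gr L d \<Longrightarrow> f d (Scal L c v) = Scal M c (f d v)"
  shows "filt_hom L M f"
  using assms unfolding filt_hom_def by blast

text \<open>Continuous linear maps of degree 0. Scalar multiplication, evaluation, differentiation
  in a variable and coefficientwise application are all instances, so exchange with convergent sums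
  is proved once.\<close>

locale filt_map = L: filtered_shifted_Linf L + M: filtered_shifted_Linf M
  for L :: "('k::field, 'v::ab_group_add) Linf" and M :: "('k, 'w::ab_group_add) Linf" +
  fixes f :: "int \<Rightarrow> 'v \<Rightarrow> 'w"
  assumes hom: "filt_hom L M f"
begin

lemma in_Filt: "k \<ge> 1 \<Longrightarrow> v \<in> Filt L k d \<Longrightarrow> f d v \<in> Filt M k d"
  using hom by (auto simp: filt_hom_def)

lemma in_Gr: "v \<in> Gr L d \<Longrightarrow> f d v \<in> Gr M d"
  using in_Filt[of 1] by (simp add: L.Filt_1 M.Filt_1)

lemma add: "v \<in> Gr L d \<Longrightarrow> w \<in> Gr L d \<Longrightarrow> f d (v + w) = f d v + f d w"
  using hom by (auto simp: filt_hom_def)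

lemma scale: "v \<in> Gr L d \<Longrightarrow> f d (Scal L c v) = Scal M c (f d v)"
  using hom by (auto simp: filt_hom_def)

lemma zero: "f d 0 = 0"
  using scale[of 0 d 0] L.Gr_0 by simp

lemma neg: "v \<in> Gr L d \<Longrightarrow> f d (- v) = - f d v"
  using scale[of v d "-1"] by simp

lemma diff: "v \<in> Gr L d \<Longrightarrow> w \<in> Gr L d \<Longrightarrow> f d (v - w) = f d v - f d w"
  using add[of v d "- w"] neg L.Gr_neg[of w d] by simp

lemma sum: "(\<And>i. i \<in> I \<Longrightarrow> g i \<in> Gr L d) \<Longrightarrow> f d (sum g I) = (\<Sum>i\<in>I. f d (g i))"
  by (induction I rule: infinite_finite_induct) (auto simp: zero add L.Gr_sum)

lemma in_ctens: "m \<ge> 1 \<Longrightarrow> x \<in> ctens L m d \<Longrightarrow> (\<lambda>i. f d (x i)) \<in> ctens M m d"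
  unfolding L.ctens_iff M.ctens_iff using in_Filt by blast

lemma fsum:
  assumes g: "g \<in> ctens L 1 d"
  shows "f d (fsum L d g) = fsum M d (\<lambda>i. f d (g i))"
proof (rule M.fsum_eqI[symmetric])
  fix k :: nat assume k: "k \<ge> 1"
  then obtain N where N: "\<forall>n\<ge>N. (\<Sum>i<n. g i) - fsum L d g \<in> Filt L k d" using L.fsum_lim[OF g] by blast
  have "(\<Sum>i<n. f d (g i)) - f d (fsum L d g) = f d ((\<Sum>i<n. g i) - fsum L d g)" for n
    by (subst diff) (use L.ctens_Gr[OF g] L.fsum_Gr[OF g] in \<open>auto simp: sum intro!: L.Gr_sum\<close>)
  then show "\<exists>N. \<forall>n\<ge>N. (\<Sum>i<n. f d (g i)) - f d (fsum L d g) \<in> Filt M k d"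
    using N in_Filt[OF k] by metis
qed (use in_ctens[of 1] g in_Gr L.fsum_Gr in auto)

end

context filtered_shifted_Linf
begin

lemma filt_map_scale: "filt_map L L (\<lambda>d. Scal L c)"
  by unfold_locales (auto intro!: filt_homI Filt_scale scale_right_distrib simp: mult.commute)

lemmas fsum_scale = filt_map.fsum[OF filt_map_scale]

lemma fsum_sum:
  assumes "\<And>i. i \<in> I \<Longrightarrow> f i \<in> ctens L 1 d" "finite I"
  shows "fsum L d (\<lambda>n. \<Sum>i\<in>I. f i n) = (\<Sum>i\<in>I. fsum L d (f i))"
    and "(\<lambda>n. \<Sum>i\<in>I. f i n) \<in> ctens L 1 d"
  using assms(2,1) by (induction I rule: finite_induct) (auto simp: fsum_add ctens_0 ctens_add)

lemma ctens_shift: "x \<in> ctens L m d \<Longrightarrow> (\<lambda>i. x (Suc i)) \<in> ctens L m d"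
  unfolding ctens_iff by (meson le_SucI)

lemma fsum_Suc:
  assumes f: "f \<in> ctens L 1 d"
  shows "fsum L d f = f 0 + fsum L d (\<lambda>i. f (Suc i))"
proof (rule fsum_eqI[OF f])
  fix k :: nat assume k: "k \<ge> 1"
  obtain N where N: "\<forall>n\<ge>N. (\<Sum>i<n. f (Suc i)) - fsum L d (\<lambda>i. f (Suc i)) \<in> Filt L k d"
    using fsum_lim[OF ctens_shift[OF f] k] by blast
  have "(\<Sum>i<n. f i) - (f 0 + fsum L d (\<lambda>i. f (Suc i))) \<in> Filt L k d" if "n \<ge> Suc N" for n
  proof (cases n)
    case (Suc m)
    then show ?thesis using N that by (simp add: sum.lessThan_Suc_shift del: sum.lessThan_Suc)
  qed (use that in simp)
  then show "\<exists>N. \<forall>n\<ge>N. (\<Sum>i<n. f i) - (f 0 + fsum L d (\<lambda>i. f (Suc i))) \<in> Filt L k d" by blast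
qed (use ctens_Gr[OF f] fsum_Gr[OF ctens_shift[OF f]] Gr_add in auto)

text \<open>The iterates of 0 form a Cauchy sequence. Induction starts for free, since step 1 of the
  filtration is the whole graded piece, and each application of \<open>\<Phi>\<close> gains one
  step; the same count shows that two fixed points differ by an element of every step.\<close>

lemma contraction_fixed_point:
  assumes in_Gr: "\<And>x. x \<in> Gr L d \<Longrightarrow> \<Phi> x \<in> Gr L d"
    and contr: "\<And>k x y. k \<ge> 1 \<Longrightarrow> x \<in> Gr L d \<Longrightarrow> y \<in> Gr L d \<Longrightarrow> x - y \<in> Filt L k d \<Longrightarrow>
      \<Phi> x - \<Phi> y \<in> Filt L (Suc k) d"
  shows "\<exists>!x. x \<in> Gr L d \<and> \<Phi> x = x"
proof -
  define y where "y k = (\<Phi> ^^ k) 0" for k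
  have yG: "y k \<in> Gr L d" for k by (induction k) (auto simp: y_def Gr_0 in_Gr)
  have yS: "y (Suc k) - y k \<in> Filt L k d" if "k \<ge> 1" for k
    using that
  proof (induction k rule: dec_induct)
    case base show ?case using yG Gr_diff by simp
  next
    case (step k)
    then show ?case using contr[of k "y (Suc k)" "y k"] yG[of k] yG[of "Suc k"] by (simp add: y_def)
  qed
  obtain v where v: "v \<in> Gr L d" "\<And>k. k \<ge> 1 \<Longrightarrow> v - y k \<in> Filt L k d"
    using Filt_limit[of y d] yG yS by blast
  have uniq: "x = z" if x: "x \<in> Gr L d" "\<Phi> x = x" and z: "z \<in> Gr L d" "\<Phi> z = z" for x z
  proof (rule Filt_eqI[OF x(1) z(1)])
    fix k :: nat assume "k \<ge> 1"
    then show "x - z \<in> Filt L k d"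
    proof (induction k rule: dec_induct)
      case base show ?case using x z Gr_diff by simp
    next
      case (step k) then show ?case using contr[of k x z] x z by simp
    qed
  qed
  have "\<Phi> v = v"
  proof (rule Filt_eqI)
    fix k :: nat assume k: "k \<ge> 1"
    have "\<Phi> v - \<Phi> (y k) \<in> Filt L k d"
      using contr[OF k v(1) yG v(2)[OF k]] Filt_le k by (meson le_SucI order_refl)
    moreover have "\<Phi> (y k) - y k \<in> Filt L k d" using yS[OF k] by (simp add: y_def)
    ultimately show "\<Phi> v - v \<in> Filt L k d"
      using Filt_trans[OF k Filt_trans[OF k] Filt_swap[OF k v(2)[OF k]]] by blast
  qed (use v in_Gr in auto)
  then show ?thesis using uniq v by blast
qed

end

section \<open>Multilinear operations\<close>

lemma total_deg_simps [simp]: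
  "total_deg [] = 0"
  "total_deg ((d, v) # xs) = d + total_deg xs"
  "total_deg (xs @ ys) = total_deg xs + total_deg ys"
  "total_deg (replicate n (0, v)) = 0"
  by (auto simp: total_deg_def sum_list_replicate)

lemma homog_simps [simp]:
  "homog L []"
  "homog L ((d, v) # xs) \<longleftrightarrow> v \<in> Gr L d \<and> homog L xs"
  "homog L (xs @ ys) \<longleftrightarrow> homog L xs \<and> homog L ys"
  by (auto simp: homog_def)

lemma homog_replicate [simp]: "v \<in> Gr L d \<Longrightarrow> homog L (replicate n (d, v))"
  by (auto simp: homog_def)

lemma homog_nths: "homog L xs \<Longrightarrow> homog L (nths xs A)"
  using set_nths_subset[of xs A] by (auto simp: homog_def)

lemma homog_nth: "homog L xs \<Longrightarrow> i < length xs \<Longrightarrow> snd (xs ! i) \<in> Gr L (fst (xs ! i))"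
  by (metis (mono_tags, lifting) case_prod_beta homog_def nth_mem)

lemma sum_list_nths_compl:
  "sum_list (nths xs A) + sum_list (nths xs (- A)) = sum_list (xs :: 'a::comm_monoid_add list)"
  by (induction xs rule: rev_induct) (auto simp: nths_append nths_singleton algebra_simps)

lemma total_deg_nths_compl: "total_deg (nths xs A) + total_deg (nths xs (- A)) = total_deg xs"
  unfolding total_deg_def nths_map[symmetric] by (rule sum_list_nths_compl)

text \<open>The empty operation has a junk value in \<open>Op\<close>; it must vanish for the twisting formulas.\<close>

definition op0 :: "('k, 'v::ab_group_add) Linf \<Rightarrow> (int \<times> 'v) list \<Rightarrow> 'v" where
  "op0 L xs = (if xs = [] then 0 else Op L xs)"

lemma op0_Nil [simp]: "op0 L [] = 0"
  by (simp add: op0_def)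

lemma op0_single: "op0 L [(d, v)] = Diff L d v"
  by (simp add: op0_def Op_def)

lemma op0_Brk: "length xs \<ge> 2 \<Longrightarrow> op0 L xs = Brk L xs"
  by (auto simp: op0_def Op_def)

lemma op0_cases:
  obtains "xs = []" | d v where "xs = [(d, v)]" | "length xs \<ge> 2"
  by (cases xs; cases "tl xs") auto

context filtered_shifted_Linf
begin

lemma op0_add:
  assumes "homog L (xs @ ys)" "v \<in> Gr L d" "w \<in> Gr L d"
  shows "op0 L (xs @ (d, v + w) # ys) = op0 L (xs @ (d, v) # ys) + op0 L (xs @ (d, w) # ys)"
proof (cases "length xs + length ys \<ge> 1")
  case True
  then show ?thesis using Brk_add[OF True assms] by (simp add: op0_Brk)
next
  case False
  then have "xs = []" "ys = []" by (cases xs; cases ys; simp)+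
  then show ?thesis using Diff_add[OF assms(2,3)] by (simp add: op0_single)
qed

lemma op0_scale:
  assumes "homog L (xs @ ys)" "v \<in> Gr L d"
  shows "op0 L (xs @ (d, Scal L c v) # ys) = Scal L c (op0 L (xs @ (d, v) # ys))"
proof (cases "length xs + length ys \<ge> 1")
  case True
  then show ?thesis using Brk_scale[OF True assms] by (simp add: op0_Brk)
next
  case False
  then have "xs = []" "ys = []" by (cases xs; cases ys; simp)+
  then show ?thesis using Diff_scale[OF assms(2)] by (simp add: op0_single)
qed

lemma op0_zero: "homog L (xs @ ys) \<Longrightarrow> op0 L (xs @ (d, 0) # ys) = 0"
  using op0_scale[of xs ys 0 d 0] Gr_0 by simp

lemma op0_neg:
  "homog L (xs @ ys) \<Longrightarrow> v \<in> Gr L d \<Longrightarrow> op0 L (xs @ (d, - v) # ys) = - op0 L (xs @ (d, v) # ys)"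
  using op0_scale[of xs ys v d "-1"] by simp

lemma op0_diff:
  "homog L (xs @ ys) \<Longrightarrow> v \<in> Gr L d \<Longrightarrow> w \<in> Gr L d \<Longrightarrow>
    op0 L (xs @ (d, v - w) # ys) = op0 L (xs @ (d, v) # ys) - op0 L (xs @ (d, w) # ys)"
  using op0_add[of xs ys v d "- w"] op0_neg[of xs ys w d] Gr_neg[of w d] by simp

lemma op0_sum:
  assumes "homog L (xs @ ys)" "\<And>i. i \<in> I \<Longrightarrow> f i \<in> Gr L d"
  shows "op0 L (xs @ (d, sum f I) # ys) = (\<Sum>i\<in>I. op0 L (xs @ (d, f i) # ys))"
  using assms(2)
  by (induction I rule: infinite_finite_induct)
    (auto simp: op0_zero[OF assms(1)] op0_add[OF assms(1)] Gr_sum)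

lemma op0_swap:
  assumes "homog L (xs @ ys)" "v \<in> Gr L d" "w \<in> Gr L e"
  shows "op0 L (xs @ (d, v) # (e, w) # ys) = signed (d * e) (op0 L (xs @ (e, w) # (d, v) # ys))"
  using Brk_symmetric[OF assms] by (simp add: op0_Brk)

lemma op0_Filt:
  assumes "length ns = length xs"
    and "\<And>i. i < length xs \<Longrightarrow> ns ! i \<ge> 1 \<and> snd (xs ! i) \<in> Filt L (ns ! i) (fst (xs ! i))"
    and k: "k \<ge> 1" "xs = [] \<or> k \<le> sum_list ns"
  shows "op0 L xs \<in> Filt L k (total_deg xs + 1)"
proof (cases xs rule: op0_cases)
  case 1 then show ?thesis using Filt_0 k by simp
next
  case (2 d v)
  then obtain n where "ns = [n]" using assms(1) by (cases ns) auto
  then show ?thesis using 2 assms(2)[of 0] Filt_Diff[of n v d] Filt_le k by (auto simp: op0_single)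
next
  case 3
  then have "op0 L xs \<in> Filt L (sum_list ns) (total_deg xs + 1)"
    using Filt_Brk[OF 3 assms(1,2)] by (simp add: op0_Brk)
  then show ?thesis using Filt_le k 3 by fastforce
qed

lemma op0_Filt_length:
  assumes "homog L xs" "k \<ge> 1" "k \<le> length xs"
  shows "op0 L xs \<in> Filt L k (total_deg xs + 1)"
  by (rule op0_Filt[of "replicate (length xs) 1"])
    (use assms homog_nth[OF assms(1)] in \<open>auto simp: sum_list_replicate\<close>)

lemma op0_Gr: "homog L xs \<Longrightarrow> op0 L xs \<in> Gr L (total_deg xs + 1)"
  using op0_Filt_length[of xs 1] Gr_0 by (cases "xs = []") (auto simp: Suc_le_eq)

text \<open>Every entry other than \<open>v\<close> lies at least in step 1 and therefore adds one
  to the filtration index. This gain drives all contractions; a lone entry, met by the differential,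
  gains nothing.\<close>

lemma op0_Filt_entry:
  assumes "homog L (xs @ ys)" "k \<ge> 1" "v \<in> Filt L k d"
  shows "op0 L (xs @ (d, v) # ys) \<in> Filt L (k + length xs + length ys) (total_deg (xs @ (d, v) # ys) + 1)"
proof (rule op0_Filt[of "replicate (length xs) 1 @ k # replicate (length ys) 1"])
  fix i assume i: "i < length (xs @ (d, v) # ys)"
  have "homog L (xs @ (d, v) # ys)" using assms Filt_Gr by auto
  from homog_nth[OF this i] i assms show "(replicate (length xs) 1 @ k # replicate (length ys) 1) ! i \<ge> 1 \<and>
      snd ((xs @ (d, v) # ys) ! i) \<in>
        Filt L ((replicate (length xs) 1 @ k # replicate (length ys) 1) ! i) (fst ((xs @ (d, v) # ys) ! i))"
    by (auto simp: nth_append nth_Cons split: nat.splits if_splits)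
qed (use assms in \<open>auto simp: sum_list_replicate\<close>)

lemma op0_Filt_nth:
  assumes xs: "homog L xs" and j: "j < length xs" and k: "k \<ge> 1"
    and v: "snd (xs ! j) \<in> Filt L k (fst (xs ! j))"
  shows "op0 L xs \<in> Filt L k (total_deg xs + 1)"
proof -
  obtain d v where dv: "xs ! j = (d, v)" by force
  then have e: "xs = take j xs @ (d, v) # drop (Suc j) xs" using id_take_nth_drop[OF j] by simp
  have "homog L (take j xs @ drop (Suc j) xs)" using xs by (subst (asm) e) simp
  from op0_Filt_entry[OF this k, of v d] v dv e
  have "op0 L xs \<in> Filt L (k + length (take j xs) + length (drop (Suc j) xs)) (total_deg xs + 1)"
    by simp
  then show ?thesis using k Filt_le by (metis add.assoc le_add1)
qed

text \<open>Entries are exchanged one at a time, \<open>zs\<close> holding those already exchanged.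
  Each exchange leaves a difference in step \<open>k\<close> at one place and step 1 elsewhere, so
  the index reached is \<open>k\<close> plus the number of the other entries.\<close>

lemma op0_cong:
  assumes "list_all2 (\<lambda>(d, v) (e, w). e = d \<and> v \<in> Gr L d \<and> w \<in> Gr L d \<and> v - w \<in> Filt L k d) xs ys"
    and "homog L zs" and k: "k \<ge> 1" and "n \<ge> 1" and "n < k + length zs + length xs"
  shows "op0 L (zs @ xs) - op0 L (zs @ ys) \<in> Filt L n (total_deg (zs @ xs) + 1)"
  using assms(1,2,5)
proof (induction xs ys arbitrary: zs rule: list_all2_induct)
  case Nil
  then show ?case using Filt_0 \<open>n \<ge> 1\<close> by simp
next
  case (Cons x xs y ys)
  obtain d v w where x: "x = (d, v)" and y: "y = (d, w)" and vw: "v \<in> Gr L d" "w \<in> Gr L d"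
    "v - w \<in> Filt L k d" using Cons.hyps(1) by auto
  have hom: "homog L xs"
    using Cons.hyps(2)
    by (auto simp: list_all2_conv_all_nth homog_def in_set_conv_nth split_beta) (metis fst_conv snd_conv)
  have "op0 L (zs @ (d, v) # xs) - op0 L (zs @ (d, w) # xs) = op0 L (zs @ (d, v - w) # xs)"
    using op0_diff[of zs xs v d w] Cons.prems hom vw by simp
  also have "\<dots> \<in> Filt L n (total_deg (zs @ x # xs) + 1)"
    by (rule Filt_le[OF _ \<open>n \<ge> 1\<close>, of _ "k + length zs + length xs"])
      (use op0_Filt_entry[of zs xs k "v - w" d] hom Cons.prems k vw(3) x in auto)
  finally have 1: "op0 L (zs @ (d, v) # xs) - op0 L (zs @ (d, w) # xs) \<in> \<dots>" .
  have 2: "op0 L (zs @ (d, w) # xs) - op0 L (zs @ (d, w) # ys) \<in> Filt L n (total_deg (zs @ x # xs) + 1)"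
    using Cons.IH[of "zs @ [y]"] Cons.prems vw by (simp add: x y add.assoc)
  show ?case using Filt_trans[OF \<open>n \<ge> 1\<close> 1 2] by (simp add: x y)
qed

text \<open>The empty subset may be included because \<open>op0\<close> is zero on the empty list
  and on lists with a zero entry. A sum over a full power set splits as a product when the entries
  fall into two blocks, which the twisting below exploits.\<close>

lemma op0_relations:
  assumes xs: "homog L xs"
  shows "(\<Sum>A\<in>Pow {..<length xs}. signed (koszul (map fst xs) A)
    (op0 L ((total_deg (nths xs A) + 1, op0 L (nths xs A)) # nths xs (- A)))) = 0"
proof (cases "xs = []")
  case True
  then show ?thesis using op0_zero[of "[]" "[]" 1] by (simp add: signed_def)
next
  case False
  have ne: "nths xs A \<noteq> []" if A: "A \<subseteq> {..<length xs}" "A \<noteq> {}" for A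
  proof -
    obtain i where i: "i \<in> A" "i < length xs" using A by auto
    then have "{i. i < length xs \<and> i \<in> A} \<noteq> {}" by auto
    then have "length (nths xs A) \<noteq> 0" unfolding length_nths by simp
    then show ?thesis by auto
  qed
  have "(\<Sum>A\<in>Pow {..<length xs}. signed (koszul (map fst xs) A)
      (op0 L ((total_deg (nths xs A) + 1, op0 L (nths xs A)) # nths xs (- A)))) =
    (\<Sum>A | A \<subseteq> {..<length xs} \<and> A \<noteq> {}. signed (koszul (map fst xs) A)
      (op0 L ((total_deg (nths xs A) + 1, op0 L (nths xs A)) # nths xs (- A))))"
    by (rule sum.mono_neutral_right)
      (use op0_zero[of "[]" _ 1] homog_nths[OF xs] in \<open>auto simp: signed_def\<close>)
  also have "\<dots> = (\<Sum>A | A \<subseteq> {..<length xs} \<and> A \<noteq> {}. signed (koszul (map fst xs) A)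
      (Op L ((total_deg (nths xs A) + 1, Op L (nths xs A)) # nths xs (- A))))"
    by (rule sum.cong) (use ne in \<open>auto simp: op0_def\<close>)
  also have "\<dots> = 0" by (rule relations[OF False xs])
  finally show ?thesis .
qed

text \<open>Entries of degree 0 pass any other entry without a sign.\<close>

lemma op0_move:
  assumes "a \<in> Gr L 0" "w \<in> Gr L e" "homog L (zs @ ys)"
  shows "op0 L (zs @ replicate n (0, a) @ (e, w) # ys) = op0 L (zs @ (e, w) # replicate n (0, a) @ ys)"
  using assms(3)
proof (induction n arbitrary: zs)
  case (Suc n)
  have "op0 L (zs @ replicate (Suc n) (0, a) @ (e, w) # ys) =
      op0 L ((zs @ [(0, a)]) @ replicate n (0, a) @ (e, w) # ys)" by simp
  also have "\<dots> = op0 L (zs @ (0, a) # (e, w) # replicate n (0, a) @ ys)"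
    by (subst Suc.IH) (use Suc.prems assms in auto)
  also have "\<dots> = op0 L (zs @ (e, w) # (0, a) # replicate n (0, a) @ ys)"
    by (subst op0_swap) (use Suc.prems assms in \<open>auto simp: signed_def\<close>)
  finally show ?case by simp
qed simp

end

section \<open>Extension of scalars to polynomials\<close>

text \<open>The completed tensor product with polynomials in one variable, packaged in the record
  type of \<open>L\<close> itself. All results about \<open>L\<close> then apply to it, and a second
  application supplies a second variable.\<close>

definition polyL :: "('k::field, 'v::ab_group_add) Linf \<Rightarrow> ('k, nat \<Rightarrow> 'v) Linf" where
  "polyL L = \<lparr>Scal = (\<lambda>c x i. Scal L c (x i)), Gr = ctens L 1, Filt = ctens L,
     Diff = (\<lambda>d x i. Diff L d (x i)), Brk = Brk_t L\<rparr>"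

lemma polyL_simps [simp]:
  "Scal (polyL L) c x = (\<lambda>i. Scal L c (x i))"
  "Gr (polyL L) d = ctens L 1 d"
  "Filt (polyL L) = ctens L"
  "Diff (polyL L) d x = (\<lambda>i. Diff L d (x i))"
  "Brk (polyL L) xs = Brk_t L xs"
  by (simp_all add: polyL_def)

definition pick :: "(int \<times> (nat \<Rightarrow> 'v)) list \<Rightarrow> nat list \<Rightarrow> (int \<times> 'v) list" where
  "pick xs is = map2 (\<lambda>(d, x) i. (d, x i)) xs is"

lemma pick_simps [simp]:
  "pick [] is = []"
  "pick xs [] = []"
  "pick ((d, x) # xs) (i # is) = (d, x i) # pick xs is"
  by (simp_all add: pick_def)

lemma length_pick [simp]: "length is = length xs \<Longrightarrow> length (pick xs is) = length xs"
  by (simp add: pick_def)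

lemma nth_pick: "length is = length xs \<Longrightarrow> j < length xs \<Longrightarrow>
    pick xs is ! j = (fst (xs ! j), snd (xs ! j) (is ! j))"
  by (simp add: pick_def split_beta)

lemma pick_append: "length is = length xs \<Longrightarrow> pick (xs @ ys) (is @ js) = pick xs is @ pick ys js"
  by (simp add: pick_def)

lemma total_deg_pick: "length is = length xs \<Longrightarrow> total_deg (pick xs is) = total_deg xs"
  by (induction "is" xs rule: list_induct2) auto

lemma homog_pick: "length is = length xs \<Longrightarrow> (\<And>d x. (d, x) \<in> set xs \<Longrightarrow> (\<And>i. x i \<in> Gr L d)) \<Longrightarrow>
    homog L (pick xs is)"
proof (induction "is" xs rule: list_induct2)
  case (Cons i "is" x xs)
  then show ?case by (cases x) auto
qed auto

lemma finite_compositions: "finite {is :: nat list. length is = m \<and> sum_list is = n}"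
proof (rule finite_subset)
  show "{is. length is = m \<and> sum_list is = n} \<subseteq> {is. set is \<subseteq> {..n} \<and> length is = m}"
    using member_le_sum_list by fastforce
qed (simp add: finite_lists_length_eq)

lemma op0_poly:
  "op0 (polyL L) xs n = (\<Sum>is | length is = length xs \<and> sum_list is = n. op0 L (pick xs is))"
proof (cases xs rule: op0_cases)
  case (2 d x)
  have "{is. length is = length xs \<and> sum_list is = n} = {[n]}"
    by (auto simp: 2 length_Suc_conv)
  then show ?thesis by (simp add: 2 op0_single)
next
  case 3
  then show ?thesis
    by (auto simp: op0_Brk Brk_t_def pick_def intro!: sum.cong)
qed auto

text \<open>The pigeonhole argument behind convergence of brackets of series: a term of high total
  degree uses a coefficient of high degree from some entry, and such a coefficient is deep in the
  filtration.\<close>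

lemma sum_list_ge_imp_nth_ge:
  fixes "is" :: "nat list"
  assumes "sum_list is \<ge> length is * M" "is \<noteq> []"
  shows "\<exists>j<length is. is ! j \<ge> M"
proof (rule ccontr)
  assume "\<not> ?thesis"
  then have "\<And>i. i \<in> set is \<Longrightarrow> i < M" by (auto simp: in_set_conv_nth)
  then have "sum_list is < length is * M" using assms(2)
  proof (induction "is")
    case (Cons i "is")
    then show ?case by (cases "is = []") (use Cons in \<open>auto intro: add_less_le_mono\<close>)
  qed simp
  then show False using assms(1) by simp
qed

context filtered_shifted_Linf
begin

lemma homog_polyD: "homog (polyL L) xs \<Longrightarrow> (d, x) \<in> set xs \<Longrightarrow> x \<in> ctens L 1 d"
  by (auto simp: homog_def)

lemma homog_pick_poly: "homog (polyL L) xs \<Longrightarrow> length is = length xs \<Longrightarrow> homog L (pick xs is)"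
  by (rule homog_pick) (auto dest: homog_polyD ctens_Gr)

lemma poly_tail:
  assumes "homog (polyL L) xs" "k \<ge> 1"
  obtains M where "M \<ge> 1" "\<And>d x i. (d, x) \<in> set xs \<Longrightarrow> i \<ge> M \<Longrightarrow> x i \<in> Filt L k d"
proof -
  have "\<exists>N. \<forall>i\<ge>N. snd p i \<in> Filt L k (fst p)" if "p \<in> set xs" for p
    using homog_polyD[OF assms(1), of "fst p" "snd p"] that assms(2) unfolding ctens_iff by auto
  then obtain N where N: "\<And>p i. p \<in> set xs \<Longrightarrow> i \<ge> N p \<Longrightarrow> snd p i \<in> Filt L k (fst p)" by metis
  have "x i \<in> Filt L k d" if "(d, x) \<in> set xs" "i \<ge> Suc (Max (N ` set xs))" for d x i
  proof -
    have "N (d, x) \<le> Max (N ` set xs)" using that(1) by auto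
    then show ?thesis using N[OF that(1), of i] that(2) by simp
  qed
  then show thesis using that[of "Suc (Max (N ` set xs))"] by auto
qed

lemma op0_pick_tail:
  assumes xs: "homog (polyL L) xs" "length is = length xs" and k: "k \<ge> 1"
    and M: "\<And>d x i. (d, x) \<in> set xs \<Longrightarrow> i \<ge> M \<Longrightarrow> x i \<in> Filt L k d"
    and j: "j < length xs" "is ! j \<ge> M"
  shows "op0 L (pick xs is) \<in> Filt L k (total_deg xs + 1)"
  using op0_Filt_nth[OF homog_pick_poly[OF xs], of j k] M[of "fst (xs ! j)" "snd (xs ! j)" "is ! j"]
    xs k j by (simp add: nth_pick total_deg_pick)

text \<open>Two bounds are combined: every coefficient lies in step \<open>m\<close> because of the
  depths \<open>ns\<close> of the entries, and the coefficients of high degree lie in any prescribed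
  step by pigeonhole.\<close>

lemma op0_poly_ctens:
  assumes xs: "homog (polyL L) xs" and m: "length ns = length xs" "m \<ge> 1" "xs = [] \<or> m \<le> sum_list ns"
    and ns: "\<And>i. i < length xs \<Longrightarrow> ns ! i \<ge> 1 \<and> snd (xs ! i) \<in> ctens L (ns ! i) (fst (xs ! i))"
  shows "op0 (polyL L) xs \<in> ctens L m (total_deg xs + 1)"
proof (rule ctensI)
  fix n
  have "op0 L (pick xs is) \<in> Filt L m (total_deg xs + 1)" if l: "length is = length xs" for "is"
  proof -
    have "op0 L (pick xs is) \<in> Filt L m (total_deg (pick xs is) + 1)"
      by (rule op0_Filt[of ns])
        (use l m ns ctens_Filt in \<open>auto simp: nth_pick dest: arg_cong[of _ _ length]\<close>)
    then show ?thesis using l by (simp add: total_deg_pick)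
  qed
  then show "op0 (polyL L) xs n \<in> Filt L m (total_deg xs + 1)"
    unfolding op0_poly by (intro Filt_sum m) auto
next
  fix k :: nat assume k: "k \<ge> 1"
  obtain M where M: "\<And>d x i. (d, x) \<in> set xs \<Longrightarrow> i \<ge> M \<Longrightarrow> x i \<in> Filt L k d"
    using poly_tail[OF xs k] by metis
  have "op0 (polyL L) xs n \<in> Filt L k (total_deg xs + 1)" if n: "n \<ge> length xs * M" for n
    unfolding op0_poly
  proof (intro Filt_sum k)
    fix "is" assume i: "is \<in> {is. length is = length xs \<and> sum_list is = n}"
    show "op0 L (pick xs is) \<in> Filt L k (total_deg xs + 1)"
    proof (cases "xs = []")
      case True then show ?thesis using Filt_0 k by simp
    next
      case False
      then obtain j where "j < length xs" "is ! j \<ge> M"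
        using sum_list_ge_imp_nth_ge[of "is" M] i n by fastforce
      then show ?thesis using op0_pick_tail[OF xs, of "is" k M j] k M i by blast
    qed
  qed
  then show "\<exists>N. \<forall>n\<ge>N. op0 (polyL L) xs n \<in> Filt L k (total_deg xs + 1)" by blast
qed

lemma op0_poly_Gr:
  assumes "homog (polyL L) xs"
  shows "op0 (polyL L) xs \<in> ctens L 1 (total_deg xs + 1)"
proof (cases "xs = []")
  case True
  then show ?thesis using ctens_0[of 1] by (simp add: zero_fun_def)
next
  case False
  show ?thesis
    by (rule op0_poly_ctens[OF assms, of "replicate (length xs) 1"])
      (use False homog_nth[OF assms] in \<open>auto simp: sum_list_replicate Suc_le_eq\<close>)
qed

section \<open>Evaluation of polynomials at a scalar\<close>

lemma ev_ctens: "x \<in> ctens L m d \<Longrightarrow> m \<ge> 1 \<Longrightarrow> (\<lambda>i. Scal L (c ^ i) (x i)) \<in> ctens L m d"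
  by (rule ctens_scale_coeff)

lemma ev_Filt: "x \<in> ctens L m d \<Longrightarrow> m \<ge> 1 \<Longrightarrow> ev L d c x \<in> Filt L m d"
  unfolding ev_def by (intro fsum_Filt ev_ctens)

lemma ev_Gr: "x \<in> ctens L 1 d \<Longrightarrow> ev L d c x \<in> Gr L d"
  using ev_Filt[of x 1] by simp

lemma ev_mod:
  assumes "x \<in> ctens L 1 d" "k \<ge> 1" "\<And>i. i \<ge> n \<Longrightarrow> x i \<in> Filt L k d"
  shows "ev L d c x - (\<Sum>i<n. Scal L (c ^ i) (x i)) \<in> Filt L k d"
  unfolding ev_def by (rule fsum_mod) (use assms ev_ctens[of x 1] Filt_scale in auto)

lemma ev_add:
  assumes "x \<in> ctens L 1 d" "y \<in> ctens L 1 d"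
  shows "ev L d c (x + y) = ev L d c x + ev L d c y"
  using fsum_add[OF ev_ctens[OF assms(1)] ev_ctens[OF assms(2)]] by (simp add: ev_def scale_right_distrib)

lemma ev_scale:
  assumes "x \<in> ctens L 1 d"
  shows "ev L d c (\<lambda>i. Scal L b (x i)) = Scal L b (ev L d c x)"
  using fsum_scale[OF ev_ctens[OF assms], of b c] by (simp add: ev_def mult.commute)

text \<open>Multilinear expansion of an operation on truncated evaluations. The prefix
  \<open>zs\<close> generalises the claim for the induction and collects the coefficients already
  selected.\<close>

lemma op0_multi_sum:
  assumes "homog (polyL L) xs" "homog L zs"
  shows "op0 L (zs @ map (\<lambda>(d, x). (d, \<Sum>i<M. Scal L (c ^ i) (x i))) xs) =
    (\<Sum>is | length is = length xs \<and> set is \<subseteq> {..<M}. Scal L (c ^ sum_list is) (op0 L (zs @ pick xs is)))"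
  using assms
proof (induction xs arbitrary: zs)
  case Nil
  have "{is. length is = length ([] :: (int \<times> (nat \<Rightarrow> 'v)) list) \<and> set is \<subseteq> {..<M}} = {[]}" by auto
  then show ?case by simp
next
  case (Cons p xs)
  obtain d x where p: "p = (d, x)" by force
  have x: "x i \<in> Gr L d" for i using Cons.prems ctens_Gr by (simp add: p)
  have xs: "homog (polyL L) xs" using Cons.prems by (simp add: p)
  define ys where "ys = map (\<lambda>(d, x). (d, \<Sum>i<M. Scal L (c ^ i) (x i))) xs"
  have ys: "homog L ys"
  proof -
    have "(\<Sum>i<M. Scal L (c ^ i) (y i)) \<in> Gr L e" if "(e, y) \<in> set xs" for e y
      by (intro Gr_sum Gr_scale ctens_Gr) (rule homog_polyD[OF xs that])
    then show ?thesis by (auto simp: ys_def homog_def)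
  qed
  have "op0 L (zs @ map (\<lambda>(d, x). (d, \<Sum>i<M. Scal L (c ^ i) (x i))) (p # xs)) =
      op0 L (zs @ (d, \<Sum>i<M. Scal L (c ^ i) (x i)) # ys)" by (simp add: p ys_def)
  also have "\<dots> = (\<Sum>i<M. op0 L (zs @ (d, Scal L (c ^ i) (x i)) # ys))"
    by (rule op0_sum) (use Cons.prems ys x in \<open>auto intro: Gr_scale\<close>)
  also have "\<dots> = (\<Sum>i<M. Scal L (c ^ i) (op0 L ((zs @ [(d, x i)]) @ ys)))"
    using op0_scale[of zs ys] Cons.prems ys x by simp
  also have "\<dots> = (\<Sum>i<M. \<Sum>is | length is = length xs \<and> set is \<subseteq> {..<M}.
      Scal L (c ^ sum_list (i # is)) (op0 L (zs @ pick (p # xs) (i # is))))"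
    unfolding ys_def
    by (subst Cons.IH[OF xs]) (use Cons.prems x in \<open>auto simp: p scale_sum_right power_add\<close>)
  also have "\<dots> = (\<Sum>(i, is)\<in>{..<M} \<times> {is. length is = length xs \<and> set is \<subseteq> {..<M}}.
      Scal L (c ^ sum_list (i # is)) (op0 L (zs @ pick (p # xs) (i # is))))"
    by (rule sum.cartesian_product)
  also have "\<dots> = (\<Sum>is | length is = length (p # xs) \<and> set is \<subseteq> {..<M}.
      Scal L (c ^ sum_list is) (op0 L (zs @ pick (p # xs) is)))"
    by (rule sum.reindex_bij_witness[of _ "\<lambda>is. (hd is, tl is)" "\<lambda>(i, is). i # is"])
      (auto simp: length_Suc_conv)
  finally show ?case .
qed

text \<open>Evaluation is a strict morphism from polynomials to \<open>L\<close>. Modulo step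
  \<open>k\<close>, the left side is a sum over exponent lists of bounded total and the right side
  one over lists with bounded entries; lists in only one of the two contribute terms in step
  \<open>k\<close>.\<close>

lemma ev_op0:
  assumes xs: "homog (polyL L) xs"
  shows "ev L (total_deg xs + 1) c (op0 (polyL L) xs) = op0 L (map (\<lambda>(d, x). (d, ev L d c x)) xs)"
    (is "ev L ?d c ?p = op0 L ?e")
proof (cases "xs = []")
  case True
  then show ?thesis by (simp add: ev_def)
next
  case False
  have e: "homog L ?e" using homog_polyD[OF xs] by (force simp: homog_def intro: ev_Gr)
  have te: "total_deg ?e = total_deg xs" by (induction xs) auto
  show ?thesis
  proof (rule Filt_eqI)
    fix k :: nat assume k: "k \<ge> 1"
    obtain M where M1: "M \<ge> 1" and M: "\<And>d x i. (d, x) \<in> set xs \<Longrightarrow> i \<ge> M \<Longrightarrow> x i \<in> Filt L k d"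
      using poly_tail[OF xs k] by metis
    \<comment> \<open>With this bound every list of total at least \<open>K\<close> has an exponent
      at least \<open>M\<close>, so its term lies in step \<open>k\<close>.\<close>
    define K where "K = length xs * M"
    let ?t = "\<lambda>is. Scal L (c ^ sum_list is) (op0 L (pick xs is))"
    let ?S = "{is. length is = length xs \<and> sum_list is < K}"
    let ?B = "{is. length is = length xs \<and> set is \<subseteq> {..<M}}"
    define tr where "tr = map (\<lambda>(d, x). (d, \<Sum>i<M. Scal L (c ^ i) (x i))) xs"
    have "list_all2 (\<lambda>(d, v) (e, w). e = d \<and> v \<in> Gr L d \<and> w \<in> Gr L d \<and> v - w \<in> Filt L k d) ?e tr"
    proof -
      have "ev L d c x \<in> Gr L d \<and> (\<Sum>i<M. Scal L (c ^ i) (x i)) \<in> Gr L d \<and>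
          ev L d c x - (\<Sum>i<M. Scal L (c ^ i) (x i)) \<in> Filt L k d" if "(d, x) \<in> set xs" for d x
        using homog_polyD[OF xs that] M[OF that]
        by (intro conjI ev_Gr Gr_sum Gr_scale ev_mod[OF _ k]) (auto intro: ctens_Gr)
      then show ?thesis
        unfolding tr_def list_all2_map1 list_all2_map2 by (intro list.rel_refl_strong) auto
    qed
    then have 1: "op0 L ?e - op0 L tr \<in> Filt L k ?d"
      using op0_cong[of k ?e tr "[]" k] k False te by simp
    have tail: "op0 L (pick xs is) \<in> Filt L k ?d" if "length is = length xs" "j < length xs" "is ! j \<ge> M" for "is" j
      using op0_pick_tail[OF xs that(1) k _ that(2,3)] M by blast
    have S: "?S = (\<Union>n<K. {is. length is = length xs \<and> sum_list is = n})" by auto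
    have finS: "finite ?S" unfolding S using finite_compositions by blast
    have "?p n \<in> Filt L k ?d" if n: "n \<ge> K" for n
      unfolding op0_poly
    proof (intro Filt_sum k)
      fix "is" assume i: "is \<in> {is. length is = length xs \<and> sum_list is = n}"
      then obtain j where "j < length xs" "is ! j \<ge> M"
        using sum_list_ge_imp_nth_ge[of "is" M] n i False by (fastforce simp: K_def)
      then show "op0 L (pick xs is) \<in> Filt L k ?d" using tail i by blast
    qed
    then have 2: "ev L ?d c ?p - (\<Sum>n<K. Scal L (c ^ n) (?p n)) \<in> Filt L k ?d"
      using ev_mod[OF op0_poly_Gr[OF xs] k, of K c] by blast
    have "(\<Sum>n<K. Scal L (c ^ n) (?p n)) = (\<Sum>n<K. \<Sum>is | length is = length xs \<and> sum_list is = n. ?t is)"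
      by (auto simp: op0_poly scale_sum_right intro!: sum.cong)
    also have "\<dots> = sum ?t ?S"
      unfolding S by (rule sum.UNION_disjoint[symmetric]) (auto simp: finite_compositions)
    finally have 3: "(\<Sum>n<K. Scal L (c ^ n) (?p n)) = sum ?t ?S" .
    \<comment> \<open>Exponents all below \<open>M\<close> have total below \<open>K\<close>; hence
      only the terms with some exponent at least \<open>M\<close> remain in the difference.\<close>
    have "?B \<subseteq> ?S"
    proof
      fix "is" assume i: "is \<in> ?B"
      show "is \<in> ?S"
      proof (rule ccontr)
        assume "is \<notin> ?S"
        then obtain j where "j < length is" "is ! j \<ge> M"
          using sum_list_ge_imp_nth_ge[of "is" M] i False by (fastforce simp: K_def)
        moreover have "is ! j \<in> {..<M}" using i calculation(1) by (metis (no_types, lifting) mem_Collect_eq nth_mem subsetD)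
        ultimately show False by simp
      qed
    qed
    then have "sum ?t ?S - sum ?t ?B = sum ?t (?S - ?B)"
      using finS by (simp add: sum_diff)
    also have "\<dots> \<in> Filt L k ?d"
    proof (intro Filt_sum k Filt_scale)
      fix "is" assume "is \<in> ?S - ?B"
      then have l: "length is = length xs" and "\<not> set is \<subseteq> {..<M}" by auto
      then obtain j where "j < length is" "is ! j \<ge> M" by (force simp: in_set_conv_nth)
      then show "op0 L (pick xs is) \<in> Filt L k ?d" using tail l by simp
    qed
    also have "sum ?t ?B = op0 L tr" using op0_multi_sum[OF xs, of "[]" c M] by (simp add: tr_def)
    finally have "sum ?t ?S - op0 L tr \<in> Filt L k ?d" .
    then show "ev L ?d c ?p - op0 L ?e \<in> Filt L k ?d"
      using Filt_trans[OF k 2[unfolded 3] Filt_trans[OF k _ Filt_swap[OF k 1]]] by blast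
  qed (use ev_Gr op0_poly_Gr[OF xs] op0_Gr[OF e] te in auto)
qed

end

text \<open>The difference \<open>p(2c) - 2^n p(c)\<close> has lower degree than \<open>p\<close>.\<close>

lemma polynomial_values_in_subspace:
  fixes scale :: "'k::field_char_0 \<Rightarrow> 'v::ab_group_add \<Rightarrow> 'v"
  assumes vs: "vector_space scale" and W: "module.subspace scale W"
    and "\<And>c. (\<Sum>i<n. scale (c ^ i) (x i)) \<in> W" and "i < n"
  shows "x i \<in> W"
proof -
  interpret vector_space scale by (rule vs)
  show ?thesis using assms(3,4)
  proof (induction n arbitrary: x i)
    case (Suc n)
    have lower: "x i \<in> W" if i: "i < n" for i
    proof -
      have "(\<Sum>i<n. scale (c ^ i) (scale (2 ^ i - 2 ^ n) (x i))) \<in> W" for c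
      proof -
        have "(\<Sum>i<Suc n. scale ((2 * c) ^ i) (x i)) - scale (2 ^ n) (\<Sum>i<Suc n. scale (c ^ i) (x i)) \<in> W"
          by (intro subspace_diff[OF W] subspace_scale[OF W] Suc.prems)
        moreover have "(\<Sum>i<Suc n. scale ((2 * c) ^ i) (x i)) - scale (2 ^ n) (\<Sum>i<Suc n. scale (c ^ i) (x i))
            = (\<Sum>i<Suc n. scale (c ^ i) (scale (2 ^ i - 2 ^ n) (x i)))"
          unfolding scale_sum_right sum_subtractf[symmetric]
          by (rule sum.cong) (simp_all add: power_mult_distrib scale_left_diff_distrib scale_right_diff_distrib mult.commute)
        ultimately show ?thesis by simp
      qed
      then have "scale (2 ^ i - 2 ^ n) (x i) \<in> W" using Suc.IH[of "\<lambda>i. scale (2 ^ i - 2 ^ n) (x i)"] i by blast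
      then have "scale (inverse (2 ^ i - 2 ^ n)) (scale (2 ^ i - 2 ^ n) (x i)) \<in> W"
        by (rule subspace_scale[OF W])
      moreover have "(2::'k) ^ i \<noteq> 2 ^ n"
      proof -
        have "(2::nat) ^ i \<noteq> 2 ^ n" using i by simp
        then show ?thesis using of_nat_eq_iff[of "2 ^ i" "2 ^ n", where 'a = 'k] by simp
      qed
      ultimately show ?thesis by simp
    qed
    show ?case
    proof (cases "i < n")
      case False
      \<comment> \<open>The value at 1 is the sum of all coefficients; removing the lower ones,
        already known to lie in \<open>W\<close>, isolates the leading one.\<close>
      have "(\<Sum>i<Suc n. scale (1 ^ i) (x i)) - (\<Sum>i<n. x i) \<in> W"
        by (intro subspace_diff[OF W] subspace_sum[OF W] Suc.prems) (use lower in auto)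
      then show ?thesis using False Suc.prems(2) by (simp add: less_Suc_eq)
    qed (use lower in auto)
  qed simp
qed

section \<open>Polynomials over a filtered shifted algebra form another one\<close>

locale Linf_char0 = filtered_shifted_Linf L
  for L :: "('k::field_char_0, 'v::ab_group_add) Linf"
begin

text \<open>\<open>x\<close> may have infinitely many nonzero coefficients, but modulo each step of
  the filtration it is a polynomial with all values zero, so its coefficients lie in that step.
  Separatedness combines the steps.\<close>

lemma poly_eq_0I:
  assumes x: "x \<in> ctens L 1 d" and ev: "\<And>c. ev L d c x = 0"
  shows "x = 0"
proof
  fix i
  have "x i = 0"
  proof (rule Filt_separated)
    fix k :: nat assume k: "k \<ge> 1"
    obtain N where N: "\<And>i. i \<ge> N \<Longrightarrow> x i \<in> Filt L k d" using ctens_tail[OF x k] by blast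
    have "(\<Sum>i<N. Scal L (c ^ i) (x i)) \<in> Filt L k d" for c
      using Filt_neg[OF k ev_mod[OF x k, where n = N and c = c]] N by (simp add: ev)
    then show "x i \<in> Filt L k d"
      using polynomial_values_in_subspace[OF vector_space_axioms Filt_subspace[OF k], where n = N and x = x and i = i] N
      by (cases "i < N") auto
  qed (use ctens_Gr[OF x] in auto)
  then show "x i = 0 i" by simp
qed

lemma vector_space_poly: "vector_space (Scal (polyL L))"
  by unfold_locales (auto simp: fun_eq_iff scale_right_distrib scale_left_distrib)

sublocale P: vector_space "Scal (polyL L)"
  by (rule vector_space_poly)

lemma ctens_subspace: "1 \<le> m \<Longrightarrow> P.subspace (ctens L m d)"
  unfolding P.subspace_def using ctens_0 ctens_add ctens_scale_coeff[where c = "\<lambda>_. c" for c]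
  by (auto simp: zero_fun_def plus_fun_def)

lemma ctens_diff: "1 \<le> m \<Longrightarrow> x \<in> ctens L m d \<Longrightarrow> y \<in> ctens L m d \<Longrightarrow> x - y \<in> ctens L m d"
  using P.subspace_diff[OF ctens_subspace] by blast

lemma poly_eqI:
  assumes x: "x \<in> ctens L 1 d" and y: "y \<in> ctens L 1 d" and "\<And>c. ev L d c x = ev L d c y"
  shows "x = y"
proof -
  have xy: "x - y \<in> ctens L 1 d" using ctens_diff x y by simp
  have "ev L d c x = ev L d c (x - y) + ev L d c y" for c using ev_add[OF xy y, of c] by simp
  then have "x - y = 0" using poly_eq_0I[OF xy] assms(3) by simp
  then show ?thesis by simp
qed

lemma Diff_Filt_ctens:
  assumes "1 \<le> m" "x \<in> ctens L m d"
  shows "(\<lambda>i. Diff L d (x i)) \<in> ctens L m (d + 1)"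
  using assms Filt_Diff unfolding ctens_iff by meson

lemma ev_signed: "x \<in> ctens L 1 d \<Longrightarrow> ev L d c (signed e x) = signed e (ev L d c x)"
  using ev_scale[of x d c "-1"] by (auto simp: signed_def fun_Compl_def)

lemma ctens_signed: "1 \<le> m \<Longrightarrow> x \<in> ctens L m d \<Longrightarrow> signed e x \<in> ctens L m d"
  using P.subspace_neg[OF ctens_subspace] by (auto simp: signed_def)

lemma ev_sum:
  assumes "\<And>i. i \<in> I \<Longrightarrow> f i \<in> ctens L 1 d"
  shows "ev L d c (sum f I) = (\<Sum>i\<in>I. ev L d c (f i))" "sum f I \<in> ctens L 1 d"
proof -
  show "sum f I \<in> ctens L 1 d" by (rule P.subspace_sum[OF ctens_subspace]) (use assms in auto)
  show "ev L d c (sum f I) = (\<Sum>i\<in>I. ev L d c (f i))"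
    using assms
  proof (induction I rule: infinite_finite_induct)
    case (insert i I)
    have "sum f I \<in> ctens L 1 d" by (rule P.subspace_sum[OF ctens_subspace]) (use insert in auto)
    then show ?case using insert ev_add[of "f i" d "sum f I" c] by (simp del: plus_fun_apply)
  qed (auto simp: ev_def zero_fun_def)
qed

lemma total_deg_map: "total_deg (map (\<lambda>(d, x). (d, g d x)) xs) = total_deg xs"
  by (induction xs) auto

lemma homog_map_ev: "homog (polyL L) xs \<Longrightarrow> homog L (map (\<lambda>(d, x). (d, ev L d c x)) xs)"
  by (force simp: homog_def intro: ev_Gr)

lemma poly_complete:
  "bij_betw (\<lambda>v. \<lambda>k\<in>{1..}. (+) v ` ctens L k d) (ctens L 1 d) (lim_quot (ctens L 1 d) (\<lambda>k. ctens L k d))"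
proof (rule P.bij_lim_quot_iff[THEN iffD2])
  show "ctens L (Suc k) d \<subseteq> ctens L k d" if "k \<ge> 1" for k
    using ctens_mono that by auto
  show "(\<forall>v\<in>ctens L 1 d. (\<forall>k\<ge>1. v \<in> ctens L k d) \<longrightarrow> v = 0) \<and>
    (\<forall>y. (\<forall>k\<ge>1. y k \<in> ctens L 1 d \<and> y (Suc k) - y k \<in> ctens L k d) \<longrightarrow>
         (\<exists>v\<in>ctens L 1 d. \<forall>k\<ge>1. v - y k \<in> ctens L k d))"
  proof (intro conjI ballI allI impI)
    fix x assume "x \<in> ctens L 1 d" "\<forall>k\<ge>1. x \<in> ctens L k d"
    then have "x i = 0" for i using Filt_separated[of "x i" d] ctens_Gr ctens_Filt by blast
    then show "x = 0" by (auto simp: fun_eq_iff)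
  next
    fix y assume y: "\<forall>k\<ge>1. y k \<in> ctens L 1 d \<and> y (Suc k) - y k \<in> ctens L k d"
    have "\<exists>v. v \<in> Gr L d \<and> (\<forall>k\<ge>1. v - y k i \<in> Filt L k d)" for i
    proof -
      have "y (Suc k) i - y k i \<in> Filt L k d" if "k \<ge> 1" for k
        using y that ctens_Filt[of "y (Suc k) - y k" k d i] by simp
      moreover have "y k i \<in> Gr L d" if "k \<ge> 1" for k using y that ctens_Gr by blast
      ultimately obtain v where "v \<in> Gr L d" "\<And>k. k \<ge> 1 \<Longrightarrow> v - y k i \<in> Filt L k d"
        using Filt_limit[of "\<lambda>k. y k i" d] by metis
      then show ?thesis by blast
    qed
    then obtain v where v: "\<And>i. v i \<in> Gr L d" "\<And>i k. k \<ge> 1 \<Longrightarrow> v i - y k i \<in> Filt L k d" by metis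
    \<comment> \<open>The limit is taken coefficientwise, so smallness of its tail has to be
      recovered: modulo step \<open>k\<close> the limit agrees with \<open>y k\<close>, uniformly in
      the coefficient, and the tail of \<open>y k\<close> is small.\<close>
    have v1: "v \<in> ctens L 1 d"
    proof (rule ctensI)
      fix k :: nat assume k: "k \<ge> 1"
      obtain N where N: "\<And>i. i \<ge> N \<Longrightarrow> y k i \<in> Filt L k d" using ctens_tail[of "y k" 1 d k] y k by blast
      have "v i \<in> Filt L k d" if "i \<ge> N" for i
        using Filt_add[OF k v(2)[OF k, of i] N[OF that]] by simp
      then show "\<exists>N. \<forall>i\<ge>N. v i \<in> Filt L k d" by blast
    qed (use v in auto)
    have "v - y k \<in> ctens L k d" if k: "k \<ge> 1" for k
    proof -
      have "v - y k \<in> ctens L 1 d" using ctens_diff v1 y k by blast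
      then show ?thesis using v(2)[OF k] unfolding ctens_iff by auto
    qed
    then show "\<exists>v\<in>ctens L 1 d. \<forall>k\<ge>1. v - y k \<in> ctens L k d" using v1 by blast
  qed
qed (use ctens_subspace in auto)

text \<open>The device for transferring additivity, homogeneity and symmetry to polynomials: after
  evaluation, the claim is one about the operations of \<open>L\<close>.\<close>

lemma op0_poly_eqI:
  assumes "homog (polyL L) xs" "y \<in> ctens L 1 (total_deg xs + 1)"
    and "\<And>c. op0 L (map (\<lambda>(d, x). (d, ev L d c x)) xs) = ev L (total_deg xs + 1) c y"
  shows "op0 (polyL L) xs = y"
  by (rule poly_eqI[OF op0_poly_Gr[OF assms(1)] assms(2)]) (simp add: ev_op0[OF assms(1)] assms(3))

lemma poly_add:
  assumes "homog (polyL L) (xs @ ys)" "v \<in> ctens L 1 d" "w \<in> ctens L 1 d"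
  shows "op0 (polyL L) (xs @ (d, v + w) # ys) =
    op0 (polyL L) (xs @ (d, v) # ys) + op0 (polyL L) (xs @ (d, w) # ys)" (is "_ = ?y + ?z")
proof (rule op0_poly_eqI)
  have vw: "v + w \<in> ctens L 1 d" using P.subspace_add[OF ctens_subspace] assms by simp
  then show "homog (polyL L) (xs @ (d, v + w) # ys)" using assms by simp
  have y: "?y \<in> ctens L 1 (total_deg (xs @ (d, v + w) # ys) + 1)"
    using op0_poly_Gr[of "xs @ (d, v) # ys"] assms by simp
  have z: "?z \<in> ctens L 1 (total_deg (xs @ (d, v + w) # ys) + 1)"
    using op0_poly_Gr[of "xs @ (d, w) # ys"] assms by simp
  show "?y + ?z \<in> ctens L 1 (total_deg (xs @ (d, v + w) # ys) + 1)"
    using P.subspace_add[OF ctens_subspace y z] by simp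
  show "op0 L (map (\<lambda>(d, x). (d, ev L d c x)) (xs @ (d, v + w) # ys)) =
      ev L (total_deg (xs @ (d, v + w) # ys) + 1) c (?y + ?z)" for c
    using ev_add[OF y z, of c] ev_op0[of "xs @ (d, v) # ys" c] ev_op0[of "xs @ (d, w) # ys" c]
      op0_add[of "map (\<lambda>(d, x). (d, ev L d c x)) xs" "map (\<lambda>(d, x). (d, ev L d c x)) ys"]
      assms homog_map_ev ev_Gr ev_add[OF assms(2,3)]
    by simp
qed

lemma poly_scale:
  assumes "homog (polyL L) (xs @ ys)" "v \<in> ctens L 1 d"
  shows "op0 (polyL L) (xs @ (d, \<lambda>i. Scal L b (v i)) # ys) =
    (\<lambda>i. Scal L b (op0 (polyL L) (xs @ (d, v) # ys) i))" (is "_ = (\<lambda>i. Scal L b (?y i))")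
proof (rule op0_poly_eqI)
  have bv: "(\<lambda>i. Scal L b (v i)) \<in> ctens L 1 d" using ctens_scale_coeff assms by simp
  then show "homog (polyL L) (xs @ (d, \<lambda>i. Scal L b (v i)) # ys)" using assms by simp
  have y: "?y \<in> ctens L 1 (total_deg (xs @ (d, \<lambda>i. Scal L b (v i)) # ys) + 1)"
    using op0_poly_Gr[of "xs @ (d, v) # ys"] assms by simp
  show "(\<lambda>i. Scal L b (?y i)) \<in> ctens L 1 (total_deg (xs @ (d, \<lambda>i. Scal L b (v i)) # ys) + 1)"
    using ctens_scale_coeff[OF _ y] by simp
  show "op0 L (map (\<lambda>(d, x). (d, ev L d c x)) (xs @ (d, \<lambda>i. Scal L b (v i)) # ys)) =
      ev L (total_deg (xs @ (d, \<lambda>i. Scal L b (v i)) # ys) + 1) c (\<lambda>i. Scal L b (?y i))" for c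
    using ev_scale[OF y, of c] ev_op0[of "xs @ (d, v) # ys" c]
      op0_scale[of "map (\<lambda>(d, x). (d, ev L d c x)) xs" "map (\<lambda>(d, x). (d, ev L d c x)) ys"]
      assms homog_map_ev ev_Gr ev_scale[OF assms(2)]
    by simp
qed

lemma poly_symmetric:
  assumes "homog (polyL L) (xs @ ys)" "v \<in> ctens L 1 d" "w \<in> ctens L 1 e"
  shows "op0 (polyL L) (xs @ (d, v) # (e, w) # ys) =
    signed (d * e) (op0 (polyL L) (xs @ (e, w) # (d, v) # ys))" (is "_ = signed _ ?y")
proof (rule op0_poly_eqI)
  show "homog (polyL L) (xs @ (d, v) # (e, w) # ys)" using assms by simp
  have y: "?y \<in> ctens L 1 (total_deg (xs @ (d, v) # (e, w) # ys) + 1)"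
    using op0_poly_Gr[of "xs @ (e, w) # (d, v) # ys"] assms by (simp add: algebra_simps)
  show "signed (d * e) ?y \<in> ctens L 1 (total_deg (xs @ (d, v) # (e, w) # ys) + 1)"
    using ctens_signed[OF _ y] by simp
  show "op0 L (map (\<lambda>(d, x). (d, ev L d c x)) (xs @ (d, v) # (e, w) # ys)) =
      ev L (total_deg (xs @ (d, v) # (e, w) # ys) + 1) c (signed (d * e) ?y)" for c
    using ev_signed[OF y, of c "d * e"] ev_op0[of "xs @ (e, w) # (d, v) # ys" c]
      op0_swap[of "map (\<lambda>(d, x). (d, ev L d c x)) xs" "map (\<lambda>(d, x). (d, ev L d c x)) ys"
        "ev L d c v" d "ev L e c w" e]
      assms homog_map_ev ev_Gr
    by (simp add: algebra_simps)
qed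

lemma poly_relations:
  assumes xs: "homog (polyL L) xs"
  shows "(\<Sum>A\<in>Pow {..<length xs}. signed (koszul (map fst xs) A)
    (op0 (polyL L) ((total_deg (nths xs A) + 1, op0 (polyL L) (nths xs A)) # nths xs (- A)))) = 0"
    (is "(\<Sum>A\<in>_. signed _ (?g A)) = 0")
proof (rule poly_eq_0I)
  let ?e = "\<lambda>c. map (\<lambda>(d, x). (d, ev L d c x))"
  have hom: "homog (polyL L) ((total_deg (nths xs A) + 1, op0 (polyL L) (nths xs A)) # nths xs (- A))" for A
    using homog_nths[OF xs] op0_poly_Gr by simp
  have deg: "total_deg (nths xs A) + 1 + total_deg (nths xs (- A)) = total_deg xs + 1" for A
    using total_deg_nths_compl[of xs A] by simp
  have g: "?g A \<in> ctens L 1 (total_deg xs + 2)" for A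
    using op0_poly_Gr[OF hom, of A] deg[of A] by (simp add: algebra_simps)
  have sg: "signed (koszul (map fst xs) A) (?g A) \<in> ctens L 1 (total_deg xs + 2)" for A
    using ctens_signed[OF _ g] by simp
  show "(\<Sum>A\<in>Pow {..<length xs}. signed (koszul (map fst xs) A) (?g A)) \<in> ctens L 1 (total_deg xs + 2)"
    by (intro ev_sum sg)
  fix c
  have eg: "ev L (total_deg xs + 2) c (?g A) =
      op0 L ((total_deg (nths (?e c xs) A) + 1, op0 L (nths (?e c xs) A)) # nths (?e c xs) (- A))" for A
    using ev_op0[OF hom, of A c] deg[of A] ev_op0[OF homog_nths[OF xs], of A c]
    by (simp add: nths_map total_deg_map algebra_simps)
  have "ev L (total_deg xs + 2) c (\<Sum>A\<in>Pow {..<length xs}. signed (koszul (map fst xs) A) (?g A)) =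
      (\<Sum>A\<in>Pow {..<length xs}. signed (koszul (map fst xs) A) (ev L (total_deg xs + 2) c (?g A)))"
    by (subst ev_sum(1)[OF sg]) (simp add: ev_signed[OF g])
  also have "\<dots> = 0"
  proof -
    have "map fst (?e c xs) = map fst xs" by (induction xs) auto
    then show ?thesis using op0_relations[OF homog_map_ev[OF xs, of c]] by (simp only: eg length_map)
  qed
  finally show "ev L (total_deg xs + 2) c (\<Sum>A\<in>Pow {..<length xs}. signed (koszul (map fst xs) A) (?g A)) = 0" .
qed

theorem poly_Linf: "Linf_char0 (polyL L)"
proof (intro Linf_char0.intro filtered_shifted_Linf.intro shifted_Linf.intro
    shifted_Linf_axioms.intro filtered_shifted_Linf_axioms.intro vector_space_poly)
  fix xs ys :: "(int \<times> (nat \<Rightarrow> 'v)) list" and v w and d e :: int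
  show "P.subspace (Gr (polyL L) d)" using ctens_subspace by simp
  show "v \<in> Gr (polyL L) d \<Longrightarrow> Diff (polyL L) d v \<in> Gr (polyL L) (d + 1)"
    using Diff_Filt_ctens by simp
  show "v \<in> Gr (polyL L) d \<Longrightarrow> w \<in> Gr (polyL L) d \<Longrightarrow>
      Diff (polyL L) d (v + w) = Diff (polyL L) d v + Diff (polyL L) d w"
    using Diff_add ctens_Gr by (auto simp: fun_eq_iff)
  show "v \<in> Gr (polyL L) d \<Longrightarrow> Diff (polyL L) d (Scal (polyL L) c v) = Scal (polyL L) c (Diff (polyL L) d v)" for c
    using Diff_scale ctens_Gr by (auto simp: fun_eq_iff)
  show "2 \<le> length xs \<Longrightarrow> homog (polyL L) xs \<Longrightarrow> Brk (polyL L) xs \<in> Gr (polyL L) (total_deg xs + 1)"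
    using op0_poly_Gr[of xs] by (simp add: op0_Brk)
  show "1 \<le> length xs + length ys \<Longrightarrow> homog (polyL L) (xs @ ys) \<Longrightarrow> v \<in> Gr (polyL L) d \<Longrightarrow> w \<in> Gr (polyL L) d \<Longrightarrow>
      Brk (polyL L) (xs @ (d, v + w) # ys) = Brk (polyL L) (xs @ (d, v) # ys) + Brk (polyL L) (xs @ (d, w) # ys)"
    using poly_add[of xs ys v d w] by (simp add: op0_Brk)
  show "1 \<le> length xs + length ys \<Longrightarrow> homog (polyL L) (xs @ ys) \<Longrightarrow> v \<in> Gr (polyL L) d \<Longrightarrow>
      Brk (polyL L) (xs @ (d, Scal (polyL L) c v) # ys) = Scal (polyL L) c (Brk (polyL L) (xs @ (d, v) # ys))" for c
    using poly_scale[of xs ys v d c] by (simp add: op0_Brk)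
  show "homog (polyL L) (xs @ ys) \<Longrightarrow> v \<in> Gr (polyL L) d \<Longrightarrow> w \<in> Gr (polyL L) e \<Longrightarrow>
      Brk (polyL L) (xs @ (d, v) # (e, w) # ys) = signed (d * e) (Brk (polyL L) (xs @ (e, w) # (d, v) # ys))"
    using poly_symmetric[of xs ys v d w e] by (simp add: op0_Brk)
  show "(\<Sum>A | A \<subseteq> {..<length xs} \<and> A \<noteq> {}. signed (koszul (map fst xs) A)
      (Op (polyL L) ((total_deg (nths xs A) + 1, Op (polyL L) (nths xs A)) # nths xs (- A)))) = 0"
    if ne: "xs \<noteq> []" and xs: "homog (polyL L) xs"
  proof -
    have ne': "nths xs A \<noteq> []" if A: "A \<subseteq> {..<length xs}" "A \<noteq> {}" for A
    proof -
      obtain i where i: "i \<in> A" "i < length xs" using A by auto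
      then have "{i. i < length xs \<and> i \<in> A} \<noteq> {}" by auto
      then have "length (nths xs A) \<noteq> 0" unfolding length_nths by simp
      then show ?thesis by auto
    qed
    \<comment> \<open>This is the term of the empty subset, absent from the axiom and present in the
      sum over the power set.\<close>
    have "op0 (polyL L) ((1, 0) # xs) = 0"
      using poly_scale[of "[]" xs 0 1 0] xs ctens_0[of 1] by (simp add: zero_fun_def)
    then have "(\<Sum>A | A \<subseteq> {..<length xs} \<and> A \<noteq> {}. signed (koszul (map fst xs) A)
        (op0 (polyL L) ((total_deg (nths xs A) + 1, op0 (polyL L) (nths xs A)) # nths xs (- A)))) =
      (\<Sum>A\<in>Pow {..<length xs}. signed (koszul (map fst xs) A)
        (op0 (polyL L) ((total_deg (nths xs A) + 1, op0 (polyL L) (nths xs A)) # nths xs (- A))))"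
      by (intro sum.mono_neutral_left) (auto simp: signed_def nths_all)
    then show ?thesis using poly_relations[OF xs] ne' by (simp add: op0_def)
  qed
  show "1 \<le> n \<Longrightarrow> P.subspace (Filt (polyL L) n d)" for n using ctens_subspace by simp
  show "Filt (polyL L) 1 d = Gr (polyL L) d" by simp
  show "1 \<le> n \<Longrightarrow> Filt (polyL L) (Suc n) d \<subseteq> Filt (polyL L) n d" for n using ctens_mono by auto
  show "1 \<le> n \<Longrightarrow> v \<in> Filt (polyL L) n d \<Longrightarrow> Diff (polyL L) d v \<in> Filt (polyL L) n (d + 1)" for n
    using Diff_Filt_ctens by simp
  show "bij_betw (\<lambda>v. \<lambda>k\<in>{1..}. (+) v ` Filt (polyL L) k d) (Gr (polyL L) d)
      (lim_quot (Gr (polyL L) d) (\<lambda>k. Filt (polyL L) k d))"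
    using poly_complete by simp
  show "Brk (polyL L) xs \<in> Filt (polyL L) (sum_list ns) (total_deg xs + 1)"
    if l: "2 \<le> length xs" "length ns = length xs"
      and ns: "\<And>i. i < length xs \<Longrightarrow> 1 \<le> ns ! i \<and> snd (xs ! i) \<in> Filt (polyL L) (ns ! i) (fst (xs ! i))" for ns
  proof -
    have "homog (polyL L) xs"
      unfolding homog_def using ns ctens_mono[of _ _ _ 1] by (fastforce simp: in_set_conv_nth)
    moreover have "sum_list ns \<ge> 1"
    proof -
      have "xs \<noteq> []" using l by auto
      then show ?thesis using ns[of 0] l by (cases ns) auto
    qed
    ultimately show ?thesis using op0_poly_ctens[of xs ns "sum_list ns"] l ns by (simp add: op0_Brk)
  qed
qed

lemma ev_filt_map: "filt_map (polyL L) L (\<lambda>d. ev L d c)"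
proof -
  interpret Q: Linf_char0 "polyL L" by (rule poly_Linf)
  show ?thesis by unfold_locales (auto intro!: filt_homI ev_Filt ev_add ev_scale)
qed

end

section \<open>Twisting\<close>

text \<open>
  The operations twisted by \<open>a\<close>: the curvature of \<open>a\<close> is \<open>tw L a []\<close>, and the twisted
  differential of \<open>v\<close> is \<open>tw L a [(d, v)]\<close>.
\<close>

definition tw :: "('k::field_char_0, 'v::ab_group_add) Linf \<Rightarrow> 'v \<Rightarrow> (int \<times> 'v) list \<Rightarrow> 'v" where
  "tw L a xs = fsum L (total_deg xs + 1) (\<lambda>k. Scal L (1 / fact k) (op0 L (replicate k (0, a) @ xs)))"

lemma nths_replicate: "nths (replicate n x) A = replicate (card (A \<inter> {..<n})) x"
proof (induction n)
  case (Suc n)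
  have "nths (replicate (Suc n) x) A = nths (replicate n x @ [x]) A"
    by (simp add: replicate_append_same)
  also have "\<dots> = replicate (card (A \<inter> {..<Suc n})) x"
    unfolding nths_append by (simp add: Suc lessThan_Suc Int_insert_right replicate_append_same)
  finally show ?case .
qed simp

text \<open>A pair that meets the block of degree 0 entries has product 0, so only pairs inside
  \<open>ds\<close> contribute to the exponent.\<close>

lemma koszul_replicate_0: "koszul (replicate n 0 @ ds) A = koszul ds {j. j + n \<in> A}"
proof -
  let ?h = "\<lambda>(i, j). (replicate n 0 @ ds) ! i * (replicate n 0 @ ds) ! j"
  let ?X = "{(i, j). i < j \<and> j < length (replicate n (0::int) @ ds) \<and> i \<notin> A \<and> j \<in> A}"
  let ?Y = "{(i, j). i < j \<and> j < length ds \<and> i \<notin> {j. j + n \<in> A} \<and> j \<in> {j. j + n \<in> A}}"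
  have fin: "finite ?X"
    by (rule finite_subset[of _ "{..<n + length ds} \<times> {..<n + length ds}"]) auto
  have "koszul (replicate n 0 @ ds) A = sum ?h {(i, j) \<in> ?X. n \<le> i}"
    unfolding koszul_def by (rule sum.mono_neutral_right[OF fin]) (auto simp: nth_append split: if_splits)
  also have "\<dots> = (\<Sum>(i, j)\<in>?Y. ds ! i * ds ! j)"
    by (rule sum.reindex_bij_witness[of _ "\<lambda>(i, j). (i + n, j + n)" "\<lambda>(i, j). (i - n, j - n)"])
      (auto simp: nth_append)
  finally show ?thesis by (simp add: koszul_def)
qed

context Linf_char0
begin

lemma sum_Pow_card:
  assumes "finite S"
  shows "(\<Sum>C\<in>Pow S. f (card C)) = (\<Sum>p\<le>card S. Scal L (of_nat (card S choose p)) (f p))"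
proof -
  have "(\<Sum>C\<in>Pow S. f (card C)) = (\<Sum>p\<le>card S. \<Sum>C | C \<in> Pow S \<and> card C = p. f (card C))"
    by (rule sum.group[symmetric]) (use assms in \<open>auto intro: card_mono\<close>)
  also have "\<dots> = (\<Sum>p\<le>card S. \<Sum>C | C \<subseteq> S \<and> card C = p. f p)"
    by (intro sum.cong) auto
  also have "\<dots> = (\<Sum>p\<le>card S. Scal L (of_nat (card S choose p)) (f p))"
    by (simp add: sum_constant_scale n_subsets[OF assms])
  finally show ?thesis .
qed

text \<open>A set of positions in \<open>n\<close> copies of \<open>a\<close> followed by
  \<open>ys\<close> is a set \<open>B\<close> of positions in \<open>ys\<close> together with a
  subset of the copies. The latter enters only through its size \<open>p\<close>, since the copies
  are equal and of degree 0, and this produces the binomial coefficient.\<close>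

lemma op0_relations_replicate:
  assumes a: "a \<in> Gr L 0" and ys: "homog L ys"
  shows "(\<Sum>B\<in>Pow {..<length ys}. \<Sum>p\<le>n. Scal L (of_nat (n choose p)) (signed (koszul (map fst ys) B)
    (op0 L ((total_deg (nths ys B) + 1, op0 L (replicate p (0, a) @ nths ys B)) #
      replicate (n - p) (0, a) @ nths ys (- B))))) = 0"
proof -
  define xs where "xs = replicate n (0, a) @ ys"
  define h where "h p B = signed (koszul (map fst ys) B)
    (op0 L ((total_deg (nths ys B) + 1, op0 L (replicate p (0, a) @ nths ys B)) #
      replicate (n - p) (0, a) @ nths ys (- B)))" for p B
  have nA: "nths xs A = replicate (card (A \<inter> {..<n})) (0, a) @ nths ys {j. j + n \<in> A}" for A
    by (simp add: xs_def nths_append nths_replicate)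
  have card_compl: "card (- A \<inter> {..<n}) = n - card (A \<inter> {..<n})" for A
  proof -
    have "- A \<inter> {..<n} = {..<n} - A \<inter> {..<n}" by auto
    then show ?thesis by (simp add: card_Diff_subset)
  qed
  have nA': "nths xs (- A) = replicate (n - card (A \<inter> {..<n})) (0, a) @ nths ys (- {j. j + n \<in> A})" for A
    by (simp add: nA card_compl Collect_neg_eq[symmetric])
  have kz: "koszul (map fst xs) A = koszul (map fst ys) {j. j + n \<in> A}" for A
    using koszul_replicate_0[of n "map fst ys" A] by (simp add: xs_def)
  have "homog L xs" using a ys by (simp add: xs_def)
  from op0_relations[OF this]
  have "0 = (\<Sum>A\<in>Pow {..<n + length ys}. h (card (A \<inter> {..<n})) {j. j + n \<in> A})"
    unfolding nA' unfolding nA kz by (simp add: h_def) (simp add: xs_def)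
  also have "\<dots> = (\<Sum>(B, C)\<in>Pow {..<length ys} \<times> Pow {..<n}. h (card C) B)"
  proof (rule sum.reindex_bij_witness[of _ "\<lambda>(B, C). C \<union> (\<lambda>j. j + n) ` B"
      "\<lambda>A. ({j. j + n \<in> A}, A \<inter> {..<n})"])
    fix A assume A: "A \<in> Pow {..<n + length ys}"
    have "x \<in> (\<lambda>j. j + n) ` {j. j + n \<in> A}" if "x \<in> A" "\<not> x < n" for x
      using that by (intro image_eqI[of _ _ "x - n"]) auto
    then show "(case ({j. j + n \<in> A}, A \<inter> {..<n}) of (B, C) \<Rightarrow> C \<union> (\<lambda>j. j + n) ` B) = A" by auto
  next
    fix p assume "p \<in> Pow {..<length ys} \<times> Pow {..<n}"
    then obtain B C where p: "p = (B, C)" "B \<subseteq> {..<length ys}" "C \<subseteq> {..<n}" by auto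
    then have "{j. j + n \<in> C \<union> (\<lambda>j. j + n) ` B} = B" "(C \<union> (\<lambda>j. j + n) ` B) \<inter> {..<n} = C" by auto
    then show "({j. j + n \<in> (case p of (B, C) \<Rightarrow> C \<union> (\<lambda>j. j + n) ` B)},
        (case p of (B, C) \<Rightarrow> C \<union> (\<lambda>j. j + n) ` B) \<inter> {..<n}) = p" by (simp add: p)
    show "(case p of (B, C) \<Rightarrow> C \<union> (\<lambda>j. j + n) ` B) \<in> Pow {..<n + length ys}"
      using p(2,3) by (fastforce simp: p(1))
  qed auto
  also have "\<dots> = (\<Sum>B\<in>Pow {..<length ys}. \<Sum>C\<in>Pow {..<n}. h (card C) B)"
    by (rule sum.cartesian_product[symmetric])
  also have "\<dots> = (\<Sum>B\<in>Pow {..<length ys}. \<Sum>p\<le>n. Scal L (of_nat (n choose p)) (h p B))"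
    using sum_Pow_card[of "{..<n}" "\<lambda>p. h p B" for B] by simp
  finally show ?thesis by (simp add: h_def)
qed

lemma op0_replicate_Filt:
  assumes "a \<in> Gr L 0" "homog L xs" "1 \<le> k" "k \<le> n + length xs"
  shows "op0 L (replicate n (0, a) @ xs) \<in> Filt L k (total_deg xs + 1)"
  using op0_Filt_length[of "replicate n (0, a) @ xs" k] assms by simp

lemma tw_ctens:
  assumes a: "a \<in> Gr L 0" and xs: "homog L xs"
    and m: "1 \<le> m" "\<And>k. op0 L (replicate k (0, a) @ xs) \<in> Filt L m (total_deg xs + 1)"
  shows "(\<lambda>k. Scal L (1 / fact k) (op0 L (replicate k (0, a) @ xs))) \<in> ctens L m (total_deg xs + 1)"
proof (rule ctensI)
  fix k :: nat assume "k \<ge> 1"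
  then show "\<exists>N. \<forall>i\<ge>N. Scal L (1 / fact i) (op0 L (replicate i (0, a) @ xs)) \<in> Filt L k (total_deg xs + 1)"
    using op0_replicate_Filt[OF a xs, of k] Filt_scale by (intro exI[of _ k]) auto
qed (use m Filt_scale in auto)

lemma tw_ctens_1:
  assumes "a \<in> Gr L 0" "homog L xs"
  shows "(\<lambda>k. Scal L (1 / fact k) (op0 L (replicate k (0, a) @ xs))) \<in> ctens L 1 (total_deg xs + 1)"
  by (rule tw_ctens) (use assms op0_Gr[of "replicate k (0, a) @ xs" for k] in auto)

lemma tw_Filt:
  assumes "a \<in> Gr L 0" "homog L xs" "1 \<le> m"
    "\<And>k. op0 L (replicate k (0, a) @ xs) \<in> Filt L m (total_deg xs + 1)"
  shows "tw L a xs \<in> Filt L m (total_deg xs + 1)"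
  unfolding tw_def by (intro fsum_Filt tw_ctens assms)

lemma tw_Gr: "a \<in> Gr L 0 \<Longrightarrow> homog L xs \<Longrightarrow> tw L a xs \<in> Gr L (total_deg xs + 1)"
  unfolding tw_def by (intro fsum_Gr tw_ctens_1)

lemma tw_mod:
  assumes "a \<in> Gr L 0" "homog L xs" "1 \<le> n"
  shows "tw L a xs - (\<Sum>k<n. Scal L (1 / fact k) (op0 L (replicate k (0, a) @ xs))) \<in> Filt L n (total_deg xs + 1)"
  unfolding tw_def
  by (rule fsum_mod[OF tw_ctens_1]) (use assms op0_replicate_Filt Filt_scale in auto)

lemma tw_Filt_entry:
  assumes a: "a \<in> Gr L 0" and xs: "homog L (xs @ ys)" and k: "k \<ge> 1" and v: "v \<in> Filt L k d"
  shows "tw L a (xs @ (d, v) # ys) \<in> Filt L (k + length xs + length ys) (total_deg (xs @ (d, v) # ys) + 1)"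
proof (rule tw_Filt[OF a])
  fix n
  have "op0 L ((replicate n (0, a) @ xs) @ (d, v) # ys) \<in>
      Filt L (k + length (replicate n (0, a) @ xs) + length ys) (total_deg ((replicate n (0, a) @ xs) @ (d, v) # ys) + 1)"
    by (rule op0_Filt_entry) (use assms in auto)
  then show "op0 L (replicate n (0, a) @ xs @ (d, v) # ys) \<in>
      Filt L (k + length xs + length ys) (total_deg (xs @ (d, v) # ys) + 1)"
    using Filt_le[where k = "k + length xs + length ys"] k by simp
qed (use assms Filt_Gr in auto)

lemma tw_add:
  assumes a: "a \<in> Gr L 0" and xs: "homog L (xs @ ys)" and v: "v \<in> Gr L d" and w: "w \<in> Gr L d"
  shows "tw L a (xs @ (d, v + w) # ys) = tw L a (xs @ (d, v) # ys) + tw L a (xs @ (d, w) # ys)"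
proof -
  have "op0 L (replicate k (0, a) @ xs @ (d, v + w) # ys) =
      op0 L (replicate k (0, a) @ xs @ (d, v) # ys) + op0 L (replicate k (0, a) @ xs @ (d, w) # ys)" for k
    using op0_add[of "replicate k (0, a) @ xs" ys v d w] assms by simp
  moreover have "(\<lambda>k. Scal L (1 / fact k) (op0 L (replicate k (0, a) @ xs @ (d, u) # ys)))
      \<in> ctens L 1 (total_deg xs + (d + total_deg ys) + 1)" if "u \<in> Gr L d" for u
    using tw_ctens_1[of a "xs @ (d, u) # ys"] assms that by simp
  ultimately show ?thesis
    using fsum_add v w by (simp add: tw_def scale_right_distrib)
qed

lemma tw_scale:
  assumes a: "a \<in> Gr L 0" and xs: "homog L (xs @ ys)" and v: "v \<in> Gr L d"
  shows "tw L a (xs @ (d, Scal L c v) # ys) = Scal L c (tw L a (xs @ (d, v) # ys))"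
proof -
  have "op0 L (replicate k (0, a) @ xs @ (d, Scal L c v) # ys) =
      Scal L c (op0 L (replicate k (0, a) @ xs @ (d, v) # ys))" for k
    using op0_scale[of "replicate k (0, a) @ xs" ys v d c] assms by simp
  then show ?thesis
    using fsum_scale[OF tw_ctens_1[of a "xs @ (d, v) # ys"], of c] assms
    by (simp add: tw_def mult.commute)
qed

lemma tw_zero: "a \<in> Gr L 0 \<Longrightarrow> homog L (xs @ ys) \<Longrightarrow> tw L a (xs @ (d, 0) # ys) = 0"
  using tw_scale[of a xs ys 0 d 0] Gr_0 by simp

lemma tw_diff:
  assumes "a \<in> Gr L 0" "homog L (xs @ ys)" "v \<in> Gr L d" "w \<in> Gr L d"
  shows "tw L a (xs @ (d, v - w) # ys) = tw L a (xs @ (d, v) # ys) - tw L a (xs @ (d, w) # ys)"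
  using tw_add[OF assms(1,2) Gr_diff[OF assms(3,4)] assms(4)] by simp

lemma fsum_diff:
  assumes "f \<in> ctens L 1 d" "g \<in> ctens L 1 d"
  shows "fsum L d f - fsum L d g = fsum L d (f - g)"
  using fsum_add[OF ctens_diff[OF _ assms] assms(2)] by simp

text \<open>The leading term of the series is free of the base point; every later one has at least
  two entries, as \<open>xs\<close> is nonempty, and so gains a step. For the curvature the gain
  fails, because it contains the differential of the base point.\<close>

lemma tw_base_cong:
  assumes a: "a \<in> Gr L 0" and b: "b \<in> Gr L 0" and k: "k \<ge> 1" and ab: "a - b \<in> Filt L k 0"
    and xs: "homog L xs" "xs \<noteq> []"
  shows "tw L a xs - tw L b xs \<in> Filt L (Suc k) (total_deg xs + 1)"
proof -
  let ?f = "\<lambda>a i. Scal L (1 / fact i) (op0 L (replicate i (0, a) @ xs))"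
  have "?f a i - ?f b i \<in> Filt L (Suc k) (total_deg xs + 1)" for i
  proof (cases "i = 0")
    case True
    then show ?thesis using Filt_0 by simp
  next
    case False
    then have len: "i + length xs \<ge> 2" using xs by (cases i; cases xs; auto)
    have "list_all2 (\<lambda>(d, v) (e, w). e = d \<and> v \<in> Gr L d \<and> w \<in> Gr L d \<and> v - w \<in> Filt L k d)
        (replicate i (0, a) @ xs) (replicate i (0, b) @ xs)"
    proof (intro list_all2_appendI list.rel_refl_strong)
      show "list_all2 (\<lambda>(d, v) (e, w). e = d \<and> v \<in> Gr L d \<and> w \<in> Gr L d \<and> v - w \<in> Filt L k d)
        (replicate i (0, a)) (replicate i (0, b))"
        using a b ab by (auto simp: list_all2_conv_all_nth)
    qed (use xs Filt_0[OF k] in \<open>auto simp: homog_def\<close>)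
    then have "op0 L ([] @ replicate i (0, a) @ xs) - op0 L ([] @ replicate i (0, b) @ xs) \<in>
        Filt L (Suc k) (total_deg ([] @ replicate i (0, a) @ xs) + 1)"
      by (rule op0_cong) (use len k in auto)
    then show ?thesis
      using Filt_scale[of "Suc k"] by (simp add: scale_right_diff_distrib[symmetric])
  qed
  moreover have "?f a - ?f b \<in> ctens L 1 (total_deg xs + 1)"
    using ctens_diff tw_ctens_1[OF a xs(1)] tw_ctens_1[OF b xs(1)] by simp
  ultimately have "?f a - ?f b \<in> ctens L (Suc k) (total_deg xs + 1)"
    unfolding ctens_iff by auto
  then have "fsum L (total_deg xs + 1) (?f a - ?f b) \<in> Filt L (Suc k) (total_deg xs + 1)"
    by (rule fsum_Filt) simp
  then show ?thesis
    using fsum_diff[OF tw_ctens_1[OF a xs(1)] tw_ctens_1[OF b xs(1)]] by (simp add: tw_def)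
qed

text \<open>A nested pair of twisted series is a double series in \<open>p\<close> and
  \<open>q\<close>, the numbers of copies of \<open>a\<close> used by the inner and the outer
  operation. The \<open>(p, q)\<close> term lies in step \<open>k\<close> whenever
  \<open>p + q\<close> is at least \<open>k\<close>, so the double series may be summed along
  diagonals.\<close>

lemma tw_double:
  assumes a: "a \<in> Gr L 0" and xs: "homog L xs" and ys: "homog L ys"
  defines "e \<equiv> total_deg xs + 1"
  defines "g \<equiv> \<lambda>p q. Scal L (1 / (fact p * fact q))
    (op0 L ((e, op0 L (replicate p (0, a) @ xs)) # replicate q (0, a) @ ys))"
  shows "(\<lambda>n. \<Sum>p\<le>n. g p (n - p)) \<in> ctens L 1 (e + total_deg ys + 1)"
    and "tw L a ((e, tw L a xs) # ys) = fsum L (e + total_deg ys + 1) (\<lambda>n. \<Sum>p\<le>n. g p (n - p))"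
proof -
  let ?d = "e + total_deg ys + 1"
  have in_e: "op0 L (replicate p (0, a) @ xs) \<in> Gr L e" for p
    using op0_replicate_Filt[OF a xs, of 1 p] op0_Gr[of "replicate p (0, a) @ xs"] a xs by (simp add: e_def)
  have tw_e: "tw L a xs \<in> Gr L e" using tw_Gr[OF a xs] by (simp add: e_def)
  have gF: "g p q \<in> Filt L k ?d" if k: "1 \<le> k" "k \<le> p + q" for k p q
  proof -
    have "op0 L (replicate p (0, a) @ xs) \<in> Filt L (max 1 p) e"
    proof (cases "p = 0")
      case True then show ?thesis using in_e[of p] by simp
    next
      case False then show ?thesis using op0_replicate_Filt[OF a xs, of "max 1 p" p] by (simp add: e_def)
    qed
    then have "op0 L ([] @ (e, op0 L (replicate p (0, a) @ xs)) # replicate q (0, a) @ ys) \<in>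
        Filt L (max 1 p + length ([] :: (int \<times> 'v) list) + length (replicate q (0, a) @ ys))
          (total_deg ([] @ (e, op0 L (replicate p (0, a) @ xs)) # replicate q (0, a) @ ys) + 1)"
      by (intro op0_Filt_entry) (use a ys in auto)
    then have "op0 L ((e, op0 L (replicate p (0, a) @ xs)) # replicate q (0, a) @ ys) \<in> Filt L k ?d"
      using Filt_le[where k = k] k by simp
    then show ?thesis unfolding g_def using Filt_scale k by blast
  qed
  have gG: "g p q \<in> Gr L ?d" for p q
    using op0_Gr[of "(e, op0 L (replicate p (0, a) @ xs)) # replicate q (0, a) @ ys"] in_e a ys Gr_scale
    by (simp add: g_def)
  show ser: "(\<lambda>n. \<Sum>p\<le>n. g p (n - p)) \<in> ctens L 1 ?d"
  proof (rule ctensI)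
    fix k :: nat assume k: "k \<ge> 1"
    show "\<exists>N. \<forall>n\<ge>N. (\<Sum>p\<le>n. g p (n - p)) \<in> Filt L k ?d"
      by (intro exI[of _ k] allI impI Filt_sum[OF k] gF[OF k]) auto
  qed (auto intro!: Gr_sum gG)
  show "tw L a ((e, tw L a xs) # ys) = fsum L ?d (\<lambda>n. \<Sum>p\<le>n. g p (n - p))"
  proof (rule fsum_eqI[OF ser, symmetric])
    show "tw L a ((e, tw L a xs) # ys) \<in> Gr L ?d"
      using tw_Gr[OF a, of "(e, tw L a xs) # ys"] tw_e ys by simp
    fix k :: nat assume k: "k \<ge> 1"
    have "tw L a ((e, tw L a xs) # ys) -
        (\<Sum>q<k. Scal L (1 / fact q) (op0 L (replicate q (0, a) @ (e, tw L a xs) # ys))) \<in> Filt L k ?d"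
      using tw_mod[OF a _ k, of "(e, tw L a xs) # ys"] tw_e ys by simp
    moreover have "(\<Sum>q<k. Scal L (1 / fact q) (op0 L (replicate q (0, a) @ (e, tw L a xs) # ys))) -
        (\<Sum>q<k. \<Sum>p<k. g p q) \<in> Filt L k ?d"
      unfolding sum_subtractf[symmetric]
    proof (rule Filt_sum[OF k])
      fix q
      let ?s = "\<Sum>p<k. Scal L (1 / fact p) (op0 L (replicate p (0, a) @ xs))"
      let ?r = "replicate q (0, a) @ ys"
      have sG: "?s \<in> Gr L e" by (intro Gr_sum Gr_scale in_e)
      have r: "homog L ([] @ ?r)" using a ys by simp
      have "op0 L ((e, ?s) # ?r) = (\<Sum>p<k. Scal L (1 / fact p) (op0 L ((e, op0 L (replicate p (0, a) @ xs)) # ?r)))"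
        using op0_sum[OF r, of "{..<k}" "\<lambda>p. Scal L (1 / fact p) (op0 L (replicate p (0, a) @ xs))" e]
          op0_scale[OF r in_e] in_e Gr_scale by simp
      then have 1: "Scal L (1 / fact q) (op0 L ((e, ?s) # ?r)) = (\<Sum>p<k. g p q)"
        by (simp add: g_def scale_sum_right mult.commute)
      \<comment> \<open>Twisting puts the copies of \<open>a\<close> in front, whereas the relations
        put the inner result in front.\<close>
      have 2: "op0 L (replicate q (0, a) @ (e, tw L a xs) # ys) = op0 L ((e, tw L a xs) # ?r)"
        using op0_move[OF a tw_e, of "[]" ys q] ys by simp
      have "op0 L ((e, tw L a xs) # ?r) - op0 L ((e, ?s) # ?r) = op0 L ([] @ (e, tw L a xs - ?s) # ?r)"
        using op0_diff[OF r tw_e sG] by simp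
      also have "\<dots> \<in> Filt L (k + length ([] :: (int \<times> 'v) list) + length ?r)
          (total_deg ([] @ (e, tw L a xs - ?s) # ?r) + 1)"
        by (rule op0_Filt_entry[OF r k]) (use tw_mod[OF a xs k] in \<open>simp add: e_def\<close>)
      finally have "op0 L ((e, tw L a xs) # ?r) - op0 L ((e, ?s) # ?r) \<in> Filt L k ?d"
        using Filt_le[where k = k] k by simp
      from Filt_scale[OF k this, of "1 / fact q"]
      show "Scal L (1 / fact q) (op0 L (replicate q (0, a) @ (e, tw L a xs) # ys)) - (\<Sum>p<k. g p q) \<in> Filt L k ?d"
        unfolding 1[symmetric] 2 by (simp add: scale_right_diff_distrib)
    qed
    ultimately have 1: "tw L a ((e, tw L a xs) # ys) - (\<Sum>q<k. \<Sum>p<k. g p q) \<in> Filt L k ?d"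
      using Filt_trans[OF k] by blast
    have "(\<Sum>m<n. \<Sum>p\<le>m. g p (m - p)) - tw L a ((e, tw L a xs) # ys) \<in> Filt L k ?d" if n: "n \<ge> 2 * k" for n
    proof -
      let ?T = "{(p, q). p + q < n}"
      have fin: "finite ?T" by (rule finite_subset[of _ "{..<n} \<times> {..<n}"]) auto
      \<comment> \<open>For large \<open>n\<close> the triangle of summed diagonals contains the
        square of truncated series, and every pair outside the square has an index at least
        \<open>k\<close>.\<close>
      have sub: "{..<k} \<times> {..<k} \<subseteq> ?T" using n by auto
      have "(\<Sum>m<n. \<Sum>p\<le>m. g p (m - p)) = (\<Sum>(p, q)\<in>?T. g p q)"
        by (rule sum.triangle_reindex[symmetric])
      moreover have "(\<Sum>q<k. \<Sum>p<k. g p q) = (\<Sum>(p, q)\<in>{..<k} \<times> {..<k}. g p q)"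
        by (subst sum.swap) (rule sum.cartesian_product)
      ultimately have "(\<Sum>m<n. \<Sum>p\<le>m. g p (m - p)) - (\<Sum>q<k. \<Sum>p<k. g p q) =
          (\<Sum>(p, q)\<in>?T - {..<k} \<times> {..<k}. g p q)"
        using sum_diff[OF fin sub, of "\<lambda>(p, q). g p q"] by simp
      also have "\<dots> \<in> Filt L k ?d"
        by (rule Filt_sum[OF k]) (use gF k in force)
      finally show ?thesis using Filt_trans[OF k _ Filt_swap[OF k 1]] by blast
    qed
    then show "\<exists>N. \<forall>n\<ge>N. (\<Sum>m<n. \<Sum>p\<le>m. g p (m - p)) - tw L a ((e, tw L a xs) # ys) \<in> Filt L k ?d"
      by blast
  qed
qed

text \<open>The relation for \<open>n\<close> copies of \<open>a\<close>, divided by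
  \<open>n!\<close>, is the diagonal \<open>p + q = n\<close> of the double series, since the
  binomial coefficient over \<open>n!\<close> is \<open>1/(p! q!)\<close>. Thus each diagonal
  vanishes. The empty subset now contributes the curvature as an extra entry.\<close>

theorem twisted_relations:
  assumes a: "a \<in> Gr L 0" and ys: "homog L ys"
  shows "(\<Sum>B\<in>Pow {..<length ys}. signed (koszul (map fst ys) B)
    (tw L a ((total_deg (nths ys B) + 1, tw L a (nths ys B)) # nths ys (- B)))) = 0"
proof -
  define d where "d = total_deg ys + 2"
  define G where "G B p q = Scal L (1 / (fact p * fact q))
      (op0 L ((total_deg (nths ys B) + 1, op0 L (replicate p (0, a) @ nths ys B)) #
        replicate q (0, a) @ nths ys (- B)))" for B p q
  \<comment> \<open>Written as scalars, the signs pass through convergent sums.\<close>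
  define s where "s B v = Scal L (if even (koszul (map fst ys) B) then 1 else -1) v" for B v
  have s: "signed (koszul (map fst ys) B) v = s B v" for B v by (simp add: signed_def s_def)
  have deg: "total_deg (nths ys B) + 1 + total_deg (nths ys (- B)) + 1 = d" for B
    using total_deg_nths_compl[of ys B] by (simp add: d_def)
  have ser: "(\<lambda>n. \<Sum>p\<le>n. G B p (n - p)) \<in> ctens L 1 d"
    and tw: "tw L a ((total_deg (nths ys B) + 1, tw L a (nths ys B)) # nths ys (- B)) =
      fsum L d (\<lambda>n. \<Sum>p\<le>n. G B p (n - p))" for B
    using tw_double[OF a homog_nths[OF ys, of B] homog_nths[OF ys, of "- B"]] unfolding deg G_def by auto
  have "(\<Sum>B\<in>Pow {..<length ys}. s B (\<Sum>p\<le>n. G B p (n - p))) = 0" for n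
  proof -
    let ?h = "\<lambda>B p. op0 L ((total_deg (nths ys B) + 1, op0 L (replicate p (0, a) @ nths ys B)) #
        replicate (n - p) (0, a) @ nths ys (- B))"
    have "(\<Sum>B\<in>Pow {..<length ys}. s B (\<Sum>p\<le>n. G B p (n - p))) =
      (\<Sum>B\<in>Pow {..<length ys}. \<Sum>p\<le>n. Scal L (1 / fact n) (Scal L (of_nat (n choose p)) (s B (?h B p))))"
      by (auto simp: G_def s_def scale_sum_right binomial_fact mult.commute intro!: sum.cong)
    also have "\<dots> = Scal L (1 / fact n)
        (\<Sum>B\<in>Pow {..<length ys}. \<Sum>p\<le>n. Scal L (of_nat (n choose p)) (s B (?h B p)))"
      by (simp add: scale_sum_right)
    also have "\<dots> = 0" using op0_relations_replicate[OF a ys, of n] by (simp add: s)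
    finally show ?thesis .
  qed
  moreover have "(\<Sum>B\<in>Pow {..<length ys}. s B (fsum L d (\<lambda>n. \<Sum>p\<le>n. G B p (n - p)))) =
      fsum L d (\<lambda>n. \<Sum>B\<in>Pow {..<length ys}. s B (\<Sum>p\<le>n. G B p (n - p)))"
    unfolding s_def
    by (subst fsum_sum(1)[OF ctens_scale_coeff[OF order_refl ser]]) (simp, simp only: fsum_scale[OF ser])
  ultimately show ?thesis by (simp add: s tw)
qed

text \<open>The twisted relation on one entry: the full subset gives the square of the twisted
  differential, the empty one the curvature term.\<close>

lemma tw_square:
  assumes a: "a \<in> Gr L 0" and v: "v \<in> Gr L d"
  shows "tw L a [(d + 1, tw L a [(d, v)])] = - tw L a [(1, tw L a []), (d, v)]"
proof -
  have P: "Pow {..<length [(d, v)]} = {{}, {0}}" by (auto simp: subset_insert_iff)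
  have k: "koszul [d] B = 0" for B by (auto simp: koszul_def intro!: sum.neutral)
  show ?thesis using twisted_relations[OF a, of "[(d, v)]"] v unfolding P
    by (simp add: k signed_def nths_Cons eq_neg_iff_add_eq_0 add.commute)
qed

text \<open>The twisted relation on two entries of degree -1. Up to the curvature term it says that
  the twisted differential is a derivation of the twisted binary bracket.\<close>

lemma tw_Leibniz:
  assumes a: "a \<in> Gr L 0" and v: "v \<in> Gr L (- 1)" and w: "w \<in> Gr L (- 1)"
  shows "tw L a [(- 1, tw L a [(- 1, v), (- 1, w)])] + tw L a [(0, tw L a [(- 1, v)]), (- 1, w)]
    - tw L a [(0, tw L a [(- 1, w)]), (- 1, v)] = - tw L a [(1, tw L a []), (- 1, v), (- 1, w)]"
proof -
  have P: "Pow {..<length [(- 1, v), (- 1, w)]} = {{}, {0}, {1}, {0, 1}}"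
    by (auto simp: numeral_2_eq_2 lessThan_Suc Pow_insert)
  \<comment> \<open>The only sign among the four subsets: the second entry is moved past the first,
    and the product of their degrees is odd.\<close>
  have k1: "koszul [- 1, - 1] {Suc 0} = 1"
  proof -
    have "{(i, j). i < j \<and> j < length [- 1, - 1 :: int] \<and> i \<notin> {Suc 0} \<and> j \<in> {Suc 0}} = {(0, Suc 0)}" by auto
    then show ?thesis unfolding koszul_def by simp
  qed
  have k0: "koszul [- 1, - 1] B = 0" if "B = {} \<or> 0 \<in> B" for B
    unfolding koszul_def using that by (auto simp: less_Suc_eq intro!: sum.neutral)
  have ne: "{0} \<noteq> {Suc 0}" "{} \<noteq> {Suc 0}" "{0, Suc 0} \<noteq> {Suc 0}" "{0, Suc 0} \<noteq> {0}" "{0, Suc 0} \<noteq> {}"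
    by (auto simp: set_eq_iff)
  show ?thesis using twisted_relations[OF a, of "[(- 1, v), (- 1, w)]"] v w unfolding P
    by (simp add: k0 k1 ne signed_def nths_Cons eq_neg_iff_add_eq_0 algebra_simps)
qed

text \<open>Index 0 of the twisted series vanishes by the convention for the empty operation and
  index 1 is the differential, which explains the shift by two in \<open>curv\<close>.\<close>

lemma curv_eq_tw:
  assumes a: "a \<in> Gr L 0"
  shows "curv L a = tw L a []"
proof -
  let ?f = "\<lambda>k. Scal L (1 / fact k) (op0 L (replicate k (0, a)))"
  have f: "?f \<in> ctens L 1 1" using tw_ctens_1[OF a, of "[]"] by simp
  have "tw L a [] = ?f 0 + (?f 1 + fsum L 1 (\<lambda>k. ?f (Suc (Suc k))))"
    using fsum_Suc[OF f] fsum_Suc[OF ctens_shift[OF f]] by (simp add: tw_def)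
  moreover have "(\<lambda>k. ?f (Suc (Suc k))) = (\<lambda>k. Scal L (1 / fact (k + 2)) (Brk L (replicate (k + 2) (0, a))))"
    by (simp add: op0_Brk)
  ultimately show ?thesis unfolding curv_def by (simp only:) (simp add: op0_single)
qed

end

section \<open>Morphisms, derivations and flows\<close>

definition lift :: "(int \<Rightarrow> 'v \<Rightarrow> 'w) \<Rightarrow> int \<Rightarrow> (nat \<Rightarrow> 'v) \<Rightarrow> nat \<Rightarrow> 'w" where
  "lift f d x = (\<lambda>i. f d (x i))"

lemma lift_apply [simp]: "lift f d x i = f d (x i)"
  by (simp add: lift_def)

definition map_entries :: "(int \<Rightarrow> 'v \<Rightarrow> 'w) \<Rightarrow> (int \<times> 'v) list \<Rightarrow> (int \<times> 'w) list" where
  "map_entries f xs = map (\<lambda>(d, x). (d, f d x)) xs"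

lemma map_entries_simps [simp]:
  "map_entries f [] = []"
  "map_entries f ((d, x) # xs) = (d, f d x) # map_entries f xs"
  "map_entries f (xs @ ys) = map_entries f xs @ map_entries f ys"
  "map_entries f (replicate n (d, x)) = replicate n (d, f d x)"
  "length (map_entries f xs) = length xs"
  by (simp_all add: map_entries_def)

lemma total_deg_map_entries [simp]: "total_deg (map_entries f xs) = total_deg xs"
  by (induction xs) auto

definition upd_entry :: "(int \<Rightarrow> 'v \<Rightarrow> 'v) \<Rightarrow> nat \<Rightarrow> (int \<times> 'v) list \<Rightarrow> (int \<times> 'v) list" where
  "upd_entry f j xs = xs[j := (fst (xs ! j), f (fst (xs ! j)) (snd (xs ! j)))]"

lemma length_upd_entry [simp]: "length (upd_entry f j xs) = length xs"
  by (simp add: upd_entry_def)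

lemma upd_entry_simps [simp]:
  "upd_entry f 0 ((d, x) # xs) = (d, f d x) # xs"
  "upd_entry f (Suc j) ((d, x) # xs) = (d, x) # upd_entry f j xs"
  by (simp_all add: upd_entry_def)

lemma total_deg_upd_entry [simp]: "j < length xs \<Longrightarrow> total_deg (upd_entry f j xs) = total_deg xs"
proof (induction xs arbitrary: j)
  case (Cons x xs)
  then show ?case by (cases x; cases j) auto
qed simp

lemma upd_entry_append: "upd_entry f (length xs + j) (xs @ ys) = xs @ upd_entry f j ys"
  by (simp add: upd_entry_def list_update_append nth_append)

lemma upd_entry_replicate:
  "j < n \<Longrightarrow> upd_entry f j (replicate n (d, x) @ ys) =
    replicate j (d, x) @ (d, f d x) # replicate (n - 1 - j) (d, x) @ ys"
proof (induction n arbitrary: j)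
  case (Suc n)
  then show ?case by (cases j) auto
qed simp

lemma sum_fun_apply: "sum f I x = (\<Sum>i\<in>I. f i x)"
  by (induction I rule: infinite_finite_induct) auto

text \<open>Strict morphisms, without higher components. Evaluation at a scalar is the source of all
  instances, together with its coefficientwise extension to a further variable.\<close>

locale Linf_map = L: Linf_char0 L + M: Linf_char0 M + filt_map L M f
  for L :: "('k::field_char_0, 'v::ab_group_add) Linf" and M :: "('k, 'w::ab_group_add) Linf" and f +
  assumes op0: "homog L xs \<Longrightarrow> f (total_deg xs + 1) (op0 L xs) = op0 M (map_entries f xs)"
begin

lemma tw:
  assumes a: "a \<in> Gr L 0" and xs: "homog L xs"
  shows "f (total_deg xs + 1) (tw L a xs) = tw M (f 0 a) (map_entries f xs)"
proof -
  have h: "homog L (replicate k (0, a) @ xs)" for k using a xs by simp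
  have "f (total_deg xs + 1) (Scal L (1 / fact k) (op0 L (replicate k (0, a) @ xs))) =
      Scal M (1 / fact k) (op0 M (replicate k (0, f 0 a) @ map_entries f xs))" for k
    using op0[OF h, of k] L.op0_Gr[OF h, of k] by (simp add: scale)
  then show ?thesis unfolding tw_def by (subst fsum[OF L.tw_ctens_1[OF a xs]]) simp
qed

end

text \<open>Derivations of degree 0, hence a Leibniz rule without signs. On a single entry the rule
  says that \<open>f\<close> commutes with the differential. The instance in view is differentiation
  of polynomials.\<close>

locale Linf_deriv = Linf_char0 L + D: filt_map L L f
  for L :: "('k::field_char_0, 'v::ab_group_add) Linf" and f +
  assumes Leibniz: "homog L xs \<Longrightarrow>
    f (total_deg xs + 1) (op0 L xs) = (\<Sum>j<length xs. op0 L (upd_entry f j xs))"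
begin

lemma homog_upd: "homog L xs \<Longrightarrow> j < length xs \<Longrightarrow> homog L (upd_entry f j xs)"
proof (induction xs arbitrary: j)
  case (Cons x xs)
  then show ?case using D.in_Gr by (cases x; cases j) auto
qed simp

text \<open>Applying \<open>f\<close> to any one of the \<open>k\<close> copies of \<open>a\<close>
  gives the same term, because the changed entry still has degree 0 and can be moved behind the
  other copies.\<close>

lemma op0_replicate_deriv:
  assumes a: "a \<in> Gr L 0" and xs: "homog L xs"
  shows "f (total_deg xs + 1) (op0 L (replicate k (0, a) @ xs)) =
    Scal L (of_nat k) (op0 L (replicate (k - 1) (0, a) @ (0, f 0 a) # xs)) +
    (\<Sum>j<length xs. op0 L (replicate k (0, a) @ upd_entry f j xs))"
proof -
  let ?g = "\<lambda>j. op0 L (upd_entry f j (replicate k (0, a) @ xs))"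
  have "(\<Sum>j<k + n. g j) = (\<Sum>j<k. g j) + (\<Sum>j<n. g (k + j))" for n and g :: "nat \<Rightarrow> 'v"
    by (induction n) (auto simp: add.assoc)
  then have "f (total_deg xs + 1) (op0 L (replicate k (0, a) @ xs)) =
      (\<Sum>j<k. ?g j) + (\<Sum>j<length xs. ?g (k + j))"
    using Leibniz[of "replicate k (0, a) @ xs"] a xs by simp
  moreover have "?g j = op0 L (replicate (k - 1) (0, a) @ (0, f 0 a) # xs)" if "j < k" for j
  proof -
    have "?g j = op0 L (replicate j (0, a) @ (0, f 0 a) # replicate (k - 1 - j) (0, a) @ xs)"
      using that by (simp add: upd_entry_replicate)
    also have "\<dots> = op0 L (replicate j (0, a) @ replicate (k - 1 - j) (0, a) @ (0, f 0 a) # xs)"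
      by (rule op0_move[symmetric]) (use a xs D.in_Gr in auto)
    also have "replicate j (0, a) @ replicate (k - 1 - j) (0, a) @ (0, f 0 a) # xs =
        replicate (k - 1) (0, a) @ (0, f 0 a) # xs"
      using that by (simp flip: append_assoc replicate_add)
    finally show ?thesis .
  qed
  moreover have "?g (k + j) = op0 L (replicate k (0, a) @ upd_entry f j xs)" for j
    using upd_entry_append[of f "replicate k (0, a)" j xs] by simp
  ultimately show ?thesis by (simp add: sum_constant_scale)
qed

text \<open>The chain rule for the exponential series: the \<open>k\<close> equal terms turn
  \<open>1/k!\<close> into \<open>1/(k-1)!\<close>, and after an index shift the twisted series with
  \<open>f 0 a\<close> as an additional entry appears.\<close>

lemma tw_deriv:
  assumes a: "a \<in> Gr L 0" and xs: "homog L xs"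
  shows "f (total_deg xs + 1) (tw L a xs) =
    tw L a ((0, f 0 a) # xs) + (\<Sum>j<length xs. tw L a (upd_entry f j xs))"
proof -
  let ?d = "total_deg xs + 1"
  define h where "h k = Scal L (of_nat k / fact k) (op0 L (replicate (k - 1) (0, a) @ (0, f 0 a) # xs))" for k
  define g where "g j k = Scal L (1 / fact k) (op0 L (replicate k (0, a) @ upd_entry f j xs))" for j k
  have fx: "homog L ((0, f 0 a) # xs)" using a xs D.in_Gr by simp
  have h0: "h 0 = 0" by (simp add: h_def)
  have hS: "(\<lambda>k. h (Suc k)) = (\<lambda>k. Scal L (1 / fact k) (op0 L (replicate k (0, a) @ (0, f 0 a) # xs)))"
    by (auto simp: h_def fun_eq_iff divide_simps simp del: of_nat_Suc)
  have hS_in: "(\<lambda>k. h (Suc k)) \<in> ctens L 1 ?d"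
    using tw_ctens_1[OF a fx] by (simp add: hS)
  have h: "h \<in> ctens L 1 ?d"
  proof (rule ctensI)
    show "h k \<in> Filt L 1 ?d" for k
      using ctens_Filt[OF hS_in, of "k - 1"] h0 Gr_0 by (cases k) auto
    show "\<exists>N. \<forall>i\<ge>N. h i \<in> Filt L k ?d" if k: "k \<ge> 1" for k
    proof -
      obtain N where "\<And>i. i \<ge> N \<Longrightarrow> h (Suc i) \<in> Filt L k ?d" using ctens_tail[OF hS_in k] by blast
      then have "h i \<in> Filt L k ?d" if "i \<ge> Suc N" for i using that by (cases i) auto
      then show ?thesis by blast
    qed
  qed
  have g: "g j \<in> ctens L 1 ?d" if "j \<in> {..<length xs}" for j
    using tw_ctens_1[OF a homog_upd[OF xs, of j]] that by (simp add: g_def[abs_def])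
  have "f ?d (tw L a xs) = fsum L ?d (\<lambda>k. f ?d (Scal L (1 / fact k) (op0 L (replicate k (0, a) @ xs))))"
    unfolding tw_def by (rule D.fsum[OF tw_ctens_1[OF a xs]])
  also have "(\<lambda>k. f ?d (Scal L (1 / fact k) (op0 L (replicate k (0, a) @ xs)))) = (\<lambda>k. h k + (\<Sum>j<length xs. g j k))"
  proof
    fix k
    have "op0 L (replicate k (0, a) @ xs) \<in> Gr L ?d"
      using op0_Gr[of "replicate k (0, a) @ xs"] a xs by simp
    then show "f ?d (Scal L (1 / fact k) (op0 L (replicate k (0, a) @ xs))) = h k + (\<Sum>j<length xs. g j k)"
      by (simp add: D.scale op0_replicate_deriv[OF a xs] h_def g_def scale_right_distrib scale_sum_right)
  qed
  also have "fsum L ?d \<dots> = fsum L ?d h + (\<Sum>j<length xs. fsum L ?d (g j))"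
    using fsum_add[OF h fsum_sum(2)[OF g, of "{..<length xs}" "\<lambda>j. j"]]
      fsum_sum(1)[OF g, of "{..<length xs}" "\<lambda>j. j"] by simp
  also have "fsum L ?d h = tw L a ((0, f 0 a) # xs)"
    using fsum_Suc[OF h] h0 by (simp add: hS tw_def)
  also have "(\<Sum>j<length xs. fsum L ?d (g j)) = (\<Sum>j<length xs. tw L a (upd_entry f j xs))"
    by (intro sum.cong) (auto simp: tw_def g_def[abs_def])
  finally show ?thesis .
qed

end

lemma pick_map_lift: "length is = length xs \<Longrightarrow> pick (map_entries (lift f) xs) is = map_entries f (pick xs is)"
  by (induction "is" xs rule: list_induct2) (auto simp: map_entries_def)

lemma pick_upd_lift:
  "length is = length xs \<Longrightarrow> j < length xs \<Longrightarrow> pick (upd_entry (lift f) j xs) is = upd_entry f j (pick xs is)"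
proof (induction "is" xs arbitrary: j rule: list_induct2)
  case (Cons i "is" x xs)
  then show ?case by (cases x; cases j) auto
qed simp

context filt_map
begin

lemma lift_ctens: "m \<ge> 1 \<Longrightarrow> x \<in> ctens L m d \<Longrightarrow> lift f d x \<in> ctens M m d"
  unfolding lift_def by (rule in_ctens)

lemma lift_filt_hom: "filt_hom (polyL L) (polyL M) (lift f)"
  by (rule filt_homI) (use lift_ctens L.ctens_Gr in \<open>auto simp: fun_eq_iff add scale\<close>)

end

lemma filt_map_poly:
  assumes "Linf_char0 L" "Linf_char0 M" "filt_hom (polyL L) (polyL M) f"
  shows "filt_map (polyL L) (polyL M) f"
proof -
  interpret L: Linf_char0 L by fact
  interpret M: Linf_char0 M by fact
  interpret PL: Linf_char0 "polyL L" by (rule L.poly_Linf)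
  interpret PM: Linf_char0 "polyL M" by (rule M.poly_Linf)
  show ?thesis by unfold_locales fact
qed

lemma Linf_map_lift:
  assumes "Linf_map L M f"
  shows "Linf_map (polyL L) (polyL M) (lift f)"
proof -
  interpret Linf_map L M f by fact
  interpret PL: Linf_char0 "polyL L" by (rule L.poly_Linf)
  interpret PM: Linf_char0 "polyL M" by (rule M.poly_Linf)
  interpret P: filt_map "polyL L" "polyL M" "lift f"
    by (intro filt_map_poly L.Linf_char0_axioms M.Linf_char0_axioms lift_filt_hom)
  show ?thesis
  proof (unfold_locales, rule ext)
    fix xs and n :: nat assume xs: "homog (polyL L) xs"
    have "f (total_deg xs + 1) (op0 L (pick xs is)) = op0 M (pick (map_entries (lift f) xs) is)"
      "op0 L (pick xs is) \<in> Gr L (total_deg xs + 1)"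
      if "is \<in> {is. length is = length xs \<and> sum_list is = n}" for "is"
      using op0[OF L.homog_pick_poly[OF xs, of "is"]] L.op0_Gr[OF L.homog_pick_poly[OF xs, of "is"]] that
      by (auto simp: total_deg_pick pick_map_lift)
    then show "lift f (total_deg xs + 1) (op0 (polyL L) xs) n = op0 (polyL M) (map_entries (lift f) xs) n"
      by (subst lift_apply, subst op0_poly, subst sum) (auto simp: op0_poly)
  qed
qed

lemma Linf_deriv_lift:
  assumes "Linf_deriv L f"
  shows "Linf_deriv (polyL L) (lift f)"
proof -
  interpret Linf_deriv L f by fact
  interpret PL: Linf_char0 "polyL L" by (rule poly_Linf)
  interpret P: filt_map "polyL L" "polyL L" "lift f"
    by (intro filt_map_poly Linf_char0_axioms D.lift_filt_hom)
  show ?thesis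
  proof (unfold_locales, rule ext)
    fix xs and n :: nat assume xs: "homog (polyL L) xs"
    let ?S = "{is. length is = length xs \<and> sum_list is = n}"
    have 1: "f (total_deg xs + 1) (op0 L (pick xs is)) = (\<Sum>j<length xs. op0 L (pick (upd_entry (lift f) j xs) is))"
      "op0 L (pick xs is) \<in> Gr L (total_deg xs + 1)" if "is \<in> ?S" for "is"
      using Leibniz[OF homog_pick_poly[OF xs, of "is"]] op0_Gr[OF homog_pick_poly[OF xs, of "is"]] that
      by (auto simp: total_deg_pick pick_upd_lift)
    have "lift f (total_deg xs + 1) (op0 (polyL L) xs) n =
        (\<Sum>is\<in>?S. \<Sum>j<length xs. op0 L (pick (upd_entry (lift f) j xs) is))"
      by (subst lift_apply, subst op0_poly, subst D.sum) (auto simp: 1)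
    also have "\<dots> = (\<Sum>j<length xs. op0 (polyL L) (upd_entry (lift f) j xs) n)"
      by (subst sum.swap) (simp add: op0_poly)
    finally show "lift f (total_deg xs + 1) (op0 (polyL L) xs) n =
        (\<Sum>j<length xs. op0 (polyL L) (upd_entry (lift f) j xs)) n"
      by (simp add: sum_fun_apply)
  qed
qed

section \<open>Differentiation and integration in the polynomial variable\<close>

definition pderiv_t :: "('k::field, 'v::ab_group_add) Linf \<Rightarrow> int \<Rightarrow> (nat \<Rightarrow> 'v) \<Rightarrow> nat \<Rightarrow> 'v" where
  "pderiv_t L d x = (\<lambda>i. Scal L (of_nat (Suc i)) (x (Suc i)))"

text \<open>The primitive with value 0 at the origin, so initial values are added separately through
  \<open>const_t\<close>.\<close>

definition pint :: "('k::field, 'v::ab_group_add) Linf \<Rightarrow> (nat \<Rightarrow> 'v) \<Rightarrow> nat \<Rightarrow> 'v" where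
  "pint L x = (\<lambda>i. case i of 0 \<Rightarrow> 0 | Suc j \<Rightarrow> Scal L (1 / of_nat (Suc j)) (x j))"

definition const_t :: "'v::zero \<Rightarrow> nat \<Rightarrow> 'v" where
  "const_t v = (\<lambda>i. if i = 0 then v else 0)"

context Linf_char0
begin

lemma ev_Linf_map: "Linf_map (polyL L) L (\<lambda>d. ev L d c)"
proof -
  interpret PL: Linf_char0 "polyL L" by (rule poly_Linf)
  interpret filt_map "polyL L" L "\<lambda>d. ev L d c" by (rule ev_filt_map)
  show ?thesis by unfold_locales (simp add: ev_op0 map_entries_def)
qed

lemma upd_pderiv_t:
  assumes xs: "homog (polyL L) xs" and l: "length is = length xs" "j < length xs"
  shows "op0 L (pick (upd_entry (pderiv_t L) j xs) is) =
    Scal L (of_nat (Suc (is ! j))) (op0 L (pick xs (is[j := Suc (is ! j)])))"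
proof -
  obtain d x where dx: "xs ! j = (d, x)" by force
  have x: "x i \<in> Gr L d" for i using homog_nth[OF xs l(2)] ctens_Gr dx by simp
  define us where "us = take j xs"
  define vs where "vs = drop (Suc j) xs"
  have xs_eq: "xs = us @ (d, x) # vs" using id_take_nth_drop[OF l(2)] dx by (simp add: us_def vs_def)
  have lu: "length us = j" using l by (simp add: us_def)
  define is1 where "is1 = take j is"
  define is2 where "is2 = drop (Suc j) is"
  have is_eq: "is = is1 @ is ! j # is2" using id_take_nth_drop[of j "is"] l by (simp add: is1_def is2_def)
  have li: "length is1 = j" using l by (simp add: is1_def)
  have upd: "upd_entry (pderiv_t L) j xs = us @ (d, pderiv_t L d x) # vs"
    using upd_entry_append[of "pderiv_t L" us 0 "(d, x) # vs"] lu xs_eq by simp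
  have "pick (upd_entry (pderiv_t L) j xs) is =
      pick us is1 @ (d, Scal L (of_nat (Suc (is ! j))) (x (Suc (is ! j)))) # pick vs is2"
    unfolding upd by (subst is_eq) (simp add: pick_append lu li pderiv_t_def)
  moreover have "is[j := Suc (is ! j)] = is1 @ Suc (is ! j) # is2"
    using upd_conv_take_nth_drop[of j "is" "Suc (is ! j)"] l by (simp add: is1_def is2_def)
  then have "pick xs (is[j := Suc (is ! j)]) = pick us is1 @ (d, x (Suc (is ! j))) # pick vs is2"
    using xs_eq by (simp add: pick_append lu li)
  moreover have "homog L (pick us is1 @ pick vs is2)"
  proof -
    have "length is2 = length vs" using l by (simp add: is2_def vs_def)
    then show ?thesis using homog_pick_poly[of us is1] homog_pick_poly[of vs is2] xs xs_eq lu li by simp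
  qed
  ultimately show ?thesis using op0_scale x by simp
qed

lemma pderiv_t_ctens: "m \<ge> 1 \<Longrightarrow> x \<in> ctens L m d \<Longrightarrow> pderiv_t L d x \<in> ctens L m d"
  unfolding pderiv_t_def by (intro ctens_scale_coeff ctens_shift)

text \<open>The factor \<open>Suc n\<close> in front of a coefficient is the sum of the exponents in
  each contributing list, and is distributed over the entries accordingly. Lists of total
  \<open>Suc n\<close> with a positive exponent at \<open>j\<close> correspond to lists of total
  \<open>n\<close> by lowering that exponent.\<close>

lemma pderiv_t_deriv: "Linf_deriv (polyL L) (pderiv_t L)"
proof -
  interpret PL: Linf_char0 "polyL L" by (rule poly_Linf)
  have "filt_hom (polyL L) (polyL L) (pderiv_t L)"
    by (rule filt_homI) (use pderiv_t_ctens in \<open>auto simp: pderiv_t_def fun_eq_iff scale_right_distrib mult.commute\<close>)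
  then interpret PD: filt_map "polyL L" "polyL L" "pderiv_t L"
    by (intro filt_map_poly Linf_char0_axioms)
  show ?thesis
  proof (unfold_locales, rule ext)
    fix xs and n :: nat assume xs: "homog (polyL L) xs"
    let ?S = "\<lambda>n. {is. length is = length xs \<and> sum_list is = n}"
    let ?O = "\<lambda>is. op0 L (pick xs is)"
    have "pderiv_t L (total_deg xs + 1) (op0 (polyL L) xs) n = (\<Sum>is\<in>?S (Suc n). Scal L (of_nat (Suc n)) (?O is))"
      by (simp only: pderiv_t_def op0_poly scale_sum_right)
    also have "\<dots> = (\<Sum>is\<in>?S (Suc n). \<Sum>j<length xs. Scal L (of_nat (is ! j)) (?O is))"
    proof (rule sum.cong[OF refl])
      fix "is" assume "is \<in> ?S (Suc n)"
      then have "Suc n = (\<Sum>j<length xs. is ! j)"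
        by (auto simp: sum_list_sum_nth atLeast0LessThan)
      then have "(of_nat (Suc n) :: 'k) = (\<Sum>j<length xs. of_nat (is ! j))" by (simp only: of_nat_sum)
      then show "Scal L (of_nat (Suc n)) (?O is) = (\<Sum>j<length xs. Scal L (of_nat (is ! j)) (?O is))"
        by (simp only: scale_sum_left)
    qed
    also have "\<dots> = (\<Sum>j<length xs. \<Sum>is\<in>?S (Suc n). Scal L (of_nat (is ! j)) (?O is))"
      by (rule sum.swap)
    also have "\<dots> = (\<Sum>j<length xs. op0 (polyL L) (upd_entry (pderiv_t L) j xs) n)"
    proof (rule sum.cong[OF refl])
      fix j assume j: "j \<in> {..<length xs}"
      have "(\<Sum>is\<in>?S (Suc n). Scal L (of_nat (is ! j)) (?O is)) =
          (\<Sum>is\<in>{is \<in> ?S (Suc n). is ! j \<noteq> 0}. Scal L (of_nat (is ! j)) (?O is))"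
        by (rule sum.mono_neutral_right) (auto simp: finite_compositions)
      also have "\<dots> = (\<Sum>is\<in>?S n. Scal L (of_nat (Suc (is ! j))) (?O (is[j := Suc (is ! j)])))"
        by (rule sum.reindex_bij_witness[of _ "\<lambda>is. is[j := Suc (is ! j)]" "\<lambda>is. is[j := is ! j - 1]"])
          (use j in \<open>auto simp: sum_list_update elem_le_sum_list simp del: of_nat_Suc\<close>)
      also have "\<dots> = (\<Sum>is\<in>?S n. op0 L (pick (upd_entry (pderiv_t L) j xs) is))"
        by (rule sum.cong[OF refl]) (use upd_pderiv_t[OF xs] j in auto)
      finally show "(\<Sum>is\<in>?S (Suc n). Scal L (of_nat (is ! j)) (?O is)) =
          op0 (polyL L) (upd_entry (pderiv_t L) j xs) n"
        by (simp add: op0_poly)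
    qed
    finally show "pderiv_t L (total_deg xs + 1) (op0 (polyL L) xs) n =
        (\<Sum>j<length xs. op0 (polyL L) (upd_entry (pderiv_t L) j xs)) n"
      by (simp add: sum_fun_apply)
  qed
qed

lemma const_t_ctens: "m \<ge> 1 \<Longrightarrow> v \<in> Filt L m d \<Longrightarrow> const_t v \<in> ctens L m d"
  unfolding const_t_def using Filt_0 by (intro ctensI) (auto intro!: exI[of _ 1])

lemma pint_ctens:
  assumes "m \<ge> 1" "x \<in> ctens L m d"
  shows "pint L x \<in> ctens L m d"
proof (rule ctensI)
  show "pint L x i \<in> Filt L m d" for i
    using assms Filt_0 Filt_scale ctens_Filt by (auto simp: pint_def split: nat.split)
  fix k :: nat assume k: "k \<ge> 1"
  obtain N where N: "\<And>i. i \<ge> N \<Longrightarrow> x i \<in> Filt L k d" using ctens_tail[OF assms(2) k] by blast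
  have "pint L x i \<in> Filt L k d" if "i \<ge> Suc N" for i
    using that N Filt_scale[OF k] by (cases i) (auto simp: pint_def)
  then show "\<exists>N. \<forall>i\<ge>N. pint L x i \<in> Filt L k d" by blast
qed

lemma pint_diff: "pint L x - pint L y = pint L (x - y)"
  by (auto simp: pint_def fun_eq_iff scale_right_diff_distrib split: nat.split)

lemma pint_pderiv_t: "const_t (x 0) + pint L (pderiv_t L d x) = x"
  by (auto simp: pint_def pderiv_t_def const_t_def fun_eq_iff simp del: of_nat_Suc split: nat.split)

lemma pderiv_t_pint: "pderiv_t L d (const_t v + pint L x) = x"
  by (auto simp: pint_def pderiv_t_def const_t_def fun_eq_iff simp del: of_nat_Suc)

lemma const_pint_0: "(const_t v + pint L x) 0 = v"
  by (simp add: const_t_def pint_def)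

lemma ev_0:
  assumes "x \<in> ctens L 1 d"
  shows "ev L d 0 x = x 0"
proof -
  have "ev L d 0 x = (\<Sum>i<1. Scal L (0 ^ i) (x i))"
    unfolding ev_def by (rule fsum_finite) (use ctens_Gr[OF assms] Gr_scale in auto)
  then show ?thesis by simp
qed

lemma ev_const: "v \<in> Gr L d \<Longrightarrow> ev L d c (const_t v) = v"
  unfolding ev_def const_t_def using Gr_0 by (subst fsum_finite[where n = 1]) auto

text \<open>Evaluation at 0 is a morphism that reads off the constant coefficient; this supplies the
  initial values of curvature and defect along a flow.\<close>

lemma tw_at_0:
  assumes "a \<in> ctens L 1 0" "homog (polyL L) xs"
  shows "tw (polyL L) a xs 0 = tw L (a 0) (map_entries (\<lambda>d x. x 0) xs)"
proof -
  interpret E: Linf_map "polyL L" L "\<lambda>d. ev L d 0" by (rule ev_Linf_map)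
  have "map_entries (\<lambda>d. ev L d 0) xs = map_entries (\<lambda>d x. x 0) xs"
    using ev_0 assms(2) by (auto simp: map_entries_def homog_def)
  then show ?thesis
    using E.tw[of a xs] assms ev_0[OF assms(1)] ev_0[of "tw (polyL L) a xs" "total_deg xs + 1"] E.L.tw_Gr[of a xs]
    by simp
qed

text \<open>Picard iteration for the flow in integral form. The unknown \<open>x\<close> is the base
  point of a twisted operation with the entry \<open>\<eta>\<close>, so changing \<open>x\<close> in
  step \<open>k\<close> changes the right side in step \<open>Suc k\<close>.\<close>

lemma flow_unique_ex:
  assumes v: "v \<in> Gr L 0" and \<eta>: "\<eta> \<in> ctens L 1 (- 1)"
  shows "\<exists>!x. x \<in> ctens L 1 0 \<and> const_t v + pint L (tw (polyL L) x [(- 1, \<eta>)]) = x"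
proof -
  interpret PL: Linf_char0 "polyL L" by (rule poly_Linf)
  have h: "homog (polyL L) [(- 1, \<eta>)]" using \<eta> by simp
  have "\<exists>!x. x \<in> Gr (polyL L) 0 \<and> const_t v + pint L (tw (polyL L) x [(- 1, \<eta>)]) = x"
  proof (rule PL.contraction_fixed_point)
    fix x assume "x \<in> Gr (polyL L) 0"
    then have "pint L (tw (polyL L) x [(- 1, \<eta>)]) \<in> ctens L 1 0"
      using PL.tw_Gr[OF _ h, of x] by (intro pint_ctens) auto
    then show "const_t v + pint L (tw (polyL L) x [(- 1, \<eta>)]) \<in> Gr (polyL L) 0"
      using PL.Gr_add const_t_ctens[of 1 v 0] v by simp
  next
    fix k :: nat and x y assume "k \<ge> 1" "x \<in> Gr (polyL L) 0" "y \<in> Gr (polyL L) 0" "x - y \<in> Filt (polyL L) k 0"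
    then have "tw (polyL L) x [(- 1, \<eta>)] - tw (polyL L) y [(- 1, \<eta>)] \<in> ctens L (Suc k) 0"
      using PL.tw_base_cong[of x y k "[(- 1, \<eta>)]"] h by simp
    from pint_ctens[OF _ this] show "const_t v + pint L (tw (polyL L) x [(- 1, \<eta>)]) -
        (const_t v + pint L (tw (polyL L) y [(- 1, \<eta>)])) \<in> Filt (polyL L) (Suc k) 0"
      by (simp add: pint_diff[symmetric])
  qed
  then show ?thesis by simp
qed

text \<open>The unknown shares its operation with \<open>\<eta>\<close>, which gives the
  contraction. The scalar \<open>c\<close> accommodates both signs that occur, and \<open>u\<close>
  collects the initial value and any source term.\<close>

lemma linear_flow_unique_ex:
  assumes a: "a \<in> ctens L 1 0" and u: "u \<in> ctens L 1 d" and \<eta>: "\<eta> \<in> ctens L 1 (- 1)"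
  shows "\<exists>!x. x \<in> ctens L 1 d \<and> u + pint L (\<lambda>i. Scal L c (tw (polyL L) a [(d, x), (- 1, \<eta>)] i)) = x"
proof -
  interpret PL: Linf_char0 "polyL L" by (rule poly_Linf)
  let ?T = "\<lambda>x. tw (polyL L) a [(d, x), (- 1, \<eta>)]"
  have "\<exists>!x. x \<in> Gr (polyL L) d \<and> u + pint L (\<lambda>i. Scal L c (?T x i)) = x"
  proof (rule PL.contraction_fixed_point)
    fix x assume "x \<in> Gr (polyL L) d"
    then have "?T x \<in> ctens L 1 d" using PL.tw_Gr[of a "[(d, x), (- 1, \<eta>)]"] a \<eta> by simp
    then have "pint L (\<lambda>i. Scal L c (?T x i)) \<in> ctens L 1 d"
      by (intro pint_ctens ctens_scale_coeff) auto
    then show "u + pint L (\<lambda>i. Scal L c (?T x i)) \<in> Gr (polyL L) d" using PL.Gr_add u by simp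
  next
    fix k :: nat and x y assume k: "k \<ge> 1" and xy: "x \<in> Gr (polyL L) d" "y \<in> Gr (polyL L) d"
      "x - y \<in> Filt (polyL L) k d"
    have "?T x - ?T y = ?T (x - y)"
      using PL.tw_diff[of a "[]" "[(- 1, \<eta>)]" x d y] a \<eta> xy by simp
    also have "\<dots> \<in> ctens L (Suc k) d"
      using PL.tw_Filt_entry[of a "[]" "[(- 1, \<eta>)]" k "x - y" d] a \<eta> xy k by simp
    finally have "?T x - ?T y \<in> ctens L (Suc k) d" .
    then have "pint L (\<lambda>i. Scal L c ((?T x - ?T y) i)) \<in> ctens L (Suc k) d"
      using pint_ctens[OF _ ctens_scale_coeff[of "Suc k" "?T x - ?T y" d "\<lambda>_. c"]] by simp
    moreover have "(\<lambda>i. Scal L c ((?T x - ?T y) i)) = (\<lambda>i. Scal L c (?T x i)) - (\<lambda>i. Scal L c (?T y i))"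
      by (simp add: fun_eq_iff scale_right_diff_distrib)
    ultimately show "u + pint L (\<lambda>i. Scal L c (?T x i)) - (u + pint L (\<lambda>i. Scal L c (?T y i))) \<in> Filt (polyL L) (Suc k) d"
      by (simp add: pint_diff[symmetric])
  qed
  then show ?thesis by simp
qed

text \<open>The propagation principle: a quantity governed by a homogeneous linear flow and zero at
  the start stays zero, because 0 is a solution too and solutions are unique.\<close>

lemma linear_flow_zero:
  assumes a: "a \<in> ctens L 1 0" and x: "x \<in> ctens L 1 d" and \<eta>: "\<eta> \<in> ctens L 1 (- 1)"
    and "x 0 = 0" and "pderiv_t L d x = (\<lambda>i. Scal L c (tw (polyL L) a [(d, x), (- 1, \<eta>)] i))"
  shows "x = 0"
proof -
  interpret PL: Linf_char0 "polyL L" by (rule poly_Linf)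
  let ?\<Phi> = "\<lambda>x. 0 + pint L (\<lambda>i. Scal L c (tw (polyL L) a [(d, x), (- 1, \<eta>)] i))"
  have "tw (polyL L) a [(d, 0), (- 1, \<eta>)] = 0"
    using PL.tw_zero[of a "[]" "[(- 1, \<eta>)]" d] a \<eta> by simp
  then have "?\<Phi> 0 = 0" by (auto simp: pint_def fun_eq_iff split: nat.split)
  moreover have "const_t 0 = (0 :: nat \<Rightarrow> 'v)" by (auto simp: const_t_def)
  then have "?\<Phi> x = x" using pint_pderiv_t[of x d] assms(4,5) by simp
  ultimately show ?thesis
    using linear_flow_unique_ex[OF a _ \<eta>, of 0 d c] x PL.Gr_0[of d] by auto
qed

end

lemma (in Linf_char0) pint_add: "pint L x + pint L y = pint L (x + y)"
  by (auto simp: pint_def fun_eq_iff scale_right_distrib split: nat.split)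

lemma (in filt_map) lift_const_pint:
  assumes v: "v \<in> Gr L d" and y: "y \<in> ctens L 1 d"
  shows "lift f d (const_t v + pint L y) = const_t (f d v) + pint M (lift f d y)"
  using v L.ctens_Gr[OF y] by (auto simp: fun_eq_iff const_t_def pint_def zero scale split: nat.split)

text \<open>
  With \<open>T\<close> the twisted operations over \<open>\<alpha>\<close> and \<open>'\<close> the derivative in the flow parameter, the flow is
  \<open>\<alpha>' = T(\<eta>)\<close>, \<open>\<beta>' = f \<eta> - T(\<beta>, \<eta>)\<close>.  The curvature \<open>C\<close> and the defect
  \<open>D = f \<alpha> - T(\<beta>)\<close> then satisfy the linear equations \<open>C' = - T(C, \<eta>)\<close> and
  \<open>D' = T(D, \<eta>) - T(C, \<beta>, \<eta>)\<close>.
\<close>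

lemma (in Linf_deriv) gauge_flow:
  assumes a: "a \<in> Gr L 0" and b: "b \<in> Gr L (- 1)" and flat: "tw L a [] = 0"
    and cell: "f 0 a = tw L a [(- 1, b)]" and \<eta>m: "\<eta> \<in> ctens L m (- 1)" and m: "m \<ge> 1"
  obtains \<alpha> \<beta> where "\<alpha> \<in> ctens L 1 0" "\<beta> \<in> ctens L 1 (- 1)"
    "\<alpha> = const_t a + pint L (tw (polyL L) \<alpha> [(- 1, \<eta>)])"
    "tw (polyL L) \<alpha> [] = 0" "lift f 0 \<alpha> = tw (polyL L) \<alpha> [(- 1, \<beta>)]"
    "\<alpha> - const_t a \<in> ctens L m 0" "\<beta> - const_t b \<in> ctens L m (- 1)"
proof -
  interpret PL: Linf_char0 "polyL L" by (rule poly_Linf)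
  interpret T: Linf_deriv "polyL L" "pderiv_t L" by (rule pderiv_t_deriv)
  interpret F: Linf_deriv "polyL L" "lift f" by (rule Linf_deriv_lift) unfold_locales
  have \<eta>: "\<eta> \<in> ctens L 1 (- 1)" using ctens_mono[OF \<eta>m] m by simp
  have f\<eta>m: "lift f (- 1) \<eta> \<in> ctens L m (- 1)" using D.lift_ctens[OF m \<eta>m] .
  have f\<eta>: "lift f (- 1) \<eta> \<in> ctens L 1 (- 1)" using ctens_mono[OF f\<eta>m] m by simp
  obtain \<alpha> where \<alpha>: "\<alpha> \<in> ctens L 1 0" and \<alpha>_eq: "const_t a + pint L (tw (polyL L) \<alpha> [(- 1, \<eta>)]) = \<alpha>"
    using flow_unique_ex[OF a \<eta>] by blast
  let ?T = "tw (polyL L) \<alpha>"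
  have \<alpha>0: "\<alpha> 0 = a" using const_pint_0[of a "?T [(- 1, \<eta>)]"] \<alpha>_eq by simp
  have \<alpha>': "pderiv_t L 0 \<alpha> = ?T [(- 1, \<eta>)]" using pderiv_t_pint[of 0 a "?T [(- 1, \<eta>)]"] \<alpha>_eq by simp
  have T\<eta>m: "?T [(- 1, \<eta>)] \<in> ctens L m 0"
    using PL.tw_Filt_entry[of \<alpha> "[]" "[]" m \<eta> "- 1"] \<alpha> \<eta>m m by simp
  have T\<eta>: "?T [(- 1, \<eta>)] \<in> ctens L 1 0" using ctens_mono[OF T\<eta>m] m by simp
  have TGr: "?T xs \<in> ctens L 1 (total_deg xs + 1)" if "homog (polyL L) xs" for xs
    using PL.tw_Gr[of \<alpha> xs] \<alpha> that by simp
  \<comment> \<open>The scalar -1 is the sign in \<open>tw_square\<close>, which turns the twisted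
    differential of T(\<eta>) into a bracket with the curvature.\<close>
  have C: "?T [] = 0"
  proof (rule linear_flow_zero[OF \<alpha> _ \<eta>, of _ 1 "- 1"])
    show "?T [] \<in> ctens L 1 1" using TGr[of "[]"] by simp
    show "?T [] 0 = 0" using tw_at_0[OF \<alpha>, of "[]"] flat by (simp add: \<alpha>0)
    have "pderiv_t L 1 (?T []) = ?T [(0, ?T [(- 1, \<eta>)])]"
      using T.tw_deriv[of \<alpha> "[]"] \<alpha> by (simp add: \<alpha>')
    also have "\<dots> = - ?T [(1, ?T []), (- 1, \<eta>)]"
      using PL.tw_square[of \<alpha> \<eta> "- 1"] \<alpha> \<eta> by simp
    finally show "pderiv_t L 1 (?T []) = (\<lambda>i. Scal L (- 1) (?T [(1, ?T []), (- 1, \<eta>)] i))"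
      by (simp add: fun_Compl_def)
  qed
  have "const_t b + pint L (lift f (- 1) \<eta>) \<in> ctens L 1 (- 1)"
    using PL.Gr_add const_t_ctens[of 1 b "- 1"] pint_ctens[OF _ f\<eta>] b by simp
  then obtain \<beta> where \<beta>: "\<beta> \<in> ctens L 1 (- 1)" and "const_t b + pint L (lift f (- 1) \<eta>) +
      pint L (\<lambda>i. Scal L (- 1) (?T [(- 1, \<beta>), (- 1, \<eta>)] i)) = \<beta>"
    using linear_flow_unique_ex[OF \<alpha> _ \<eta>] by blast
  moreover define \<beta>' where "\<beta>' = lift f (- 1) \<eta> - ?T [(- 1, \<beta>), (- 1, \<eta>)]"
  moreover have "lift f (- 1) \<eta> + (\<lambda>i. Scal L (- 1) (?T [(- 1, \<beta>), (- 1, \<eta>)] i)) = \<beta>'"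
    by (simp add: \<beta>'_def fun_eq_iff)
  ultimately have \<beta>_eq: "const_t b + pint L \<beta>' = \<beta>"
    by (simp only: add.assoc pint_add)
  have \<beta>0: "\<beta> 0 = b" using const_pint_0[of b \<beta>'] \<beta>_eq by simp
  have \<beta>': "pderiv_t L (- 1) \<beta> = \<beta>'" using pderiv_t_pint[of "- 1" b \<beta>'] \<beta>_eq by simp
  have T\<beta>\<eta>m: "?T [(- 1, \<beta>), (- 1, \<eta>)] \<in> ctens L m (- 1)"
    using PL.tw_Filt_entry[of \<alpha> "[(- 1, \<beta>)]" "[]" m \<eta> "- 1"] \<alpha> \<beta> \<eta>m m ctens_mono[where k = m] by auto
  have T\<beta>\<eta>: "?T [(- 1, \<beta>), (- 1, \<eta>)] \<in> ctens L 1 (- 1)" using ctens_mono[OF T\<beta>\<eta>m] m by simp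
  have T\<beta>: "?T [(- 1, \<beta>)] \<in> ctens L 1 0" using TGr[of "[(- 1, \<beta>)]"] \<beta> by simp
  have f\<alpha>: "lift f 0 \<alpha> \<in> ctens L 1 0" using D.lift_ctens[OF _ \<alpha>] by simp
  have "lift f 0 \<alpha> - ?T [(- 1, \<beta>)] = 0"
  proof (rule linear_flow_zero[OF \<alpha> _ \<eta>, of _ 0 1])
    show "lift f 0 \<alpha> - ?T [(- 1, \<beta>)] \<in> ctens L 1 0" using PL.Gr_diff f\<alpha> T\<beta> by simp
    show "(lift f 0 \<alpha> - ?T [(- 1, \<beta>)]) 0 = 0"
      using tw_at_0[OF \<alpha>, of "[(- 1, \<beta>)]"] \<beta> cell by (simp add: \<alpha>0 \<beta>0)
    \<comment> \<open>\<open>lift f\<close> acts on coefficients and is linear over the scalars,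
      hence commutes with the derivative in the flow parameter.\<close>
    have "pderiv_t L 0 (lift f 0 \<alpha>) = lift f 0 (?T [(- 1, \<eta>)])"
      unfolding \<alpha>'[symmetric] using ctens_Gr[OF \<alpha>] by (auto simp: pderiv_t_def fun_eq_iff D.scale simp del: of_nat_Suc)
    also have "\<dots> = ?T [(0, lift f 0 \<alpha>), (- 1, \<eta>)] + ?T [(- 1, lift f (- 1) \<eta>)]"
      using F.tw_deriv[of \<alpha> "[(- 1, \<eta>)]"] \<alpha> \<eta> by simp
    finally have 1: "pderiv_t L 0 (lift f 0 \<alpha>) = \<dots>" .
    have "pderiv_t L 0 (?T [(- 1, \<beta>)]) = ?T [(0, ?T [(- 1, \<eta>)]), (- 1, \<beta>)] + ?T [(- 1, \<beta>')]"
      using T.tw_deriv[of \<alpha> "[(- 1, \<beta>)]"] \<alpha> \<beta> by (simp add: \<alpha>' \<beta>')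
    also have "?T [(- 1, \<beta>')] = ?T [(- 1, lift f (- 1) \<eta>)] - ?T [(- 1, ?T [(- 1, \<beta>), (- 1, \<eta>)])]"
      using PL.tw_diff[of \<alpha> "[]" "[]" "lift f (- 1) \<eta>" "- 1"] \<alpha> f\<eta> T\<beta>\<eta> by (simp add: \<beta>'_def)
    finally have 2: "pderiv_t L 0 (?T [(- 1, \<beta>)]) = ?T [(0, ?T [(- 1, \<eta>)]), (- 1, \<beta>)] +
        (?T [(- 1, lift f (- 1) \<eta>)] - ?T [(- 1, ?T [(- 1, \<beta>), (- 1, \<eta>)])])" .
    \<comment> \<open>The curvature is already known to vanish along the flow, so the Leibniz
      identity holds without its correction and the equation for the defect becomes
      homogeneous.\<close>
    have 3: "?T [(- 1, ?T [(- 1, \<beta>), (- 1, \<eta>)])] + ?T [(0, ?T [(- 1, \<beta>)]), (- 1, \<eta>)]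
        - ?T [(0, ?T [(- 1, \<eta>)]), (- 1, \<beta>)] = 0"
      using PL.tw_Leibniz[of \<alpha> \<beta> \<eta>] PL.tw_zero[of \<alpha> "[]" "[(- 1, \<beta>), (- 1, \<eta>)]" 1] \<alpha> \<beta> \<eta> C by simp
    have 4: "?T [(0, lift f 0 \<alpha> - ?T [(- 1, \<beta>)]), (- 1, \<eta>)] =
        ?T [(0, lift f 0 \<alpha>), (- 1, \<eta>)] - ?T [(0, ?T [(- 1, \<beta>)]), (- 1, \<eta>)]"
      using PL.tw_diff[of \<alpha> "[]" "[(- 1, \<eta>)]" "lift f 0 \<alpha>" 0] \<alpha> f\<alpha> T\<beta> \<eta> by simp
    have "pderiv_t L 0 (lift f 0 \<alpha> - ?T [(- 1, \<beta>)]) =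
        pderiv_t L 0 (lift f 0 \<alpha>) - pderiv_t L 0 (?T [(- 1, \<beta>)])"
      by (simp add: pderiv_t_def fun_eq_iff scale_right_diff_distrib)
    also have "\<dots> = ?T [(0, lift f 0 \<alpha> - ?T [(- 1, \<beta>)]), (- 1, \<eta>)]"
      unfolding 1 2 4 using 3 by (simp add: algebra_simps)
    finally show "pderiv_t L 0 (lift f 0 \<alpha> - ?T [(- 1, \<beta>)]) =
        (\<lambda>i. Scal L 1 (?T [(0, lift f 0 \<alpha> - ?T [(- 1, \<beta>)]), (- 1, \<eta>)] i))" by simp
  qed
  then have fT: "lift f 0 \<alpha> = ?T [(- 1, \<beta>)]" by simp
  have "\<alpha> - const_t a = pint L (?T [(- 1, \<eta>)])" using \<alpha>_eq by (simp add: diff_eq_eq add.commute)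
  then have \<alpha>m: "\<alpha> - const_t a \<in> ctens L m 0" using pint_ctens[OF m T\<eta>m] by simp
  have "\<beta> - const_t b = pint L \<beta>'" using \<beta>_eq by (simp add: diff_eq_eq add.commute)
  then have \<beta>m: "\<beta> - const_t b \<in> ctens L m (- 1)"
    using pint_ctens[OF m, of \<beta>' "- 1"] ctens_diff[OF m f\<eta>m T\<beta>\<eta>m] by (simp add: \<beta>'_def)
  show thesis by (rule that[OF \<alpha> \<beta> \<alpha>_eq[symmetric] C fT \<alpha>m \<beta>m])
qed

section \<open>Extension of 1-cells\<close>

text \<open>The Maurer-Cartan equation for forms on the interval, in terms of twisted operations
  over polynomials. In this form a cell is exactly the initial datum of a gauge flow over
  \<open>polyL L\<close> whose derivation is differentiation in t.\<close>

definition is_cell :: "('k::field_char_0, 'v::ab_group_add) Linf \<Rightarrow> (nat \<Rightarrow> 'v) \<Rightarrow> (nat \<Rightarrow> 'v) \<Rightarrow> bool" where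
  "is_cell L a b \<longleftrightarrow> a \<in> ctens L 1 0 \<and> b \<in> ctens L 1 (- 1) \<and> tw (polyL L) a [] = 0 \<and>
    pderiv_t L 0 a = tw (polyL L) a [(- 1, b)]"

context Linf_char0
begin

lemma cell_extend:
  assumes ab: "is_cell L a b" and rc: "is_cell L r c" and cm: "c \<in> ctens L m (- 1)" and m: "m \<ge> 1"
    and ends: "ev L 0 1 a = ev L 0 0 r"
  obtains a' b' where "is_cell L a' b'" "ev L 0 0 a' = ev L 0 0 a" "ev L 0 1 a' = ev L 0 1 r"
    "a' - a \<in> ctens L m 0" "b' - b \<in> ctens L m (- 1)"
proof -
  let ?P = "polyL L"
  interpret PL: Linf_char0 ?P by (rule poly_Linf)
  interpret PPL: Linf_char0 "polyL ?P" by (rule PL.poly_Linf)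
  interpret T: Linf_deriv ?P "pderiv_t L" by (rule pderiv_t_deriv)
  have a: "a \<in> ctens L 1 0" and b: "b \<in> ctens L 1 (- 1)" and r: "r \<in> ctens L 1 0"
    using ab rc by (auto simp: is_cell_def)
  \<comment> \<open>This is t c(s): the outer index \<open>i\<close> is the power of the flow
    variable s, the inner index \<open>j\<close> that of the cell variable t.\<close>
  define \<eta> where "\<eta> i j = (if j = 1 then c i else 0)" for i j :: nat
  have single: "(\<lambda>j::nat. if j = 1 then v else 0) \<in> ctens L k d" if "k \<ge> 1" "v \<in> Filt L k d" for k v d
    using that Filt_0 by (intro ctensI) (auto intro!: exI[of _ 2])
  have \<eta>: "\<eta> \<in> ctens ?P m (- 1)"
  proof (rule PL.ctensI)
    show "\<eta> i \<in> Filt ?P m (- 1)" for i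
      using single[OF m ctens_Filt[OF cm]] by (simp add: \<eta>_def[abs_def])
    fix k :: nat assume k: "k \<ge> 1"
    obtain N where "\<And>i. i \<ge> N \<Longrightarrow> c i \<in> Filt L k (- 1)" using ctens_tail[OF cm k] by blast
    then have "\<forall>i\<ge>N. \<eta> i \<in> Filt ?P k (- 1)" using single[OF k] by (simp add: \<eta>_def[abs_def])
    then show "\<exists>N. \<forall>i\<ge>N. \<eta> i \<in> Filt ?P k (- 1)" by blast
  qed
  have \<eta>1: "\<eta> \<in> ctens ?P 1 (- 1)" using PL.ctens_mono[OF \<eta>] m by simp
  \<comment> \<open>The flow runs over \<open>polyL L\<close> with d/dt as its derivation. The
    changes of both components are integrals of terms containing \<eta> or its t-derivative, which
    gives their depth \<open>m\<close>.\<close>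
  obtain \<alpha> \<beta> where \<alpha>: "\<alpha> \<in> ctens ?P 1 0" and \<beta>: "\<beta> \<in> ctens ?P 1 (- 1)"
    and \<alpha>_eq: "\<alpha> = const_t a + pint ?P (tw (polyL ?P) \<alpha> [(- 1, \<eta>)])"
    and flat: "tw (polyL ?P) \<alpha> [] = 0" and cell: "lift (pderiv_t L) 0 \<alpha> = tw (polyL ?P) \<alpha> [(- 1, \<beta>)]"
    and \<alpha>m: "\<alpha> - const_t a \<in> ctens ?P m 0" and \<beta>m: "\<beta> - const_t b \<in> ctens ?P m (- 1)"
    by (rule T.gauge_flow[of a b \<eta> m]) (use ab \<eta> m in \<open>auto simp: is_cell_def\<close>)
  interpret S: Linf_map "polyL ?P" ?P "\<lambda>d. ev ?P d 1" by (rule PL.ev_Linf_map)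
  let ?a = "ev ?P 0 1 \<alpha>" and ?b = "ev ?P (- 1) 1 \<beta>"
  have am: "?a - a \<in> ctens L m 0"
    using S.in_Filt[OF m, of "\<alpha> - const_t a" 0] \<alpha>m S.diff[of \<alpha> 0 "const_t a"] \<alpha>
      PL.const_t_ctens[of 1 a 0] PL.ev_const[of a 0 1] a by simp
  have bm: "?b - b \<in> ctens L m (- 1)"
    using S.in_Filt[OF m, of "\<beta> - const_t b" "- 1"] \<beta>m S.diff[of \<beta> "- 1" "const_t b"] \<beta>
      PL.const_t_ctens[of 1 b "- 1"] PL.ev_const[of b "- 1" 1] b by simp
  have cell': "is_cell L ?a ?b"
    unfolding is_cell_def
  proof (intro conjI)
    show "?a \<in> ctens L 1 0" "?b \<in> ctens L 1 (- 1)" using S.in_Gr \<alpha> \<beta> by auto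
    show "tw ?P ?a [] = 0" using S.tw[of \<alpha> "[]"] \<alpha> flat S.zero by simp
    \<comment> \<open>Differentiation in t is continuous, hence commutes with setting s = 1.\<close>
    have "pderiv_t L 0 ?a = ev ?P 0 1 (lift (pderiv_t L) 0 \<alpha>)"
      using T.D.fsum[of \<alpha> 0] \<alpha> by (simp add: ev_def lift_def)
    also have "\<dots> = tw ?P ?a [(- 1, ?b)]"
      unfolding cell using S.tw[of \<alpha> "[(- 1, \<beta>)]"] \<alpha> \<beta> by simp
    finally show "pderiv_t L 0 ?a = tw ?P ?a [(- 1, ?b)]" .
  qed
  \<comment> \<open>The two evaluations are exchanged. Freezing t instead of s leaves a path in s
    over \<open>L\<close> that solves the flow equation with generator t c(s) and starting point
    a(t).\<close>
  have at: "ev L 0 t ?a = ev L 0 1 (lift (\<lambda>d. ev L d t) 0 \<alpha>)"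
    and flow: "lift (\<lambda>d. ev L d t) 0 \<alpha> \<in> ctens L 1 0"
      "const_t (ev L 0 t a) + pint L (tw ?P (lift (\<lambda>d. ev L d t) 0 \<alpha>) [(- 1, \<lambda>i. Scal L t (c i))]) =
        lift (\<lambda>d. ev L d t) 0 \<alpha>" for t
  proof -
    interpret E: Linf_map ?P L "\<lambda>d. ev L d t" by (rule ev_Linf_map)
    interpret EE: Linf_map "polyL ?P" ?P "lift (\<lambda>d. ev L d t)" by (rule Linf_map_lift) unfold_locales
    show "ev L 0 t ?a = ev L 0 1 (lift (\<lambda>d. ev L d t) 0 \<alpha>)"
      using E.fsum[of \<alpha> 0] \<alpha> by (simp add: ev_def[of ?P] ev_def[of L 0 1] lift_def)
    show "lift (\<lambda>d. ev L d t) 0 \<alpha> \<in> ctens L 1 0" using EE.in_Gr[of \<alpha> 0] \<alpha> by simp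
    have "lift (\<lambda>d. ev L d t) (- 1) \<eta> = (\<lambda>i. Scal L t (c i))"
    proof
      fix i
      have "ev L (- 1) t (\<eta> i) = (\<Sum>j<2. Scal L (t ^ j) (\<eta> i j))"
        unfolding ev_def by (rule fsum_finite) (use ctens_Gr rc Gr_0 Gr_scale in \<open>auto simp: \<eta>_def is_cell_def\<close>)
      then show "lift (\<lambda>d. ev L d t) (- 1) \<eta> i = Scal L t (c i)"
        by (simp add: \<eta>_def numeral_2_eq_2)
    qed
    then have "lift (\<lambda>d. ev L d t) 0 (tw (polyL ?P) \<alpha> [(- 1, \<eta>)]) =
        tw ?P (lift (\<lambda>d. ev L d t) 0 \<alpha>) [(- 1, \<lambda>i. Scal L t (c i))]"
      using EE.tw[of \<alpha> "[(- 1, \<eta>)]"] \<alpha> \<eta>1 by simp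
    moreover have "lift (\<lambda>d. ev L d t) 0 (const_t a + pint ?P (tw (polyL ?P) \<alpha> [(- 1, \<eta>)])) =
        const_t (ev L 0 t a) + pint L (lift (\<lambda>d. ev L d t) 0 (tw (polyL ?P) \<alpha> [(- 1, \<eta>)]))"
      by (rule E.lift_const_pint) (use a PPL.tw_Gr[of \<alpha> "[(- 1, \<eta>)]"] \<alpha> \<eta>1 in auto)
    ultimately show "const_t (ev L 0 t a) + pint L (tw ?P (lift (\<lambda>d. ev L d t) 0 \<alpha>) [(- 1, \<lambda>i. Scal L t (c i))]) =
        lift (\<lambda>d. ev L d t) 0 \<alpha>"
      using \<alpha>_eq by simp
  qed
  have zero: "ev L 0 0 ?a = ev L 0 0 a"
  proof -
    have "tw ?P x [(- 1, 0)] = 0" if "x \<in> ctens L 1 0" for x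
      using PL.tw_zero[of x "[]" "[]" "- 1"] that by simp
    moreover have "pint L 0 = 0" by (auto simp: pint_def fun_eq_iff split: nat.split)
    moreover have "(\<lambda>i. Scal L 0 (c i)) = 0" by auto
    ultimately have "lift (\<lambda>d. ev L d 0) 0 \<alpha> = const_t (ev L 0 0 a)"
      using flow[of 0] by simp
    then show ?thesis using at[of 0] ev_const[OF ev_Gr[OF a], of 1 0] by simp
  qed
  have one: "ev L 0 1 ?a = ev L 0 1 r"
  proof -
    have "const_t (ev L 0 1 a) + pint L (tw ?P r [(- 1, c)]) = r"
      using pint_pderiv_t[of r 0] rc ends ev_0[OF r] by (simp add: is_cell_def)
    then have "lift (\<lambda>d. ev L d 1) 0 \<alpha> = r"
      using flow_unique_ex[OF ev_Gr[OF a, of 1] ctens_mono[OF cm order_refl m]] flow[of 1] r by auto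
    then show ?thesis using at[of 1] by simp
  qed
  show thesis by (rule that[OF cell' zero one am bm])
qed

section \<open>Comparison with Maurer-Cartan elements over the forms on the interval\<close>

lemma fsum_tensor_Omega1:
  assumes "g \<in> ctens (polyL L) 1 d" "h \<in> ctens (polyL L) 1 (d - 1)"
  shows "fsum (tensor_Omega1 L) d (\<lambda>n. (g n, h n)) = (fsum (polyL L) d g, fsum (polyL L) (d - 1) h)"
proof -
  interpret PL: Linf_char0 "polyL L" by (rule poly_Linf)
  have sum: "(\<Sum>i<n. (g i, h i)) = (\<Sum>i<n. g i, \<Sum>i<n. h i)" for n
    by (induction n) (auto simp: zero_prod_def)
  \<comment> \<open>The sum of pairs is computed from its definition: convergence is componentwise,
    and uniqueness in each component comes from the polynomials over \<open>L\<close>.\<close>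
  show ?thesis
    unfolding fsum_def[of "tensor_Omega1 L"]
  proof (rule the_equality)
    have "\<exists>N. \<forall>n\<ge>N. (\<Sum>i<n. (g i, h i)) - (fsum (polyL L) d g, fsum (polyL L) (d - 1) h) \<in> Filt (tensor_Omega1 L) k d"
      if k: "k \<ge> 1" for k
    proof -
      obtain M N where "\<forall>n\<ge>M. (\<Sum>i<n. g i) - fsum (polyL L) d g \<in> ctens L k d"
        "\<forall>n\<ge>N. (\<Sum>i<n. h i) - fsum (polyL L) (d - 1) h \<in> ctens L k (d - 1)"
        using PL.fsum_lim[OF assms(1) k] PL.fsum_lim[OF assms(2) k] by auto
      then show ?thesis by (intro exI[of _ "max M N"]) (simp add: tensor_Omega1_def sum)
    qed
    then show "(fsum (polyL L) d g, fsum (polyL L) (d - 1) h) \<in> Gr (tensor_Omega1 L) d \<and>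
      (\<forall>k\<ge>1. \<exists>N. \<forall>n\<ge>N. (\<Sum>i<n. (g i, h i)) - (fsum (polyL L) d g, fsum (polyL L) (d - 1) h) \<in> Filt (tensor_Omega1 L) k d)"
      using PL.fsum_Gr[OF assms(1)] PL.fsum_Gr[OF assms(2)] by (simp add: tensor_Omega1_def)
    fix v assume v: "v \<in> Gr (tensor_Omega1 L) d \<and>
      (\<forall>k\<ge>1. \<exists>N. \<forall>n\<ge>N. (\<Sum>i<n. (g i, h i)) - v \<in> Filt (tensor_Omega1 L) k d)"
    obtain x y where xy: "v = (x, y)" by force
    have lim: "\<exists>N. \<forall>n\<ge>N. (\<Sum>i<n. g i) - x \<in> ctens L k d \<and> (\<Sum>i<n. h i) - y \<in> ctens L k (d - 1)" if "k \<ge> 1" for k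
      using v that by (simp add: tensor_Omega1_def sum xy)
    have xy_in: "x \<in> Gr (polyL L) d" "y \<in> Gr (polyL L) (d - 1)"
      using v by (auto simp: tensor_Omega1_def xy)
    have "fsum (polyL L) d g = x"
      by (rule PL.fsum_eqI[OF assms(1) xy_in(1)]) (use lim in \<open>unfold polyL_simps, blast\<close>)
    moreover have "fsum (polyL L) (d - 1) h = y"
      by (rule PL.fsum_eqI[OF assms(2) xy_in(2)]) (use lim in \<open>unfold polyL_simps, blast\<close>)
    ultimately show "v = (fsum (polyL L) d g, fsum (polyL L) (d - 1) h)" by (simp add: xy)
  qed
qed

text \<open>The part free of dt is the curvature of \<open>a\<close>. In the dt part,
  \<open>n\<close> equal contributions divided by \<open>n!\<close> leave \<open>1/(n-1)!\<close>,
  which is the series of the twisted differential of \<open>b\<close>.\<close>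

lemma curv_tensor_Omega1:
  assumes a: "a \<in> ctens L 1 0" and b: "b \<in> ctens L 1 (- 1)"
  shows "curv (tensor_Omega1 L) (a, b) = (tw (polyL L) a [], pderiv_t L 0 a - tw (polyL L) a [(- 1, b)])"
proof -
  let ?P = "polyL L"
  interpret PL: Linf_char0 ?P by (rule poly_Linf)
  define g where "g j = Scal ?P (1 / fact (j + 2)) (op0 ?P (replicate (j + 2) (0, a)))" for j
  define F where "F k = Scal ?P (1 / fact k) (op0 ?P (replicate k (0, a) @ [(- 1, b)]))" for k
  have G: "(\<lambda>k. Scal ?P (1 / fact k) (op0 ?P (replicate k (0, a) @ []))) \<in> ctens ?P 1 1"
    using PL.tw_ctens_1[of a "[]"] a by simp
  have g: "g \<in> ctens ?P 1 1"
    using PL.ctens_shift[OF PL.ctens_shift[OF G]] by (simp add: g_def[abs_def] del: polyL_simps)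
  have F: "F \<in> ctens ?P 1 0" using PL.tw_ctens_1[of a "[(- 1, b)]"] a b by (simp add: F_def[abs_def] del: polyL_simps(1))
  have FS: "(\<lambda>j. F (Suc j)) \<in> ctens ?P 1 0" by (rule PL.ctens_shift[OF F])
  have neg: "(\<lambda>j. - F (Suc j)) = (\<lambda>j. Scal ?P (- 1) (F (Suc j)))" by (auto simp: fun_eq_iff)
  have mF: "(\<lambda>j. - F (Suc j)) \<in> ctens ?P 1 (1 - 1)"
    unfolding neg using PL.ctens_scale_coeff[OF _ FS, of "\<lambda>_. - 1"] by simp
  \<comment> \<open>All entries have degree 0, so dt picks up only the sign of passing the bracket,
    wherever it stands, and \<open>b\<close> can be moved to the end freely.\<close>
  have brk: "Brk (tensor_Omega1 L) (replicate n (0, (a, b))) =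
      (op0 ?P (replicate n (0, a)), - Scal ?P (of_nat n) (op0 ?P (replicate (n - 1) (0, a) @ [(- 1, b)])))"
    if n: "n \<ge> 2" for n
  proof -
    let ?h = "map (\<lambda>(d :: int, a :: nat \<Rightarrow> 'v, b :: nat \<Rightarrow> 'v). (d, a))"
    have "signed (1 + total_deg (take j (replicate n (0, (a, b))))) (Brk_t L (?h (take j (replicate n (0, (a, b))))
           @ (\<lambda>(d, a, b). (d - 1, b)) (replicate n (0, (a, b)) ! j) # ?h (drop (Suc j) (replicate n (0, (a, b)))))) =
        - op0 ?P (replicate (n - 1) (0, a) @ [(- 1, b)])" if j: "j < n" for j
    proof -
      have "op0 ?P (replicate j (0, a) @ (- 1, b) # replicate (n - 1 - j) (0, a) @ []) =
          op0 ?P (replicate j (0, a) @ replicate (n - 1 - j) (0, a) @ (- 1, b) # [])"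
        by (rule PL.op0_move[symmetric]) (use a b in auto)
      also have "replicate j (0, a) @ replicate (n - 1 - j) (0, a) @ (- 1, b) # [] =
          replicate (n - 1) (0, a) @ [(- 1, b)]"
        using j by (simp flip: append_assoc replicate_add)
      finally have "Brk_t L (replicate j (0, a) @ (- 1, b) # replicate (n - 1 - j) (0, a)) =
          op0 ?P (replicate (n - 1) (0, a) @ [(- 1, b)])"
        using n j by (simp add: op0_Brk)
      then show ?thesis using j by (simp add: min_def signed_def)
    qed
    then have "snd (Brk (tensor_Omega1 L) (replicate n (0, (a, b)))) =
        (\<Sum>j<n. - op0 ?P (replicate (n - 1) (0, a) @ [(- 1, b)]))"
      by (simp add: tensor_Omega1_def)
    also have "\<dots> = - Scal ?P (of_nat n) (op0 ?P (replicate (n - 1) (0, a) @ [(- 1, b)]))"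
      by (simp only: sum_negf P.sum_constant_scale card_lessThan)
    moreover have "fst (Brk (tensor_Omega1 L) (replicate n (0, (a, b)))) = op0 ?P (replicate n (0, a))"
      using n by (simp add: tensor_Omega1_def op0_Brk)
    ultimately show ?thesis by (simp only: prod_eq_iff fst_conv snd_conv)
  qed
  have "Scal (tensor_Omega1 L) (1 / fact (j + 2)) (Brk (tensor_Omega1 L) (replicate (j + 2) (0, (a, b)))) =
      (g j, - F (Suc j))" for j
  proof -
    have c: "(1 / fact (j + 2)) * of_nat (j + 2) = (1 / fact (Suc j) :: 'k)"
      by (simp add: divide_simps del: of_nat_Suc of_nat_add)
    have "Scal ?P (1 / fact (j + 2)) (- Scal ?P (of_nat (j + 2)) (op0 ?P (replicate (j + 2 - 1) (0, a) @ [(- 1, b)])))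
        = - F (Suc j)"
      by (simp only: P.scale_minus_right P.scale_scale c F_def) simp
    moreover have "Scal (tensor_Omega1 L) s (x, y) = (Scal ?P s x, Scal ?P s y)" for s x y
      by (simp add: tensor_Omega1_def)
    ultimately show ?thesis by (simp only: brk g_def le_add2)
  qed
  then have "curv (tensor_Omega1 L) (a, b) = Diff (tensor_Omega1 L) 0 (a, b) + (fsum ?P 1 g, fsum ?P 0 (\<lambda>j. - F (Suc j)))"
    using fsum_tensor_Omega1[OF g mF] by (simp add: curv_def)
  moreover have "Diff (tensor_Omega1 L) 0 (a, b) = (Diff ?P 0 a, pderiv_t L 0 a - Diff ?P (- 1) b)"
    by (simp add: tensor_Omega1_def pderiv_t_def fun_eq_iff)
  moreover have "Diff ?P 0 a + fsum ?P 1 g = tw ?P a []"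
    using PL.curv_eq_tw[of a] a by (simp add: curv_def g_def[abs_def] op0_Brk)
  moreover have "fsum ?P 0 (\<lambda>j. - F (Suc j)) = - fsum ?P 0 (\<lambda>j. F (Suc j))"
    unfolding neg PL.fsum_scale[OF FS, symmetric] by (simp add: fun_eq_iff)
  moreover have "tw ?P a [(- 1, b)] = Diff ?P (- 1) b + fsum ?P 0 (\<lambda>j. F (Suc j))"
  proof -
    have "tw ?P a [(- 1, b)] = fsum ?P 0 F" by (simp add: tw_def F_def[abs_def])
    also have "\<dots> = F 0 + fsum ?P 0 (\<lambda>j. F (Suc j))" by (rule PL.fsum_Suc[OF F])
    also have "F 0 = Diff ?P (- 1) b" by (simp add: F_def op0_single)
    finally show ?thesis .
  qed
  ultimately show ?thesis by (simp add: algebra_simps)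
qed

lemma MC_cells1_iff: "(a, b) \<in> MC_cells1 L \<longleftrightarrow> is_cell L a b"
proof -
  have "(a, b) \<in> MC_cells1 L \<longleftrightarrow> a \<in> ctens L 1 0 \<and> b \<in> ctens L 1 (- 1) \<and> curv (tensor_Omega1 L) (a, b) = 0"
    by (auto simp: MC_cells1_def MC_def tensor_Omega1_def)
  also have "\<dots> \<longleftrightarrow> is_cell L a b"
    using curv_tensor_Omega1[of a b] by (auto simp: is_cell_def zero_prod_def)
  finally show ?thesis .
qed

end

theorem lemmaC1:
  fixes L :: "('k::field_char_0, 'v::ab_group_add) Linf"
    and \<rho> :: "nat \<Rightarrow> (nat \<Rightarrow> 'v) \<times> (nat \<Rightarrow> 'v)"
  assumes "filtered_shifted_Linf L"
    and "\<And>n. n \<ge> 1 \<Longrightarrow> \<rho> n \<in> MC_cells1 L"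
    and "\<And>n. n \<ge> 1 \<Longrightarrow> snd (\<rho> n) \<in> ctens L n (- 1)"
    and "\<And>n. n \<ge> 1 \<Longrightarrow> ev L 0 1 (fst (\<rho> n)) = ev L 0 0 (fst (\<rho> (n + 1)))"
  shows "\<exists>\<gamma> :: nat \<Rightarrow> (nat \<Rightarrow> 'v) \<times> (nat \<Rightarrow> 'v). \<forall>n\<ge>1.
    \<gamma> n \<in> MC_cells1 L \<and>
    ev L 0 0 (fst (\<gamma> n)) = ev L 0 0 (fst (\<rho> 1)) \<and>
    ev L 0 1 (fst (\<gamma> n)) = ev L 0 1 (fst (\<rho> n)) \<and>
    \<gamma> (n + 1) - \<gamma> n \<in> Filt (tensor_Omega1 L) (n + 1) 0"
proof -
  interpret Linf_char0 L using assms(1) by (simp add: Linf_char0_def)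
  \<comment> \<open>Choice starts at index 0: the cell chosen at \<open>n\<close> ends where
    \<open>\<rho> (Suc n)\<close> ends, and the next one absorbs \<open>\<rho> (n + 2)\<close>,
    whose dt component has depth \<open>n + 2\<close>. The final sequence is shifted back by
    one.\<close>
  let ?Q = "\<lambda>n \<gamma>. \<gamma> \<in> MC_cells1 L \<and> ev L 0 0 (fst \<gamma>) = ev L 0 0 (fst (\<rho> 1)) \<and>
    ev L 0 1 (fst \<gamma>) = ev L 0 1 (fst (\<rho> (Suc n)))"
  have "\<exists>\<gamma>. \<forall>n. ?Q n (\<gamma> n) \<and> \<gamma> (Suc n) - \<gamma> n \<in> Filt (tensor_Omega1 L) (n + 2) 0"
  proof (rule dependent_nat_choice)
    show "\<exists>\<gamma>. ?Q 0 \<gamma>" using assms(2)[of 1] by (intro exI[of _ "\<rho> 1"]) simp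
    fix \<gamma> n assume Q: "?Q n \<gamma>"
    obtain a b r c where eq: "\<gamma> = (a, b)" "\<rho> (n + 2) = (r, c)" by (metis surj_pair)
    obtain a' b' where "is_cell L a' b'" "ev L 0 0 a' = ev L 0 0 a" "ev L 0 1 a' = ev L 0 1 r"
      "a' - a \<in> ctens L (n + 2) 0" "b' - b \<in> ctens L (n + 2) (- 1)"
      by (rule cell_extend[of a b r c "n + 2"])
        (use Q assms(2)[of "n + 2"] assms(3)[of "n + 2"] assms(4)[of "Suc n"] eq in \<open>auto simp: MC_cells1_iff\<close>)
    then show "\<exists>\<gamma>'. ?Q (Suc n) \<gamma>' \<and> \<gamma>' - \<gamma> \<in> Filt (tensor_Omega1 L) (n + 2) 0"
      using Q eq by (intro exI[of _ "(a', b')"]) (auto simp: MC_cells1_iff tensor_Omega1_def)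
  qed
  then obtain \<gamma> where \<gamma>: "\<And>n. ?Q n (\<gamma> n) \<and> \<gamma> (Suc n) - \<gamma> n \<in> Filt (tensor_Omega1 L) (n + 2) 0"
    by blast
  show ?thesis
  proof (intro exI[of _ "\<lambda>n. \<gamma> (n - 1)"] allI impI)
    fix n :: nat assume "n \<ge> 1"
    then obtain m where "n = Suc m" by (cases n) auto
    then show "\<gamma> (n - 1) \<in> MC_cells1 L \<and> ev L 0 0 (fst (\<gamma> (n - 1))) = ev L 0 0 (fst (\<rho> 1)) \<and>
      ev L 0 1 (fst (\<gamma> (n - 1))) = ev L 0 1 (fst (\<rho> n)) \<and>
      \<gamma> (n + 1 - 1) - \<gamma> (n - 1) \<in> Filt (tensor_Omega1 L) (n + 1) 0"
      using \<gamma>[of m] by simp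
  qed
qed

end
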